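(* For any open cover $\{U_i\}_{i\in I}$ of a cartesian space $\mathbf R^n$ we can find a diffeomorphism $f\colon\mathbf R^n\to\mathbf R^n$ such that the image of the cover $\{U_i\}_{i\in I}$ under $f$ has Lebesgue number $1$ or higher, meaning that the $f$-preimage of any open ball of radius $1$ is a subset of some $U_i$ ($i\in I$). A similar statement holds for smooth or topological manifolds $M$, where $f$ is now a proper embedding: for any open cover $\{U_i\}_{i\in I}$ of $M$ we can find a proper embedding $f\colon M\to\mathbf R^n$ into some cartesian space $\mathbf R^n$ such that the $f$-preimage of any open ball of radius $1$ in $\mathbf R^n$ is a subset of some $U_i$ ($i\in I$).
   Context: Manifolds (topological or smooth) are always assumed to be paracompact and Hausdorff. A cartesian space is a space $\mathbf R^n$. A proper embedding is an embedding (a smooth embedding if $M$ is a smooth manifold, a topological embedding if $M$ is a topological manifold) that is a proper map.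
   Formalization: For manifolds M, it is additionally assumed that M has at most countably many connected components (an uncountable discrete M embeds in no R^n) and that the index set I is nonempty (relevant only for empty M with the empty cover). *)

theory Defs
  imports "HOL-Analysis.Analysis"
begin

section \<open>Cartesian spaces\<close>

text \<open>
  The cartesian space of dimension n is the library's \<^const>\<open>Euclidean_space\<close> n: sequences of reals
  that vanish from index n on. The dimension is therefore an ordinary natural number, possibly 0,
  over which one can quantify.
\<close>

abbreviation cartesian :: "nat \<Rightarrow> (nat \<Rightarrow> real) set"
  where "cartesian n \<equiv> topspace (Euclidean_space n)"

definition eucl_dist :: "nat \<Rightarrow> (nat \<Rightarrow> real) \<Rightarrow> (nat \<Rightarrow> real) \<Rightarrow> real"
  where "eucl_dist n x y = sqrt (\<Sum>i<n. (x i - y i)\<^sup>2)"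

definition eucl_ball :: "nat \<Rightarrow> (nat \<Rightarrow> real) \<Rightarrow> real \<Rightarrow> (nat \<Rightarrow> real) set"
  where "eucl_ball n c r = {y \<in> cartesian n. eucl_dist n c y < r}"

section \<open>Smooth maps between open subsets of cartesian spaces\<close>

definition partial_deriv :: "nat \<Rightarrow> ((nat \<Rightarrow> real) \<Rightarrow> real) \<Rightarrow> (nat \<Rightarrow> real) \<Rightarrow> real"
  where "partial_deriv i f x = deriv (\<lambda>t. f (x(i := t))) (x i)"

text \<open>
  Class \<open>C\<^sup>k\<close> on a subset S of the cartesian space of dimension m; only used for S open there. Only the
  values of f on S matter.
\<close>

primrec Ck_on :: "nat \<Rightarrow> nat \<Rightarrow> (nat \<Rightarrow> real) set \<Rightarrow> ((nat \<Rightarrow> real) \<Rightarrow> real) \<Rightarrow> bool"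
  where
    "Ck_on 0 m S f \<longleftrightarrow> continuous_map (subtopology (Euclidean_space m) S) euclideanreal f"
  | "Ck_on (Suc k) m S f \<longleftrightarrow>
       continuous_map (subtopology (Euclidean_space m) S) euclideanreal f \<and>
       (\<forall>i<m. (\<forall>x\<in>S. (\<lambda>t. f (x(i := t))) field_differentiable at (x i)) \<and>
               Ck_on k m S (partial_deriv i f))"

definition smooth_on ::
    "nat \<Rightarrow> (nat \<Rightarrow> real) set \<Rightarrow> nat \<Rightarrow> ((nat \<Rightarrow> real) \<Rightarrow> (nat \<Rightarrow> real)) \<Rightarrow> bool"
  where "smooth_on m S n f \<longleftrightarrow>
    f ` S \<subseteq> cartesian n \<and> (\<forall>j<n. \<forall>k. Ck_on k m S (\<lambda>x. f x j))"

definition diffeomorphism :: "nat \<Rightarrow> ((nat \<Rightarrow> real) \<Rightarrow> (nat \<Rightarrow> real)) \<Rightarrow> bool"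
  where "diffeomorphism n f \<longleftrightarrow>
    bij_betw f (cartesian n) (cartesian n) \<and>
    smooth_on n (cartesian n) n f \<and>
    smooth_on n (cartesian n) n (inv_into (cartesian n) f)"

text \<open>The derivative of f at x, i.e. the linear map given by the Jacobian matrix, is injective.\<close>

definition injective_deriv_at ::
    "nat \<Rightarrow> nat \<Rightarrow> ((nat \<Rightarrow> real) \<Rightarrow> (nat \<Rightarrow> real)) \<Rightarrow> (nat \<Rightarrow> real) \<Rightarrow> bool"
  where "injective_deriv_at m n f x \<longleftrightarrow>
    (\<forall>v\<in>cartesian m.
       (\<forall>j<n. (\<Sum>i<m. v i * partial_deriv i (\<lambda>y. f y j) x) = 0) \<longrightarrow> v = (\<lambda>i. 0))"

section \<open>Open covers and paracompactness\<close>

definition open_cover :: "'a topology \<Rightarrow> 'i set \<Rightarrow> ('i \<Rightarrow> 'a set) \<Rightarrow> bool"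
  where "open_cover X I U \<longleftrightarrow> (\<forall>i\<in>I. openin X (U i)) \<and> (\<Union>i\<in>I. U i) = topspace X"

definition paracompact_space :: "'a topology \<Rightarrow> bool"
  where "paracompact_space X \<longleftrightarrow>
    (\<forall>\<U>. (\<forall>U\<in>\<U>. openin X U) \<and> \<Union>\<U> = topspace X \<longrightarrow>
       (\<exists>\<V>. (\<forall>V\<in>\<V>. openin X V) \<and> \<Union>\<V> = topspace X \<and>
            (\<forall>V\<in>\<V>. \<exists>U\<in>\<U>. V \<subseteq> U) \<and> locally_finite_in X \<V>))"

text \<open>
  The preimage under f of every open ball of radius 1 is contained in a member of the cover; that
  is, the image of the cover under f has Lebesgue number at least 1.
\<close>

definition unit_ball_preimages_subordinate ::
    "'a topology \<Rightarrow> 'i set \<Rightarrow> ('i \<Rightarrow> 'a set) \<Rightarrow> nat \<Rightarrow> ('a \<Rightarrow> (nat \<Rightarrow> real)) \<Rightarrow> bool"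
  where "unit_ball_preimages_subordinate X I U n f \<longleftrightarrow>
    (\<forall>c\<in>cartesian n. \<exists>i\<in>I. {x \<in> topspace X. f x \<in> eucl_ball n c 1} \<subseteq> U i)"

section \<open>Topological and smooth manifolds\<close>

text \<open>
  Charts are pairs (V, p) of an open set V and a homeomorphism p from V onto an open subset of the
  cartesian space of dimension d. Values of p outside V are irrelevant.
\<close>

definition is_chart :: "nat \<Rightarrow> 'a topology \<Rightarrow> 'a set \<times> ('a \<Rightarrow> (nat \<Rightarrow> real)) \<Rightarrow> bool"
  where "is_chart d X = (\<lambda>(V, p).
    openin X V \<and> openin (Euclidean_space d) (p ` V) \<and>
    homeomorphic_map (subtopology X V) (subtopology (Euclidean_space d) (p ` V)) p)"

text \<open>
  Manifolds are paracompact and Hausdorff of a fixed dimension d. Paracompactness still allows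
  uncountably many connected components; a manifold of that kind embeds into no cartesian space.
\<close>

definition topological_manifold :: "nat \<Rightarrow> 'a topology \<Rightarrow> bool"
  where "topological_manifold d X \<longleftrightarrow>
    Hausdorff_space X \<and> paracompact_space X \<and>
    (\<forall>x\<in>topspace X. \<exists>V p. is_chart d X (V, p) \<and> x \<in> V)"

text \<open>
  A smooth structure is given by any smooth atlas, not necessarily a maximal one; the notions below
  depend only on the maximal atlas it generates.
\<close>

definition smooth_atlas ::
    "nat \<Rightarrow> 'a topology \<Rightarrow> ('a set \<times> ('a \<Rightarrow> (nat \<Rightarrow> real))) set \<Rightarrow> bool"
  where "smooth_atlas d X A \<longleftrightarrow>
    (\<forall>c\<in>A. is_chart d X c) \<and> (\<Union>(V, p)\<in>A. V) = topspace X \<and>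
    (\<forall>(V, p)\<in>A. \<forall>(W, q)\<in>A. smooth_on d (p ` (V \<inter> W)) d (q \<circ> inv_into V p))"

definition smooth_manifold ::
    "nat \<Rightarrow> 'a topology \<Rightarrow> ('a set \<times> ('a \<Rightarrow> (nat \<Rightarrow> real))) set \<Rightarrow> bool"
  where "smooth_manifold d X A \<longleftrightarrow>
    Hausdorff_space X \<and> paracompact_space X \<and> smooth_atlas d X A"

definition topological_proper_embedding ::
    "'a topology \<Rightarrow> nat \<Rightarrow> ('a \<Rightarrow> (nat \<Rightarrow> real)) \<Rightarrow> bool"
  where "topological_proper_embedding X n f \<longleftrightarrow>
    embedding_map X (Euclidean_space n) f \<and> proper_map X (Euclidean_space n) f"

text \<open>A smooth embedding is a smooth immersion that is a topological embedding.\<close>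

definition smooth_immersion ::
    "nat \<Rightarrow> ('a set \<times> ('a \<Rightarrow> (nat \<Rightarrow> real))) set \<Rightarrow> nat \<Rightarrow> ('a \<Rightarrow> (nat \<Rightarrow> real)) \<Rightarrow> bool"
  where "smooth_immersion d A n f \<longleftrightarrow>
    (\<forall>(V, p)\<in>A. smooth_on d (p ` V) n (f \<circ> inv_into V p) \<and>
       (\<forall>y\<in>p ` V. injective_deriv_at d n (f \<circ> inv_into V p) y))"

definition smooth_proper_embedding ::
    "nat \<Rightarrow> 'a topology \<Rightarrow> ('a set \<times> ('a \<Rightarrow> (nat \<Rightarrow> real))) set \<Rightarrow> nat \<Rightarrow>
     ('a \<Rightarrow> (nat \<Rightarrow> real)) \<Rightarrow> bool"
  where "smooth_proper_embedding d X A n f \<longleftrightarrow>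
    smooth_immersion d A n f \<and>
    embedding_map X (Euclidean_space n) f \<and> proper_map X (Euclidean_space n) f"

end

(*
  In R^n the diffeomorphism is radial, x |-> phi(|x|^2) x with phi nondecreasing and growing fast
  enough: |f x - f y| >= phi(min(|x|^2, |y|^2)) |x - y|, so the preimage of a unit ball is smaller
  than the Lebesgue number of the cover on the relevant ball around 0.  The inverse is
  y |-> y / phi(H(|y|^2)) with H inverse to t |-> t phi(t)^2, a one-dimensional inverse function.

  For a manifold of dimension d, covering dimension (with the crude bound 2^d for the order, from a
  grid coloured by parity) yields a refinement of the cover by relatively compact chart pieces in
  finitely many colours, the pieces of one colour being disjoint and locally finite.  With cut-off
  functions equal to 1 on cores that still cover, each colour contributes to the map the cut-off
  chart coordinates, the scaled cut-off function, and the cut-off function times 4^(j+1) on the j-th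
  piece.  If x lies in the core of a piece and |f x - f y| < 2 then y lies in the same piece; this
  gives the statement on unit balls, injectivity and properness at once.
*)
theory Submission
  imports Defs
begin

text \<open>The target dimension has to be finite although the cover may need infinitely many chart
  pieces. Coordinates can therefore be spent only per colour: all pieces of one colour share
  \<open>d + 2\<close> of them, and the map goes into dimension 3 * 2^d * (d + 2). The factor 3
  comes from the shells of a compact exhaustion. Dimension theory is confined to compact sets inside
  charts, where a Lebesgue number and finite subfamilies are at hand.

  The threshold 2 comes from two points of a unit ball being less than 2 apart. It explains the
  expansion factor 2 / \<epsilon> in the cartesian case, and the plateau value 4 and the base 4 of
  the tags on manifolds.

  Differentiability is given by iterated derivatives of one-variable slices, so the chain rule has
  to be derived from the mean value theorem. The cut-off functions are smooth functions of chart
  coordinates, and compatibility of charts is used only for smoothness and immersion; hence one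
  construction serves topological and smooth manifolds. Nonemptiness of the index set enters through
  balls that miss the image.\<close>

lemma compactin_choose_finite:
  assumes K: "compactin X K" and N: "\<And>x. x \<in> K \<Longrightarrow> openin X (N x) \<and> x \<in> N x"
  obtains T where "finite T" "T \<subseteq> K" "K \<subseteq> (\<Union>x\<in>T. N x)"
proof -
  have "\<exists>\<F>. finite \<F> \<and> \<F> \<subseteq> N ` K \<and> K \<subseteq> \<Union>\<F>"
    using N by (intro compactinD[OF K]) auto
  then obtain \<F> where \<F>: "finite \<F>" "\<F> \<subseteq> N ` K" "K \<subseteq> \<Union>\<F>" by blast
  moreover from finite_subset_image[OF this(1,2)] obtain T
    where "T \<subseteq> K" "finite T" "\<F> = N ` T" by blast
  ultimately show ?thesis by (intro that[of T]) simp_all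
qed

section \<open>Smooth functions on cartesian spaces\<close>

text \<open>Open balls of the maximum norm. They describe the topology inherited from the product
  directly, without passing through the Euclidean metric.\<close>

definition cube :: "nat \<Rightarrow> (nat \<Rightarrow> real) \<Rightarrow> real \<Rightarrow> (nat \<Rightarrow> real) set"
  where "cube d a r = {x \<in> cartesian d. \<forall>i<d. \<bar>x i - a i\<bar> < r}"

lemma cartesian_iff: "x \<in> cartesian d \<longleftrightarrow> (\<forall>i\<ge>d. x i = 0)"
  by (simp add: topspace_Euclidean_space)

lemma Euclidean_space_eq: "Euclidean_space d = top_of_set {x. \<forall>i\<ge>d. x i = 0}"
  by (simp add: Euclidean_space_def euclidean_product_topology)

lemma continuous_map_Euclidean_coord:
  "continuous_map (Euclidean_space d) euclideanreal (\<lambda>x. x i)"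
  unfolding Euclidean_space_eq continuous_map_iff_continuous
  by (rule continuous_on_subset[OF continuous_on_product_coordinates]) simp

lemma continuous_map_Euclidean_iff_coord:
  assumes "f ` topspace X \<subseteq> cartesian n"
  shows "continuous_map X (Euclidean_space n) f \<longleftrightarrow> (\<forall>j<n. continuous_map X euclideanreal (\<lambda>x. f x j))"
proof -
  have "f x = (\<lambda>i. if i < n then f x i else 0)" if "x \<in> topspace X" for x
    using assms that by (auto simp: fun_eq_iff image_subset_iff cartesian_iff)
  then have "continuous_map X (Euclidean_space n) f
      \<longleftrightarrow> continuous_map X (Euclidean_space n) (\<lambda>x i. if i < n then f x i else 0)"
    by (metis (no_types, lifting) continuous_map_eq)
  then show ?thesis by (simp add: continuous_map_componentwise_Euclidean_space)
qed

lemma openin_cube: "openin (Euclidean_space d) (cube d a r)"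
proof -
  have eq: "cube d a r = topspace (Euclidean_space d) \<inter>
      (\<Inter>i\<in>{..<d}. {x \<in> topspace (Euclidean_space d). x i \<in> {a i - r<..<a i + r}})"
    by (auto simp: cube_def abs_less_iff) (force simp: algebra_simps)+
  show ?thesis
  \<comment> \<open>For d = 0 the intersection runs over an empty family, and the cube is the whole
    one-point space.\<close>
  proof (cases "d = 0")
    case True
    then show ?thesis using eq by simp
  next
    case False
    then have "cube d a r = (\<Inter>i\<in>{..<d}. {x \<in> topspace (Euclidean_space d). x i \<in> {a i - r<..<a i + r}})"
      by (subst eq) auto
    also have "openin (Euclidean_space d) \<dots>"
      using False
      by (intro openin_INT2 openin_continuous_map_preimage[OF continuous_map_Euclidean_coord]) auto
    finally show ?thesis .
  qed
qed

lemma openin_Euclidean_iff_cube: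
  "openin (Euclidean_space d) S \<longleftrightarrow> S \<subseteq> cartesian d \<and> (\<forall>x\<in>S. \<exists>r>0. cube d x r \<subseteq> S)"
proof (intro iffI conjI ballI)
  assume S: "openin (Euclidean_space d) S"
  then show "S \<subseteq> cartesian d" by (rule openin_subset)
  fix x assume x: "x \<in> S"
  obtain T where T: "openin (powertop_real UNIV) T" "S = T \<inter> cartesian d"
    using S unfolding Euclidean_space_def openin_subtopology by (auto simp: topspace_Euclidean_space)
  then obtain U where U: "\<And>i. open (U i)" "x \<in> (\<Pi>\<^sub>E i\<in>UNIV. U i)" "(\<Pi>\<^sub>E i\<in>UNIV. U i) \<subseteq> T"
    using x unfolding openin_product_topology_alt by fastforce
  have "\<exists>r>0. \<forall>t. \<bar>t - x i\<bar> < r \<longrightarrow> t \<in> U i" for i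
  proof -
    have "x i \<in> U i" using U(2) by auto
    with U(1)[of i] show ?thesis unfolding open_dist dist_real_def by blast
  qed
  then obtain r where r: "\<And>i. r i > 0" "\<And>i t. \<bar>t - x i\<bar> < r i \<Longrightarrow> t \<in> U i" by metis
  \<comment> \<open>The element 1 keeps the set nonempty when d = 0.\<close>
  define R where "R = Min (insert 1 (r ` {..<d}))"
  have R0: "R > 0" unfolding R_def using r by (subst Min_gr_iff) auto
  have Rr: "R \<le> r i" if "i < d" for i unfolding R_def using that by (intro Min_le) auto
  have "cube d x R \<subseteq> S"
  proof
    fix y assume y: "y \<in> cube d x R"
    have "y i \<in> U i" for i
    proof (cases "i < d")
      case True
      then show ?thesis using y Rr[of i] r(2)[of "y i" i] unfolding cube_def by force
    next
      case False
      then have "y i = x i" using y x T(2) by (auto simp: cube_def cartesian_iff)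
      then show ?thesis using r by simp
    qed
    then show "y \<in> S" using U(3) T(2) y by (auto simp: cube_def)
  qed
  with R0 show "\<exists>r>0. cube d x r \<subseteq> S" by blast
next
  assume *: "S \<subseteq> cartesian d \<and> (\<forall>x\<in>S. \<exists>r>0. cube d x r \<subseteq> S)"
  show "openin (Euclidean_space d) S"
  proof (subst openin_subopen, intro ballI)
    fix x assume x: "x \<in> S"
    then obtain r where "r > 0" "cube d x r \<subseteq> S" using * by blast
    moreover have "x \<in> cube d x r" using x * \<open>r > 0\<close> by (auto simp: cube_def)
    ultimately show "\<exists>T. openin (Euclidean_space d) T \<and> x \<in> T \<and> T \<subseteq> S"
      using openin_cube by blast
  qed
qed

section \<open>Functions of class C^k: congruence and locality\<close>

lemma continuous_map_sub_Euclidean_iff: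
  assumes "S \<subseteq> cartesian m"
  shows "continuous_map (subtopology (Euclidean_space m) S) euclideanreal f \<longleftrightarrow> continuous_on S f"
  using assms
  by (simp add: Euclidean_space_eq subtopology_subtopology inf.absorb2)

lemma cartesian_upd: "x \<in> cartesian m \<Longrightarrow> i < m \<Longrightarrow> x(i := t) \<in> cartesian m"
  by (auto simp: cartesian_iff)

text \<open>A slice through a point of an open set stays in the set for a while. This is why partial
  derivatives depend only on the values on S.\<close>

lemma openin_Euclidean_eventually_upd:
  assumes "openin (Euclidean_space m) S" "x \<in> S" "i < m"
  shows "\<forall>\<^sub>F t in nhds (x i). x(i := t) \<in> S"
proof -
  obtain r where r: "r > 0" "cube m x r \<subseteq> S" and sub: "S \<subseteq> cartesian m"
    using assms openin_Euclidean_iff_cube by metis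
  have "x(i := t) \<in> S" if "\<bar>t - x i\<bar> < r" for t
    using r sub assms(2,3) that by (intro subsetD[OF r(2)]) (auto simp: cube_def cartesian_upd)
  then show ?thesis
    unfolding eventually_nhds_metric dist_real_def using r(1) by blast
qed

lemma Ck_on_imp_continuous_on:
  assumes "S \<subseteq> cartesian m" "Ck_on k m S f"
  shows "continuous_on S f"
  using assms by (cases k) (auto simp: continuous_map_sub_Euclidean_iff)

lemma Ck_on_Suc_D:
  "Ck_on (Suc k) m S f \<Longrightarrow> Ck_on k m S f"
  by (induction k arbitrary: f) auto

lemma Ck_on_le: "k \<le> l \<Longrightarrow> Ck_on l m S f \<Longrightarrow> Ck_on k m S f"
  by (induction rule: dec_induct) (auto simp del: Ck_on.simps dest: Ck_on_Suc_D)

lemma Ck_on_partial_deriv: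
  "Ck_on (Suc k) m S f \<Longrightarrow> i < m \<Longrightarrow> Ck_on k m S (partial_deriv i f)"
  by simp

lemma Ck_on_has_partial_deriv:
  assumes "Ck_on (Suc k) m S f" "i < m" "x \<in> S"
  shows "((\<lambda>t. f (x(i := t))) has_real_derivative partial_deriv i f x) (at (x i))"
  using assms by (simp add: partial_deriv_def DERIV_deriv_iff_field_differentiable)

lemma partial_deriv_cong:
  assumes "openin (Euclidean_space m) S" "\<And>x. x \<in> S \<Longrightarrow> f x = g x" "x \<in> S" "i < m"
  shows "partial_deriv i f x = partial_deriv i g x"
  unfolding partial_deriv_def
  using openin_Euclidean_eventually_upd[OF assms(1,3,4)] assms(2)
  by (intro deriv_cong_ev) (auto elim: eventually_mono)

lemma Ck_on_cong_imp:
  assumes "openin (Euclidean_space m) S" "\<And>x. x \<in> S \<Longrightarrow> f x = g x" "Ck_on k m S f"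
  shows "Ck_on k m S g"
  using assms(2,3)
proof (induction k arbitrary: f g)
  case 0
  then show ?case using continuous_on_cong[OF refl, of S f g] openin_subset[OF assms(1)]
    by (auto simp: continuous_map_sub_Euclidean_iff)
next
  case (Suc k)
  note sub = openin_subset[OF assms(1)]
  have "continuous_on S g"
    using Suc.prems sub continuous_on_cong[OF refl, of S f g]
    by (simp add: continuous_map_sub_Euclidean_iff)
  moreover have "(\<lambda>t. g (x(i := t))) field_differentiable at (x i)" if "i < m" "x \<in> S" for i x
  proof -
    have "((\<lambda>t. g (x(i := t))) has_real_derivative partial_deriv i f x) (at (x i))"
    proof (rule DERIV_cong_ev[THEN iffD1, OF refl _ refl])
      show "\<forall>\<^sub>F t in nhds (x i). f (x(i := t)) = g (x(i := t))"
        using openin_Euclidean_eventually_upd[OF assms(1) that(2,1)]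
        by (rule eventually_mono) (rule Suc.prems(1))
      show "((\<lambda>t. f (x(i := t))) has_real_derivative partial_deriv i f x) (at (x i))"
        using Ck_on_has_partial_deriv Suc.prems(2) that by blast
    qed
    then show ?thesis using field_differentiable_def by blast
  qed
  moreover have "Ck_on k m S (partial_deriv i g)" if "i < m" for i
    using Suc.IH[of "partial_deriv i f" "partial_deriv i g"] Suc.prems that
      partial_deriv_cong[OF assms(1) Suc.prems(1)] by simp
  ultimately show ?case using sub by (simp add: continuous_map_sub_Euclidean_iff)
qed

lemma Ck_on_cong:
  assumes "openin (Euclidean_space m) S" "\<And>x. x \<in> S \<Longrightarrow> f x = g x"
  shows "Ck_on k m S f \<longleftrightarrow> Ck_on k m S g"
  using Ck_on_cong_imp[of m S f g k] Ck_on_cong_imp[of m S g f k] assms by auto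

text \<open>The candidates \<open>f'\<close> need to be the partial derivatives on S only, so
  explicit formulas can replace \<open>deriv\<close>.\<close>

lemma Ck_on_SucI:
  assumes S: "openin (Euclidean_space m) S" and "continuous_on S f"
    and d: "\<And>i x. i < m \<Longrightarrow> x \<in> S \<Longrightarrow> ((\<lambda>t. f (x(i := t))) has_real_derivative f' i x) (at (x i))"
    and "\<And>i. i < m \<Longrightarrow> Ck_on k m S (f' i)"
  shows "Ck_on (Suc k) m S f"
proof -
  have "partial_deriv i f x = f' i x" if "i < m" "x \<in> S" for i x
    unfolding partial_deriv_def using d[OF that] by (rule DERIV_imp_deriv)
  then have "Ck_on k m S (partial_deriv i f)" if "i < m" for i
    using Ck_on_cong[OF S, of "f' i" "partial_deriv i f" k] that assms(4) by simp
  then show ?thesis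
    using assms openin_subset[OF S]
    by (auto simp: continuous_map_sub_Euclidean_iff field_differentiable_def)
qed

lemma Ck_on_subset:
  assumes "Ck_on k m S f" "T \<subseteq> S" 
  shows "Ck_on k m T f"
  using assms(1)
  by (induction k arbitrary: f)
    (use assms(2) in \<open>auto intro: continuous_map_from_subtopology_mono\<close>)


lemma continuous_on_Euclidean_local:
  assumes S: "openin (Euclidean_space m) S"
    and loc: "\<And>x. x \<in> S \<Longrightarrow> \<exists>T. openin (Euclidean_space m) T \<and> x \<in> T \<and> continuous_on T (f :: _ \<Rightarrow> real)"
  shows "continuous_on S f"
proof -
  obtain T where T: "\<And>x. x \<in> S \<Longrightarrow> openin (Euclidean_space m) (T x)" "\<And>x. x \<in> S \<Longrightarrow> x \<in> T x"
      "\<And>x. x \<in> S \<Longrightarrow> continuous_on (T x) f"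
    using loc by metis
  note sub = openin_subset[OF S]
  have "continuous_map (subtopology (Euclidean_space m) S) euclideanreal f"
  proof (rule pasting_lemma[where I = S and T = "\<lambda>x. S \<inter> T x" and f = "\<lambda>_. f"])
    fix x assume x: "x \<in> S"
    show "openin (subtopology (Euclidean_space m) S) (S \<inter> T x)"
      using T(1)[OF x] by (simp add: openin_subtopology_Int2)
    have "continuous_on (S \<inter> T x) f"
      using T(3)[OF x] by (rule continuous_on_subset) simp
    then show "continuous_map (subtopology (subtopology (Euclidean_space m) S) (S \<inter> T x)) euclideanreal f"
      using sub by (simp add: subtopology_subtopology continuous_map_sub_Euclidean_iff le_infI1)
  qed (use T(2) in auto)
  then show ?thesis using sub by (simp add: continuous_map_sub_Euclidean_iff)
qed

text \<open>Serves functions that are given by different formulas in different places: locally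
  finite sums, and functions glued from charts.\<close>

lemma Ck_on_local:
  assumes S: "openin (Euclidean_space m) S"
    and loc: "\<And>x. x \<in> S \<Longrightarrow> \<exists>T. openin (Euclidean_space m) T \<and> x \<in> T \<and> Ck_on k m T f"
  shows "Ck_on k m S f"
  using loc
proof (induction k arbitrary: f)
  case 0
  have "continuous_on S f"
    by (rule continuous_on_Euclidean_local[OF S])
      (use 0 Ck_on_imp_continuous_on openin_subset in metis)
  then show ?case using openin_subset[OF S] by (simp add: continuous_map_sub_Euclidean_iff)
next
  case (Suc k)
  have cont: "continuous_on S f"
    by (rule continuous_on_Euclidean_local[OF S])
      (use Suc.prems Ck_on_imp_continuous_on openin_subset in metis)
  show ?case
  proof (rule Ck_on_SucI[OF S cont])
    fix i assume i: "i < m"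
    show "Ck_on k m S (partial_deriv i f)"
    proof (rule Suc.IH)
      fix x assume "x \<in> S"
      with Suc.prems obtain T where "openin (Euclidean_space m) T" "x \<in> T" "Ck_on (Suc k) m T f"
        by blast
      then show "\<exists>T. openin (Euclidean_space m) T \<and> x \<in> T \<and> Ck_on k m T (partial_deriv i f)"
        using Ck_on_partial_deriv i by blast
    qed
    fix x assume "x \<in> S"
    with Suc.prems obtain T where "x \<in> T" "Ck_on (Suc k) m T f" by blast
    then show "((\<lambda>t. f (x(i := t))) has_real_derivative partial_deriv i f x) (at (x i))"
      using Ck_on_has_partial_deriv i by blast
  qed
qed

section \<open>Algebra of C^k functions\<close>

lemma Ck_on_const: "openin (Euclidean_space m) S \<Longrightarrow> Ck_on k m S (\<lambda>x. c)"
proof (induction k arbitrary: c)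
  case (Suc k)
  then show ?case by (intro Ck_on_SucI[where f' = "\<lambda>_ _. 0"]) auto
qed auto

lemma Ck_on_coord: 
  assumes S: "openin (Euclidean_space m) S"
  shows "Ck_on k m S (\<lambda>x. x j)"
proof -
  have c: "continuous_on S (\<lambda>x. x j)"
    by (rule continuous_on_subset[OF continuous_on_product_coordinates]) simp
  show ?thesis
  proof (cases k)
    case 0
    with c show ?thesis using openin_subset[OF S] by (simp add: continuous_map_sub_Euclidean_iff)
  next
    case (Suc l)
    have "Ck_on (Suc l) m S (\<lambda>x. x j)"
    proof (rule Ck_on_SucI[OF S c, where f' = "\<lambda>i _. if i = j then 1 else 0"])
      show "((\<lambda>t. (x(i := t)) j) has_real_derivative (if i = j then 1 else 0)) (at (x i))" for i x
        by (auto intro!: derivative_eq_intros)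
      show "Ck_on l m S (\<lambda>_. if i = j then 1 else 0)" for i
        using Ck_on_const[OF S] by simp
    qed
    then show ?thesis using Suc by simp
  qed
qed

lemma Ck_on_add:
  assumes S: "openin (Euclidean_space m) S"
  shows "Ck_on k m S f \<Longrightarrow> Ck_on k m S g \<Longrightarrow> Ck_on k m S (\<lambda>x. f x + g x)"
proof (induction k arbitrary: f g)
  case 0
  then show ?case by (auto intro: continuous_map_add)
next
  case (Suc k)
  note sub = openin_subset[OF S]
  show ?case
  proof (rule Ck_on_SucI[OF S, where f' = "\<lambda>i x. partial_deriv i f x + partial_deriv i g x"])
    show "continuous_on S (\<lambda>x. f x + g x)"
      using Ck_on_imp_continuous_on[OF sub] Suc.prems by (intro continuous_intros) blast+
    fix i assume i: "i < m"
    show "Ck_on k m S (\<lambda>x. partial_deriv i f x + partial_deriv i g x)"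
      using Suc.prems i by (intro Suc.IH Ck_on_partial_deriv)
    fix x assume x: "x \<in> S"
    show "((\<lambda>t. f (x(i := t)) + g (x(i := t))) has_real_derivative
        partial_deriv i f x + partial_deriv i g x) (at (x i))"
      by (intro DERIV_add Ck_on_has_partial_deriv[OF Suc.prems(1) i x] Ck_on_has_partial_deriv[OF Suc.prems(2) i x])
  qed
qed

lemma Ck_on_mult:
  assumes S: "openin (Euclidean_space m) S"
  shows "Ck_on k m S f \<Longrightarrow> Ck_on k m S g \<Longrightarrow> Ck_on k m S (\<lambda>x. f x * g x)"
proof (induction k arbitrary: f g)
  case 0
  then show ?case by (auto intro: continuous_map_real_mult)
next
  case (Suc k)
  note sub = openin_subset[OF S]
  show ?case
  proof (rule Ck_on_SucI[OF S, where f' = "\<lambda>i x. partial_deriv i f x * g x + f x * partial_deriv i g x"])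
    show "continuous_on S (\<lambda>x. f x * g x)"
      using Ck_on_imp_continuous_on[OF sub] Suc.prems by (intro continuous_intros) blast+
    fix i assume i: "i < m"
    show "Ck_on k m S (\<lambda>x. partial_deriv i f x * g x + f x * partial_deriv i g x)"
      using Ck_on_partial_deriv[OF Suc.prems(1) i] Ck_on_partial_deriv[OF Suc.prems(2) i]
        Ck_on_Suc_D[OF Suc.prems(1)] Ck_on_Suc_D[OF Suc.prems(2)]
      by (intro Suc.IH Ck_on_add[OF S])
    fix x assume x: "x \<in> S"
    show "((\<lambda>t. f (x(i := t)) * g (x(i := t))) has_real_derivative
        partial_deriv i f x * g x + f x * partial_deriv i g x) (at (x i))"
      using DERIV_mult[OF Ck_on_has_partial_deriv[OF Suc.prems(1) i x] Ck_on_has_partial_deriv[OF Suc.prems(2) i x]]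
      by (rule DERIV_cong) simp
  qed
qed

lemma Ck_on_sum:
  assumes S: "openin (Euclidean_space m) S" and "\<And>i. i \<in> I \<Longrightarrow> Ck_on k m S (f i)"
  shows "Ck_on k m S (\<lambda>x. \<Sum>i\<in>I. f i x)"
  using assms(2)
  by (induction I rule: infinite_finite_induct) (auto intro!: Ck_on_const Ck_on_add S)

lemma Ck_on_prod:
  assumes S: "openin (Euclidean_space m) S" and "\<And>i. i \<in> I \<Longrightarrow> Ck_on k m S (f i)"
  shows "Ck_on k m S (\<lambda>x. \<Prod>i\<in>I. f i x)"
  using assms(2)
  by (induction I rule: infinite_finite_induct) (auto intro!: Ck_on_const Ck_on_mult S)

lemma Ck_on_diff:
  assumes S: "openin (Euclidean_space m) S" and "Ck_on k m S f" "Ck_on k m S g"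
  shows "Ck_on k m S (\<lambda>x. f x - g x)"
  using Ck_on_add[OF S assms(2) Ck_on_mult[OF S Ck_on_const[OF S, of k "-1"] assms(3)]] by simp

section \<open>The chain rule\<close>

lemma MVT_unordered:
  fixes f :: "real \<Rightarrow> real"
  assumes "\<And>s. \<bar>s - a\<bar> \<le> \<bar>y - a\<bar> \<Longrightarrow> (f has_real_derivative f' s) (at s)"
  shows "\<exists>s. \<bar>s - a\<bar> \<le> \<bar>y - a\<bar> \<and> f y - f a = f' s * (y - a)"
proof (cases a y rule: linorder_cases)
  case less
  then have "\<exists>z>a. z < y \<and> f y - f a = (y - a) * f' z"
    by (intro MVT2) (use assms in auto)
  then obtain z where "z > a" "z < y" "f y - f a = (y - a) * f' z" by blast
  then show ?thesis by (intro exI[of _ z]) (auto simp: algebra_simps)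
next
  case greater
  then have "\<exists>z>y. z < a \<and> f a - f y = (a - y) * f' z"
    by (intro MVT2) (use assms in auto)
  then obtain z where "z > y" "z < a" "f a - f y = (a - y) * f' z" by blast
  then show ?thesis by (intro exI[of _ z]) (auto simp: algebra_simps)
qed auto

text \<open>Pass from \<open>a\<close> to \<open>y\<close> by changing one coordinate at a time and
  apply the mean value theorem to each leg. The intermediate points \<open>z\<close> are in no
  coordinate farther from \<open>a\<close> than \<open>y\<close> is, which is what makes the
  coefficients converge when \<open>y\<close> tends to \<open>a\<close>.\<close>

lemma increment_partial_derivs:
  assumes T: "openin (Euclidean_space n) T" and g: "Ck_on 1 n T g"
    and r: "cube n a r \<subseteq> T" and a: "a \<in> cartesian n" and y: "y \<in> cube n a r"
  obtains c where "g y - g a = (\<Sum>k<n. c k * (y k - a k))"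
    and "\<And>k. k < n \<Longrightarrow> \<exists>z\<in>cartesian n. c k = partial_deriv k g z \<and> (\<forall>i<n. \<bar>z i - a i\<bar> \<le> \<bar>y i - a i\<bar>)"
proof -
  define Y where "Y = (\<lambda>k i. if i < k then y i else a i)"
  have Y0: "Y 0 = a" by (auto simp: Y_def)
  have Yn: "Y n = y"
    using y a by (fastforce simp: Y_def cube_def cartesian_iff fun_eq_iff)
  have YS: "Y (Suc k) = (Y k)(k := y k)" "Y k = (Y k)(k := a k)" for k
    by (auto simp: Y_def fun_eq_iff less_Suc_eq)
  have Yc: "(Y k)(k := s) \<in> cartesian n" if "k < n" for k s
    using that y a by (auto simp: Y_def cartesian_iff cube_def)
  have Yd: "\<bar>((Y k)(k := s)) i - a i\<bar> \<le> \<bar>y i - a i\<bar>" if "\<bar>s - a k\<bar> \<le> \<bar>y k - a k\<bar>" for k s i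
    using that by (auto simp: Y_def)
  have "\<exists>s. \<bar>s - a k\<bar> \<le> \<bar>y k - a k\<bar> \<and>
      g ((Y k)(k := y k)) - g ((Y k)(k := a k)) = partial_deriv k g ((Y k)(k := s)) * (y k - a k)"
    if k: "k < n" for k
  proof (rule MVT_unordered)
    fix s assume s: "\<bar>s - a k\<bar> \<le> \<bar>y k - a k\<bar>"
    have "\<bar>((Y k)(k := s)) i - a i\<bar> < r" if "i < n" for i
      using Yd[OF s, of i] y that by (auto simp: cube_def)
    then have "(Y k)(k := s) \<in> T"
      using r Yc[OF k] by (auto simp: cube_def)
    then have "((\<lambda>t. g (((Y k)(k := s))(k := t))) has_real_derivative partial_deriv k g ((Y k)(k := s)))
        (at (((Y k)(k := s)) k))"
      using Ck_on_has_partial_deriv[of 0 n T g k "(Y k)(k := s)"] g k by simp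
    then show "((\<lambda>t. g ((Y k)(k := t))) has_real_derivative partial_deriv k g ((Y k)(k := s))) (at s)"
      by simp
  qed
  then obtain s where s: "\<And>k. k < n \<Longrightarrow> \<bar>s k - a k\<bar> \<le> \<bar>y k - a k\<bar>"
      "\<And>k. k < n \<Longrightarrow> g ((Y k)(k := y k)) - g ((Y k)(k := a k)) = partial_deriv k g ((Y k)(k := s k)) * (y k - a k)"
    by metis
  show ?thesis
  proof (rule that[of "\<lambda>k. partial_deriv k g ((Y k)(k := s k))"])
    have "g y - g a = (\<Sum>k<n. g (Y (Suc k)) - g (Y k))"
      using sum_lessThan_telescope[of "\<lambda>k. g (Y k)" n] by (simp add: Y0 Yn)
    also have "\<dots> = (\<Sum>k<n. partial_deriv k g ((Y k)(k := s k)) * (y k - a k))"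
    proof (rule sum.cong)
      show "g (Y (Suc k)) - g (Y k) = partial_deriv k g ((Y k)(k := s k)) * (y k - a k)"
        if "k \<in> {..<n}" for k
        using s(2)[of k] YS[of k] that by simp
    qed simp
    finally show "g y - g a = (\<Sum>k<n. partial_deriv k g ((Y k)(k := s k)) * (y k - a k))" .
    show "\<exists>z\<in>cartesian n. partial_deriv k g ((Y k)(k := s k)) = partial_deriv k g z \<and>
        (\<forall>i<n. \<bar>z i - a i\<bar> \<le> \<bar>y i - a i\<bar>)" if "k < n" for k
      using Yc[OF that] Yd[OF s(1)[OF that]] by blast
  qed
qed

lemma continuous_on_cube:
  assumes T: "openin (Euclidean_space n) T" and h: "continuous_on T (h :: _ \<Rightarrow> real)"
    and a: "a \<in> T" and e: "e > 0"
  obtains r where "r > 0" "cube n a r \<subseteq> T" "\<And>z. z \<in> cube n a r \<Longrightarrow> \<bar>h z - h a\<bar> < e"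
proof -
  note sub = openin_subset[OF T]
  have "continuous_map (subtopology (Euclidean_space n) T) euclideanreal h"
    using h sub by (simp add: continuous_map_sub_Euclidean_iff)
  then have "openin (subtopology (Euclidean_space n) T) {x \<in> topspace (subtopology (Euclidean_space n) T). h x \<in> ball (h a) e}"
    by (rule openin_continuous_map_preimage) simp
  moreover have "{x \<in> topspace (subtopology (Euclidean_space n) T). h x \<in> ball (h a) e} = {x \<in> T. \<bar>h x - h a\<bar> < e}"
    using sub by (auto simp: dist_real_def abs_minus_commute)
  ultimately have "openin (Euclidean_space n) {x \<in> T. \<bar>h x - h a\<bar> < e}"
    using T openin_trans_full by metis
  then obtain r where "r > 0" "cube n a r \<subseteq> {x \<in> T. \<bar>h x - h a\<bar> < e}"
    using a e unfolding openin_Euclidean_iff_cube by force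
  then show ?thesis by (intro that[of r]) auto
qed

text \<open>Divide the increment formula by t - t0. The difference quotients of the curve converge
  by assumption, and the coefficients converge by continuity of the partial derivatives, since their
  evaluation points are squeezed towards \<gamma> t0.\<close>

lemma has_real_derivative_compose_curve:
  assumes T: "openin (Euclidean_space n) T" and g: "Ck_on 1 n T g"
    and \<gamma>T: "\<gamma> t0 \<in> T" and \<gamma>: "\<And>t. \<gamma> t \<in> cartesian n"
    and D: "\<And>j. j < n \<Longrightarrow> ((\<lambda>t. \<gamma> t j) has_real_derivative D j) (at t0)"
  shows "((\<lambda>t. g (\<gamma> t)) has_real_derivative (\<Sum>j<n. partial_deriv j g (\<gamma> t0) * D j)) (at t0)"
proof -
  define a where "a = \<gamma> t0"
  obtain r where r: "r > 0" "cube n a r \<subseteq> T"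
    using T \<gamma>T unfolding openin_Euclidean_iff_cube a_def by blast
  have near: "\<forall>\<^sub>F t in at t0. \<forall>j<n. \<bar>\<gamma> t j - a j\<bar> < e" if "e > 0" for e
  proof -
    have "\<forall>\<^sub>F t in at t0. \<bar>\<gamma> t j - a j\<bar> < e" if "j < n" for j
    proof -
      have "isCont (\<lambda>t. \<gamma> t j) t0" using D[OF that] by (rule DERIV_isCont)
      then show ?thesis
        using tendstoD[of "\<lambda>t. \<gamma> t j" "\<gamma> t0 j" "at t0" e] \<open>e > 0\<close>
        by (simp add: isCont_def dist_real_def a_def)
    qed
    then have "\<forall>\<^sub>F t in at t0. \<forall>j\<in>{..<n}. \<bar>\<gamma> t j - a j\<bar> < e"
      by (subst eventually_ball_finite_distrib) auto
    then show ?thesis by (simp add: Ball_def)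
  qed
  \<comment> \<open>The coefficients must become functions of t before a limit can be taken; where
    the curve is outside the cube they are arbitrary.\<close>
  have "\<exists>c. \<gamma> t \<in> cube n a r \<longrightarrow> g (\<gamma> t) - g a = (\<Sum>k<n. c k * (\<gamma> t k - a k)) \<and>
      (\<forall>k<n. \<exists>z\<in>cartesian n. c k = partial_deriv k g z \<and> (\<forall>i<n. \<bar>z i - a i\<bar> \<le> \<bar>\<gamma> t i - a i\<bar>))" for t
  proof (cases "\<gamma> t \<in> cube n a r")
    case True
    have "a \<in> cartesian n" using \<gamma> by (simp add: a_def)
    then obtain c' where "g (\<gamma> t) - g a = (\<Sum>k<n. c' k * (\<gamma> t k - a k))"
      "\<And>k. k < n \<Longrightarrow>
        \<exists>z\<in>cartesian n. c' k = partial_deriv k g z \<and> (\<forall>i<n. \<bar>z i - a i\<bar> \<le> \<bar>\<gamma> t i - a i\<bar>)"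
      using increment_partial_derivs[OF T g r(2) _ True] by blast
    then show ?thesis by (intro exI[of _ c']) blast
  qed simp
  then have "\<forall>t. \<exists>c. \<gamma> t \<in> cube n a r \<longrightarrow> g (\<gamma> t) - g a = (\<Sum>k<n. c k * (\<gamma> t k - a k)) \<and>
      (\<forall>k<n. \<exists>z\<in>cartesian n. c k = partial_deriv k g z \<and> (\<forall>i<n. \<bar>z i - a i\<bar> \<le> \<bar>\<gamma> t i - a i\<bar>))"
    by blast
  from choice[OF this] obtain c where
    c: "\<And>t. \<gamma> t \<in> cube n a r \<Longrightarrow> g (\<gamma> t) - g a = (\<Sum>k<n. c t k * (\<gamma> t k - a k))"
    "\<And>t k. \<gamma> t \<in> cube n a r \<Longrightarrow> k < n \<Longrightarrow>
       \<exists>z\<in>cartesian n. c t k = partial_deriv k g z \<and> (\<forall>i<n. \<bar>z i - a i\<bar> \<le> \<bar>\<gamma> t i - a i\<bar>)"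
    by blast
  have incube: "\<forall>\<^sub>F t in at t0. \<gamma> t \<in> cube n a r"
    using near[OF r(1)] by eventually_elim (use \<gamma> in \<open>auto simp: cube_def\<close>)
  have clim: "((\<lambda>t. c t k) \<longlongrightarrow> partial_deriv k g a) (at t0)" if k: "k < n" for k
  proof (rule tendstoI)
    fix e :: real assume e: "e > 0"
    have "Ck_on 0 n T (partial_deriv k g)" using g k by simp
    then have "continuous_on T (partial_deriv k g)"
      using Ck_on_imp_continuous_on openin_subset[OF T] by blast
    then obtain d where d: "d > 0" "\<And>z. z \<in> cube n a d \<Longrightarrow> \<bar>partial_deriv k g z - partial_deriv k g a\<bar> < e"
      using continuous_on_cube[OF T _ \<gamma>T e] unfolding a_def by metis
    show "\<forall>\<^sub>F t in at t0. dist (c t k) (partial_deriv k g a) < e"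
      using near[OF d(1)] incube
    proof eventually_elim
      case (elim t)
      then obtain z where z: "z \<in> cartesian n" "c t k = partial_deriv k g z"
          "\<forall>i<n. \<bar>z i - a i\<bar> \<le> \<bar>\<gamma> t i - a i\<bar>"
        using c(2) k by blast
      then have "z \<in> cube n a d" using elim by (auto simp: cube_def intro: le_less_trans)
      then show ?case using d(2) z by (simp add: dist_real_def)
    qed
  qed
  have "((\<lambda>t. \<Sum>k<n. c t k * ((\<gamma> t k - \<gamma> t0 k) / (t - t0))) \<longlongrightarrow> (\<Sum>k<n. partial_deriv k g a * D k)) (at t0)"
    using D by (intro tendsto_sum tendsto_mult clim) (auto simp: has_field_derivative_iff)
  then show ?thesis
    unfolding has_field_derivative_iff a_def
  proof (rule Lim_transform_eventually)
    show "\<forall>\<^sub>F t in at t0. (\<Sum>k<n. c t k * ((\<gamma> t k - \<gamma> t0 k) / (t - t0))) = (g (\<gamma> t) - g (\<gamma> t0)) / (t - t0)"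
      using incube by eventually_elim (use c(1) in \<open>auto simp: a_def sum_divide_distrib\<close>)
  qed
qed

lemma partial_deriv_compose:
  assumes S: "openin (Euclidean_space m) S" and T: "openin (Euclidean_space n) T"
    and g: "Ck_on 1 n T g" and h: "\<And>j. j < n \<Longrightarrow> Ck_on 1 m S (\<lambda>x. h x j)"
    and hT: "h ` S \<subseteq> T" and x: "x \<in> S" and i: "i < m"
  shows "((\<lambda>t. g (h (x(i := t)))) has_real_derivative
      (\<Sum>j<n. partial_deriv j g (h x) * partial_deriv i (\<lambda>y. h y j) x)) (at (x i))"
proof -
  \<comment> \<open>The curve has to lie in the cartesian space for all t, while \<open>h\<close> is
    controlled on S only; hence the value 0 elsewhere.\<close>
  define \<gamma> where "\<gamma> = (\<lambda>t. if x(i := t) \<in> S then h (x(i := t)) else (\<lambda>_. 0))"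
  have ev: "\<forall>\<^sub>F t in nhds (x i). \<gamma> t = h (x(i := t))"
    using openin_Euclidean_eventually_upd[OF S x i] by eventually_elim (auto simp: \<gamma>_def)
  have \<gamma>x: "\<gamma> (x i) = h x" using x by (simp add: \<gamma>_def)
  have "((\<lambda>t. g (\<gamma> t)) has_real_derivative
      (\<Sum>j<n. partial_deriv j g (\<gamma> (x i)) * partial_deriv i (\<lambda>y. h y j) x)) (at (x i))"
  proof (rule has_real_derivative_compose_curve[OF T g])
    show "\<gamma> (x i) \<in> T" using \<gamma>x x hT by auto
    show "\<gamma> t \<in> cartesian n" for t
      using subset_trans[OF hT openin_subset[OF T]]
      by (cases "x(i := t) \<in> S") (auto simp: \<gamma>_def cartesian_iff)
    fix j assume j: "j < n"
    have *: "((\<lambda>t. h (x(i := t)) j) has_real_derivative partial_deriv i (\<lambda>y. h y j) x) (at (x i))"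
      using Ck_on_has_partial_deriv[of 0 m S "\<lambda>x. h x j"] h[OF j] i x by simp
    show "((\<lambda>t. \<gamma> t j) has_real_derivative partial_deriv i (\<lambda>y. h y j) x) (at (x i))"
      by (rule DERIV_cong_ev[THEN iffD1, OF refl _ refl, OF _ *]) (use ev in \<open>eventually_elim, simp\<close>)
  qed
  then show ?thesis
    unfolding \<gamma>x
    by (rule DERIV_cong_ev[THEN iffD1, OF refl _ refl, rotated]) (use ev in \<open>eventually_elim, simp\<close>)
qed

text \<open>Induction with \<open>h\<close> fixed and \<open>g\<close> arbitrary: a partial
  derivative of the composite consists of partial derivatives of \<open>g\<close>, composed with the
  same \<open>h\<close>, times partial derivatives of the components of \<open>h\<close>.\<close>

lemma Ck_on_compose:
  assumes S: "openin (Euclidean_space m) S" and T: "openin (Euclidean_space n) T" and hT: "h ` S \<subseteq> T"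
  shows "Ck_on k n T g \<Longrightarrow> (\<And>j. j < n \<Longrightarrow> Ck_on k m S (\<lambda>x. h x j)) \<Longrightarrow> Ck_on k m S (\<lambda>x. g (h x))"
proof (induction k arbitrary: g)
  have cont: "continuous_on S (\<lambda>x. g (h x))"
    if "continuous_on T g" "\<And>j. j < n \<Longrightarrow> continuous_on S (\<lambda>x. h x j)" for g :: "_ \<Rightarrow> real"
  proof -
    note subS = openin_subset[OF S] and subT = openin_subset[OF T]
    have "continuous_map (subtopology (Euclidean_space m) S) (Euclidean_space n) h"
      using that(2) hT subS subT
      by (subst continuous_map_Euclidean_iff_coord) (auto simp: continuous_map_sub_Euclidean_iff)
    then have "continuous_map (subtopology (Euclidean_space m) S) (subtopology (Euclidean_space n) T) h"
      using hT subS by (auto simp: continuous_map_in_subtopology)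
    then have "continuous_map (subtopology (Euclidean_space m) S) euclideanreal (g \<circ> h)"
      using that(1) subT by (intro continuous_map_compose) (auto simp: continuous_map_sub_Euclidean_iff)
    then show ?thesis using subS by (simp add: continuous_map_sub_Euclidean_iff o_def)
  qed
  note C = Ck_on_imp_continuous_on[OF openin_subset[OF S]] Ck_on_imp_continuous_on[OF openin_subset[OF T]]
  {
    case 0
    then show ?case using cont C openin_subset[OF S]
      by (metis Ck_on.simps(1) continuous_map_sub_Euclidean_iff)
  next
    case (Suc k)
    have g1: "Ck_on 1 n T g" and h1: "\<And>j. j < n \<Longrightarrow> Ck_on 1 m S (\<lambda>x. h x j)"
      using Suc.prems Ck_on_le[of 1 "Suc k"] by auto
    show ?case
    proof (rule Ck_on_SucI[OF S cont])
      show "continuous_on T g" "\<And>j. j < n \<Longrightarrow> continuous_on S (\<lambda>x. h x j)"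
        using C Suc.prems by blast+
      fix i assume i: "i < m"
      show "((\<lambda>t. g (h (x(i := t)))) has_real_derivative
          (\<Sum>j<n. partial_deriv j g (h x) * partial_deriv i (\<lambda>y. h y j) x)) (at (x i))"
        if "x \<in> S" for x
        using partial_deriv_compose[OF S T g1 h1 hT that i] .
      show "Ck_on k m S (\<lambda>x. \<Sum>j<n. partial_deriv j g (h x) * partial_deriv i (\<lambda>y. h y j) x)"
      proof (intro Ck_on_sum Ck_on_mult S)
        fix j assume "j \<in> {..<n}"
        then have j: "j < n" by simp
        show "Ck_on k m S (\<lambda>x. partial_deriv j g (h x))"
          using Ck_on_partial_deriv[OF Suc.prems(1) j] Ck_on_Suc_D[OF Suc.prems(2)]
          by (rule Suc.IH)
        show "Ck_on k m S (partial_deriv i (\<lambda>y. h y j))"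
          using Ck_on_partial_deriv[OF Suc.prems(2)[OF j] i] .
      qed
    qed
  }
qed

section \<open>Smooth bump functions\<close>

definition ccube :: "nat \<Rightarrow> (nat \<Rightarrow> real) \<Rightarrow> real \<Rightarrow> (nat \<Rightarrow> real) set"
  where "ccube d a r = {x \<in> cartesian d. \<forall>i<d. \<bar>x i - a i\<bar> \<le> r}"

text \<open>Tychonoff's theorem, for a product whose factors are intervals below index d and {0}
  from d on.\<close>

lemma compactin_ccube: "compactin (Euclidean_space d) (ccube d a r)"
proof -
  have eq: "ccube d a r = (\<Pi>\<^sub>E i\<in>UNIV. if i < d then {a i - r..a i + r} else {0})"
  proof (rule set_eqI)
    fix x
    have "(\<bar>x i - a i\<bar> \<le> r) = (x i \<in> {a i - r..a i + r})" for i by (auto simp: abs_le_iff)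
    moreover have "(\<forall>i. x i \<in> (if i < d then {a i - r..a i + r} else {0})) \<longleftrightarrow>
        (\<forall>i<d. x i \<in> {a i - r..a i + r}) \<and> (\<forall>i\<ge>d. x i = 0)"
      by (metis not_less singleton_iff)
    ultimately show "x \<in> ccube d a r \<longleftrightarrow> x \<in> (\<Pi>\<^sub>E i\<in>UNIV. if i < d then {a i - r..a i + r} else {0})"
      unfolding ccube_def PiE_UNIV_domain by (auto simp: cartesian_iff)
  qed
  have "compactin (powertop_real UNIV) (ccube d a r)"
    unfolding eq by (subst compactin_PiE) auto
  then show ?thesis
    unfolding Euclidean_space_def compactin_subtopology
    by (auto simp: ccube_def cartesian_iff)
qed

section \<open>Reciprocals and smooth functions of one real variable\<close>

lemma Ck_on_inverse:
  assumes S: "openin (Euclidean_space m) S" and nz: "\<And>x. x \<in> S \<Longrightarrow> f x \<noteq> 0"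
  shows "Ck_on k m S f \<Longrightarrow> Ck_on k m S (\<lambda>x. inverse (f x))"
proof (induction k)
  case 0
  then have "continuous_on S (\<lambda>x. inverse (f x))"
    using Ck_on_imp_continuous_on[OF openin_subset[OF S]] nz by (intro continuous_intros) blast+
  then show ?case using openin_subset[OF S] by (simp add: continuous_map_sub_Euclidean_iff)
next
  case (Suc k)
  note IH = Suc.IH[OF Ck_on_Suc_D[OF Suc.prems]]
  show ?case
  proof (rule Ck_on_SucI[OF S, where f' = "\<lambda>i x. (-1) * (inverse (f x) * partial_deriv i f x * inverse (f x))"])
    show "continuous_on S (\<lambda>x. inverse (f x))"
      using Ck_on_imp_continuous_on[OF openin_subset[OF S] IH] .
    fix i assume i: "i < m"
    show "Ck_on k m S (\<lambda>x. (-1) * (inverse (f x) * partial_deriv i f x * inverse (f x)))"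
      using Ck_on_partial_deriv[OF Suc.prems i] by (intro Ck_on_mult[OF S] Ck_on_const[OF S] IH)
    fix x assume x: "x \<in> S"
    have "f (x(i := x i)) \<noteq> 0" using nz x by simp
    from DERIV_inverse'[OF Ck_on_has_partial_deriv[OF Suc.prems i x] this]
    show "((\<lambda>t. inverse (f (x(i := t)))) has_real_derivative
        (-1) * (inverse (f x) * partial_deriv i f x * inverse (f x))) (at (x i))"
      by (rule DERIV_cong) simp
  qed
qed

text \<open>One-variable smoothness is expressed through \<open>Ck_on\<close> in dimension 1, so
  that the closure rules and the chain rule carry over.\<close>

definition smooth1 :: "(real \<Rightarrow> real) \<Rightarrow> bool"
  where "smooth1 g \<longleftrightarrow> (\<forall>k. Ck_on k 1 (cartesian 1) (\<lambda>x. g (x 0)))"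

lemma openin_cartesian: "openin (Euclidean_space m) (cartesian m)"
  by simp

lemma Ck_on_smooth1:
  assumes S: "openin (Euclidean_space m) S" and g: "smooth1 g" and f: "Ck_on k m S f"
  shows "Ck_on k m S (\<lambda>x. g (f x))"
proof -
  define h where "h = (\<lambda>x (i::nat). if i = 0 then f x else 0)"
  have "h ` S \<subseteq> cartesian 1" by (auto simp: cartesian_iff h_def)
  moreover have "Ck_on k m S (\<lambda>x. h x j)" if "j < 1" for j
    using f that by (simp add: h_def)
  moreover have "Ck_on k 1 (cartesian 1) (\<lambda>y. g (y 0))" using g by (simp only: smooth1_def)
  ultimately have "Ck_on k m S (\<lambda>x. g (h x 0))"
    using Ck_on_compose[OF S openin_cartesian, of h 1 k "\<lambda>y. g (y 0)"] by blast
  then show ?thesis by (simp add: h_def)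
qed

lemma smooth1_has_real_derivative:
  assumes "smooth1 g"
  shows "(g has_real_derivative deriv g t) (at t)"
proof -
  let ?x = "\<lambda>i::nat. if i = 0 then t else 0"
  have "Ck_on (Suc 0) 1 (cartesian 1) (\<lambda>x. g (x 0))" using assms by (simp only: smooth1_def)
  from Ck_on_has_partial_deriv[OF this, of 0 ?x]
  have "(g has_real_derivative partial_deriv 0 (\<lambda>x. g (x 0)) ?x) (at t)"
    by (simp add: cartesian_iff)
  then show ?thesis by (simp add: DERIV_imp_deriv)
qed

lemma smooth1_deriv:
  assumes "smooth1 g"
  shows "smooth1 (deriv g)"
  unfolding smooth1_def
proof
  fix k
  have "Ck_on (Suc k) 1 (cartesian 1) (\<lambda>x. g (x 0))" using assms by (simp only: smooth1_def)
  from Ck_on_partial_deriv[OF this, of 0]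
  show "Ck_on k 1 (cartesian 1) (\<lambda>x. deriv g (x 0))"
    by (simp add: partial_deriv_def[abs_def])
qed

text \<open>A whole family is shown to be C^k at once, by induction on k: the derivative of a member
  may involve other members, as long as it inherits C^k from all of them. This suits families closed
  under differentiation and solutions of differential equations.\<close>

lemma smooth1_coinduct:
  assumes "g \<in> \<F>"
    and "\<And>f. f \<in> \<F> \<Longrightarrow> \<exists>f'. (\<forall>t. (f has_real_derivative f' t) (at t)) \<and>
      (\<forall>k. (\<forall>h\<in>\<F>. Ck_on k 1 (cartesian 1) (\<lambda>x. h (x 0))) \<longrightarrow> Ck_on k 1 (cartesian 1) (\<lambda>x. f' (x 0)))"
  shows "smooth1 g"
proof -
  have cont: "continuous_on (cartesian 1) (\<lambda>x. f (x 0))" if f: "f \<in> \<F>" for f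
  proof -
    have "continuous_on UNIV f"
      using assms(2)[OF f] DERIV_isCont by (auto simp: continuous_on_eq_continuous_at)
    then show ?thesis
      by (rule continuous_on_compose2) (auto intro: continuous_on_subset[OF continuous_on_product_coordinates])
  qed
  have "\<forall>h\<in>\<F>. Ck_on k 1 (cartesian 1) (\<lambda>x. h (x 0))" for k
  proof (induction k)
    case 0
    show ?case
      using cont continuous_map_sub_Euclidean_iff[OF subset_refl, of 1] by (simp only: Ck_on.simps) blast
  next
    case (Suc k)
    show ?case
    proof
      fix f assume f: "f \<in> \<F>"
      from assms(2)[OF f] obtain f' where f': "\<forall>t. (f has_real_derivative f' t) (at t)"
          "\<forall>k. (\<forall>h\<in>\<F>. Ck_on k 1 (cartesian 1) (\<lambda>x. h (x 0))) \<longrightarrow> Ck_on k 1 (cartesian 1) (\<lambda>x. f' (x 0))"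
        by (elim exE conjE)
      show "Ck_on (Suc k) 1 (cartesian 1) (\<lambda>x. f (x 0))"
      proof (rule Ck_on_SucI[OF openin_cartesian cont[OF f], where f' = "\<lambda>i x. f' (x 0)"])
        show "((\<lambda>t. f ((x(i := t)) 0)) has_real_derivative f' (x 0)) (at (x i))" if "i < 1" for i :: nat and x
          using f'(1) that by (cases "i = 0") auto
        show "Ck_on k 1 (cartesian 1) (\<lambda>x. f' (x 0))"
          using f'(2) Suc.IH by (elim allE[of _ k] mp)
      qed
    qed
  qed
  then show ?thesis using assms(1) by (auto simp: smooth1_def)
qed

text \<open>The function exp (-1/t) of the positive half-line, extended by 0, together with its
  multiples by powers of 1/t. The derivative of a member is a combination of two others, so the
  range of \<open>flat\<close> is a family fit for \<open>smooth1_coinduct\<close>.\<close>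

definition flat :: "nat \<Rightarrow> real \<Rightarrow> real"
  where "flat n t = (if t > 0 then exp (- inverse t) * inverse t ^ n else 0)"

lemma flat_tendsto_0: "(flat n \<longlongrightarrow> 0) (at 0)"
proof -
  have "((\<lambda>t. inverse t ^ n / exp (inverse t)) \<longlongrightarrow> 0) (at_right (0::real))"
    by (rule filterlim_compose[OF tendsto_power_div_exp_0 filterlim_inverse_at_top_right])
  then have "(flat n \<longlongrightarrow> 0) (at_right 0)"
    by (rule Lim_transform_eventually)
      (auto simp: flat_def eventually_at_right_field exp_minus field_simps intro!: exI[of _ 1])
  moreover have "(flat n \<longlongrightarrow> 0) (at_left 0)"
    by (rule tendsto_eventually) (auto simp: flat_def eventually_at_left_field intro!: exI[of _ "-1"])
  ultimately show ?thesis by (simp add: filterlim_split_at)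
qed

lemma flat_has_real_derivative:
  "(flat n has_real_derivative flat (n + 2) t - real n * flat (n + 1) t) (at t)"
proof (cases t "0::real" rule: linorder_cases)
  case less
  have "((\<lambda>_. 0) has_real_derivative 0) (at t)" by simp
  then have "(flat n has_real_derivative 0) (at t)"
    by (rule has_field_derivative_transform_within_open[of _ _ _ "{..<0}"]) (use less in \<open>auto simp: flat_def\<close>)
  then show ?thesis using less by (simp add: flat_def)
next
  case greater
  have "((\<lambda>t. exp (- inverse t) * inverse t ^ n) has_real_derivative
     exp (- inverse t) * inverse t ^ (n + 2) - real n * (exp (- inverse t) * inverse t ^ (n + 1))) (at t)"
  proof -
    have 1: "((\<lambda>t. exp (- inverse t)) has_real_derivative exp (- inverse t) * inverse t ^ 2) (at t)"
      using greater by (auto intro!: derivative_eq_intros simp: power2_eq_square)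
    have 2: "((\<lambda>t. inverse t ^ n) has_real_derivative - real n * inverse t ^ (n + 1)) (at t)"
      using greater by (intro DERIV_cong[OF DERIV_power[OF DERIV_inverse]]) (auto simp: power_Suc[symmetric] simp del: power_Suc split: nat_diff_split, cases n, auto)
    from DERIV_mult[OF 1 2] show ?thesis
      by (rule DERIV_cong) (simp add: power_add power2_eq_square algebra_simps)
  qed
  then have "(flat n has_real_derivative
     exp (- inverse t) * inverse t ^ (n + 2) - real n * (exp (- inverse t) * inverse t ^ (n + 1))) (at t)"
    by (rule has_field_derivative_transform_within_open[of _ _ _ "{0<..}"]) (use greater in \<open>auto simp: flat_def\<close>)
  then show ?thesis using greater by (simp add: flat_def)
next
  case equal
  \<comment> \<open>The difference quotient of \<open>flat n\<close> at 0 is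
    \<open>flat (Suc n)\<close>.\<close>
  have "((\<lambda>s. (flat n s - flat n 0) / (s - 0)) \<longlongrightarrow> 0) (at 0)"
    using flat_tendsto_0[of "Suc n"]
    by (rule Lim_transform_eventually) (auto simp: flat_def field_simps)
  then show ?thesis using equal by (simp add: has_field_derivative_iff flat_def)
qed

lemma smooth1_flat: "smooth1 (flat n)"
proof (rule smooth1_coinduct[of _ "range flat"])
  fix f assume "f \<in> range flat"
  then obtain n where n: "f = flat n" by blast
  have "Ck_on k 1 (cartesian 1) (\<lambda>x. flat (n + 2) (x 0) - real n * flat (n + 1) (x 0))"
    if "\<forall>h\<in>range flat. Ck_on k 1 (cartesian 1) (\<lambda>x. h (x 0))" for k
    using that by (intro Ck_on_diff Ck_on_mult Ck_on_const openin_cartesian) auto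
  with flat_has_real_derivative[of n] show "\<exists>f'. (\<forall>t. (f has_real_derivative f' t) (at t)) \<and>
      (\<forall>k. (\<forall>h\<in>range flat. Ck_on k 1 (cartesian 1) (\<lambda>x. h (x 0))) \<longrightarrow>
        Ck_on k 1 (cartesian 1) (\<lambda>x. f' (x 0)))"
    unfolding n by (intro exI[of _ "\<lambda>t. flat (n + 2) t - real n * flat (n + 1) t"]) blast
qed auto

lemma flat_0: "flat 0 t = (if t > 0 then exp (- inverse t) else 0)"
  by (simp add: flat_def)

text \<open>The classical step from 0 to 1 on the unit interval. The denominator is positive because
  t and 1 - t are never both nonpositive.\<close>

definition smooth_step :: "real \<Rightarrow> real"
  where "smooth_step t = flat 0 t * inverse (flat 0 t + flat 0 (1 - t))"

lemma flat_sum_pos: "flat 0 t + flat 0 (1 - t) > 0"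
  by (auto simp: flat_0 intro: add_pos_pos)

lemma smooth1_smooth_step: "smooth1 smooth_step"
  unfolding smooth1_def smooth_step_def
  by (intro allI Ck_on_mult Ck_on_inverse Ck_on_add Ck_on_smooth1[OF _ smooth1_flat] Ck_on_diff
      Ck_on_coord Ck_on_const openin_cartesian less_imp_neq[OF flat_sum_pos, symmetric])

lemma smooth_step_bounds: "0 \<le> smooth_step t" "smooth_step t \<le> 1"
  using flat_sum_pos[of t] by (auto simp: smooth_step_def flat_0 field_simps)

lemma smooth_step_eq: "t \<ge> 1 \<Longrightarrow> smooth_step t = 1" "t \<le> 0 \<Longrightarrow> smooth_step t = 0"
  using flat_sum_pos[of t] by (auto simp: smooth_step_def flat_0)

text \<open>With u = (x i - a i) / r, both 2 - u and 2 + u are at least 1 if |u| \<le> 1, and one of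
  them is at most 0 if |u| \<ge> 2. So the product is 1 on the closed cube of radius r > 0 and 0 off
  the one of radius 2r.\<close>

definition cube_bump :: "nat \<Rightarrow> (nat \<Rightarrow> real) \<Rightarrow> real \<Rightarrow> (nat \<Rightarrow> real) \<Rightarrow> real"
  where "cube_bump d a r x =
    (\<Prod>i<d. smooth_step (2 - inverse r * (x i - a i)) * smooth_step (2 + inverse r * (x i - a i)))"

lemma Ck_on_cube_bump: "Ck_on k d (cartesian d) (cube_bump d a r)"
  unfolding cube_bump_def[abs_def]
  by (intro Ck_on_prod Ck_on_mult Ck_on_smooth1[OF _ smooth1_smooth_step] Ck_on_diff Ck_on_add
      Ck_on_coord Ck_on_const openin_cartesian)

lemma cube_bump_bounds: "0 \<le> cube_bump d a r x" "cube_bump d a r x \<le> 1"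
  unfolding cube_bump_def
  by (auto intro!: prod_nonneg prod_le_1 mult_le_one mult_nonneg_nonneg smooth_step_bounds)

lemma cube_bump_eq_1:
  assumes "r > 0" "x \<in> ccube d a r"
  shows "cube_bump d a r x = 1"
  unfolding cube_bump_def
proof (rule prod.neutral, rule ballI)
  fix i assume "i \<in> {..<d}"
  then have "\<bar>inverse r * (x i - a i)\<bar> \<le> 1"
    using assms by (auto simp: ccube_def abs_mult field_simps)
  then show "smooth_step (2 - inverse r * (x i - a i)) * smooth_step (2 + inverse r * (x i - a i)) = 1"
    by (simp add: smooth_step_eq abs_le_iff)
qed

lemma cube_bump_eq_0:
  assumes "r > 0" "x \<in> cartesian d - ccube d a (2 * r)"
  shows "cube_bump d a r x = 0"
proof -
  obtain i where i: "i < d" "\<not> \<bar>x i - a i\<bar> \<le> 2 * r" using assms by (auto simp: ccube_def)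
  then have "\<bar>inverse r * (x i - a i)\<bar> > 2"
    using assms by (auto simp: abs_mult field_simps)
  then have "smooth_step (2 - inverse r * (x i - a i)) * smooth_step (2 + inverse r * (x i - a i)) = 0"
    by (auto simp: smooth_step_eq abs_if split: if_splits)
  then show ?thesis using i by (auto simp: cube_bump_def prod_zero_iff)
qed

text \<open>Cover C by finitely many cubes and take 1 minus the product of the complementary bumps:
  this stays between 0 and 1 and equals 1 wherever a single bump does, without any division. The
  value 1 is needed on an open set N around C, because later also derivatives are compared on
  C.\<close>

lemma smooth_bump_function:
  assumes O: "openin (Euclidean_space d) G" and C: "compactin (Euclidean_space d) C" and CO: "C \<subseteq> G"
  obtains b T N where "\<And>x. 0 \<le> b x" "\<And>x. b x \<le> 1" "compactin (Euclidean_space d) T" "T \<subseteq> G"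
    "\<And>x. x \<in> cartesian d - T \<Longrightarrow> b x = 0" "openin (Euclidean_space d) N" "C \<subseteq> N"
    "\<And>x. x \<in> N \<Longrightarrow> b x = 1" "\<And>k. Ck_on k d (cartesian d) b"
proof -
  have "\<exists>r>0. ccube d a (2 * r) \<subseteq> G" if "a \<in> C" for a
  proof -
    have "a \<in> G" using that CO by blast
    then obtain R where R: "R > 0" "cube d a R \<subseteq> G"
      using O unfolding openin_Euclidean_iff_cube by blast
    then have "ccube d a (2 * (R / 3)) \<subseteq> G"
      by (intro subset_trans[OF _ R(2)]) (force simp: ccube_def cube_def)
    then show ?thesis using R(1) by (intro exI[of _ "R / 3"]) auto
  qed
  then obtain r where r: "\<And>a. a \<in> C \<Longrightarrow> r a > 0" "\<And>a. a \<in> C \<Longrightarrow> ccube d a (2 * r a) \<subseteq> G" by metis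
  have Csub: "C \<subseteq> cartesian d" using C compactin_subset_topspace by blast
  have "openin (Euclidean_space d) (cube d a (r a)) \<and> a \<in> cube d a (r a)" if "a \<in> C" for a
    using Csub r(1) that openin_cube by (auto simp: cube_def)
  then obtain F where F: "finite F" "F \<subseteq> C" "C \<subseteq> (\<Union>a\<in>F. cube d a (r a))"
    by (rule compactin_choose_finite[OF C])
  define b where "b x = 1 - (\<Prod>a\<in>F. 1 - cube_bump d a (r a) x)" for x
  show ?thesis
  proof (rule that[of b "\<Union>a\<in>F. ccube d a (2 * r a)" "\<Union>a\<in>F. cube d a (r a)"])
    show "0 \<le> b x" "b x \<le> 1" for x
      by (auto simp: b_def intro!: prod_nonneg prod_le_1 cube_bump_bounds)
    show "compactin (Euclidean_space d) (\<Union>a\<in>F. ccube d a (2 * r a))"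
      using F by (intro compactin_Union) (auto intro: compactin_ccube)
    show "(\<Union>a\<in>F. ccube d a (2 * r a)) \<subseteq> G" using r F by blast
    show "openin (Euclidean_space d) (\<Union>a\<in>F. cube d a (r a))"
      by (auto intro: openin_cube)
    show "C \<subseteq> (\<Union>a\<in>F. cube d a (r a))" by (rule F)
    show "b x = 0" if x: "x \<in> cartesian d - (\<Union>a\<in>F. ccube d a (2 * r a))" for x
    proof -
      have "cube_bump d a (r a) x = 0" if "a \<in> F" for a
        using x that F r(1) by (intro cube_bump_eq_0) auto
      then show ?thesis by (simp add: b_def)
    qed
    show "b x = 1" if x: "x \<in> (\<Union>a\<in>F. cube d a (r a))" for x
    proof -
      obtain a where a: "a \<in> F" "x \<in> cube d a (r a)" using x by blast
      then have "x \<in> ccube d a (r a)" by (auto simp: cube_def ccube_def)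
      then have "cube_bump d a (r a) x = 1" using a F r(1) by (intro cube_bump_eq_1) auto
      then show ?thesis using a F by (auto simp: b_def prod_zero_iff)
    qed
    show "Ck_on k d (cartesian d) b" for k
      unfolding b_def[abs_def]
      by (intro Ck_on_diff Ck_on_prod Ck_on_const Ck_on_cube_bump openin_cartesian)
  qed
qed

section \<open>Radial diffeomorphisms\<close>

text \<open>The classical covering lemma, in the form in which the whole cube, including its part
  outside C, lies in a member.\<close>

lemma cube_Lebesgue_number:
  assumes C: "compactin (Euclidean_space d) C" and U: "\<And>i. i \<in> I \<Longrightarrow> openin (Euclidean_space d) (U i)"
    and CU: "C \<subseteq> (\<Union>i\<in>I. U i)"
  obtains \<epsilon> where "\<epsilon> > 0" "\<And>x. x \<in> C \<Longrightarrow> \<exists>i\<in>I. cube d x \<epsilon> \<subseteq> U i"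
proof -
  have "\<exists>r>0. \<exists>i\<in>I. cube d a (2 * r) \<subseteq> U i" if "a \<in> C" for a
  proof -
    obtain i where i: "i \<in> I" "a \<in> U i" using CU \<open>a \<in> C\<close> by blast
    then obtain R where R: "R > 0" "cube d a R \<subseteq> U i"
      using U[OF i(1)] unfolding openin_Euclidean_iff_cube by blast
    then show ?thesis using i(1) by (intro exI[of _ "R / 2"]) auto
  qed
  then obtain r where r: "\<And>a. a \<in> C \<Longrightarrow> r a > 0" "\<And>a. a \<in> C \<Longrightarrow> \<exists>i\<in>I. cube d a (2 * r a) \<subseteq> U i" by metis
  have Csub: "C \<subseteq> cartesian d" using C compactin_subset_topspace by blast
  have "openin (Euclidean_space d) (cube d a (r a)) \<and> a \<in> cube d a (r a)" if "a \<in> C" for a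
    using Csub r(1) that openin_cube by (auto simp: cube_def)
  then obtain F where F: "finite F" "F \<subseteq> C" "C \<subseteq> (\<Union>a\<in>F. cube d a (r a))"
    by (rule compactin_choose_finite[OF C])
  define e where "e = Min (insert 1 (r ` F))"
  have e0: "e > 0" unfolding e_def using F r by (subst Min_gr_iff) auto
  have er: "e \<le> r a" if "a \<in> F" for a unfolding e_def using that F by (intro Min_le) auto
  show ?thesis
  proof (rule that[OF e0])
    fix x assume "x \<in> C"
    then obtain a where a: "a \<in> F" "x \<in> cube d a (r a)" using F by blast
    have "cube d x e \<subseteq> cube d a (2 * r a)"
      using a er[OF a(1)] by (force simp: cube_def)
    then show "\<exists>i\<in>I. cube d x e \<subseteq> U i" using r(2) a(1) F(2) by blast
  qed
qed

section \<open>Rapidly growing smooth functions and inverse functions\<close>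

lemma flat_0_mono: "s \<le> t \<Longrightarrow> flat 0 s \<le> flat 0 t"
  by (auto simp: flat_0 intro: le_imp_inverse_le)

lemma flat_0_nonneg: "0 \<le> flat 0 t"
  by (simp add: flat_0)

lemma continuous_on_smooth1: "smooth1 g \<Longrightarrow> continuous_on A g"
  using smooth1_has_real_derivative DERIV_isCont continuous_at_imp_continuous_on by blast

text \<open>Summand k vanishes for t \<le> k, so the sum is locally finite and therefore smooth, and
  each summand is nondecreasing. The bound \<open>real k - 1\<close> fits the later choice of k as
  the ceiling of a squared norm.\<close>

lemma smooth1_growth:
  fixes c :: "nat \<Rightarrow> real"
  assumes c: "\<And>k. c k \<ge> 0"
  obtains \<phi> where "smooth1 \<phi>" "mono \<phi>" "\<And>t. \<phi> t \<ge> 1" "\<And>t. t \<le> 0 \<Longrightarrow> \<phi> t = \<phi> 0"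
    "\<And>k t. 0 \<le> t \<Longrightarrow> t > real k - 1 \<Longrightarrow> \<phi> t \<ge> c k"
proof -
  \<comment> \<open>For t > k + 1 the factor \<open>flat 0 (t - real k)\<close> is at least
    \<open>flat 0 1\<close>, that is exp (-1), so summand k reaches c (k + 2). The remaining values
    c 0 and c 1 go into the constant term.\<close>
  define b where "b k = exp 1 * c (k + 2)" for k
  define \<phi> where "\<phi> t = 1 + c 0 + c 1 + (\<Sum>k<nat \<lceil>t\<rceil>. b k * flat 0 (t - real k))" for t
  have \<phi>_eq: "\<phi> t = 1 + c 0 + c 1 + (\<Sum>k<K. b k * flat 0 (t - real k))" if "t \<le> real K" for t K
  proof -
    have "nat \<lceil>t\<rceil> \<le> K" using that by linarith
    then have "(\<Sum>k<nat \<lceil>t\<rceil>. b k * flat 0 (t - real k)) = (\<Sum>k<K. b k * flat 0 (t - real k))"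
      by (intro sum.mono_neutral_left) (auto simp: flat_0 not_less)
    then show ?thesis by (simp add: \<phi>_def)
  qed
  have b0: "b k \<ge> 0" for k using c by (simp add: b_def)
  show ?thesis
  proof (rule that[of \<phi>])
    show "smooth1 \<phi>"
      unfolding smooth1_def
    proof (intro allI Ck_on_local[OF openin_cartesian])
      fix k and x :: "nat \<Rightarrow> real" assume x: "x \<in> cartesian 1"
      \<comment> \<open>The added 1 makes x 0 < K strict, so that one finite sum represents \<phi>
        on a neighbourhood.\<close>
      define K where "K = nat \<lceil>x 0\<rceil> + 1"
      let ?T = "{x \<in> topspace (Euclidean_space 1). x 0 \<in> {..<real K}}"
      have T: "openin (Euclidean_space 1) ?T"
        by (rule openin_continuous_map_preimage[OF continuous_map_Euclidean_coord]) simp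
      have "x 0 < real K" unfolding K_def by linarith
      then have "x \<in> ?T" using x by simp
      moreover have "Ck_on k 1 ?T (\<lambda>x. 1 + c 0 + c 1 + (\<Sum>k<K. b k * flat 0 (x 0 - real k)))"
        by (intro Ck_on_add Ck_on_sum Ck_on_mult Ck_on_smooth1[OF _ smooth1_flat] Ck_on_diff Ck_on_coord Ck_on_const T)
      then have "Ck_on k 1 ?T (\<lambda>x. \<phi> (x 0))"
      proof (rule Ck_on_cong_imp[OF T, rotated])
        show "1 + c 0 + c 1 + (\<Sum>k<K. b k * flat 0 (x 0 - real k)) = \<phi> (x 0)" if "x \<in> ?T" for x
          using that \<phi>_eq[of "x 0" K] by simp
      qed
      ultimately show "\<exists>T. openin (Euclidean_space 1) T \<and> x \<in> T \<and> Ck_on k 1 T (\<lambda>x. \<phi> (x 0))"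
        using T by blast
    qed
    show "mono \<phi>"
    proof
      fix s t :: real assume st: "s \<le> t"
      define K where "K = nat \<lceil>t\<rceil>"
      have K: "t \<le> real K" "s \<le> real K" using st unfolding K_def by linarith+
      show "\<phi> s \<le> \<phi> t"
        unfolding \<phi>_eq[OF K(1)] \<phi>_eq[OF K(2)]
        using st b0 by (intro add_left_mono sum_mono mult_left_mono flat_0_mono) auto
    qed
    have sum0: "0 \<le> (\<Sum>k<K. b k * flat 0 (t - real k))" for K t
      using b0 flat_0_nonneg by (intro sum_nonneg mult_nonneg_nonneg)
    show "\<phi> t \<ge> 1" for t
      using sum0 c[of 0] c[of 1] by (simp add: \<phi>_def add_nonneg_nonneg add.assoc)
    show "\<phi> t = \<phi> 0" if "t \<le> 0" for t
      using that by (simp add: \<phi>_def)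
    show "\<phi> t \<ge> c k" if t: "0 \<le> t" "t > real k - 1" for k t
    proof (cases "k \<le> 1")
      case True
      then have "c k \<le> c 0 + c 1" using c by (cases k) auto
      then show ?thesis using sum0[of t "nat \<lceil>t\<rceil>"] by (simp add: \<phi>_def)
    next
      case False
      define j where "j = k - 2"
      have kj: "k = j + 2" using False by (simp add: j_def)
      have "j \<in> {..<nat \<lceil>t\<rceil>}" using t kj by simp linarith
      then have "b j * flat 0 (t - real j) \<le> (\<Sum>k<nat \<lceil>t\<rceil>. b k * flat 0 (t - real k))"
        using b0 flat_0_nonneg by (intro member_le_sum) auto
      moreover have "flat 0 1 \<le> flat 0 (t - real j)" using t kj by (intro flat_0_mono) simp
      then have "b j * flat 0 1 \<le> b j * flat 0 (t - real j)" using b0 by (intro mult_left_mono)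
      moreover have "b j * flat 0 1 = c k" by (simp add: b_def flat_0 kj exp_minus field_simps)
      ultimately show ?thesis using c[of 0] c[of 1] by (simp add: \<phi>_def)
    qed
  qed
qed

text \<open>The formula H' = 1 / G'(H) expresses the derivative of H through H itself, so the family
  {H} suffices for \<open>smooth1_coinduct\<close>.\<close>

lemma smooth1_inverse_function:
  assumes G: "smooth1 G" and pos: "\<And>t. deriv G t > 0"
    and GH: "\<And>s. G (H s) = s" and HG: "\<And>t. H (G t) = t"
  shows "smooth1 H"
proof -
  have "isCont H s" for s
    using isCont_inverse_function[of 1 "H s" H G] HG GH smooth1_has_real_derivative[OF G] DERIV_isCont
    by (metis zero_less_one)
  then have H': "(H has_real_derivative inverse (deriv G (H s))) (at s)" for s
    using smooth1_has_real_derivative[OF G, of "H s"] pos[of "H s"] GH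
    by (intro DERIV_inverse_function[where f = G and a = "s - 1" and b = "s + 1"]) auto
  show ?thesis
  proof (rule smooth1_coinduct[of H "{H}"])
    fix f assume "f \<in> {H}"
    moreover have "Ck_on k 1 (cartesian 1) (\<lambda>x. inverse (deriv G (H (x 0))))"
      if "Ck_on k 1 (cartesian 1) (\<lambda>x. H (x 0))" for k
      using that pos
      by (intro Ck_on_inverse Ck_on_smooth1[OF _ smooth1_deriv[OF G]] openin_cartesian)
        (metis less_irrefl)
    ultimately show "\<exists>f'. (\<forall>t. (f has_real_derivative f' t) (at t)) \<and>
      (\<forall>k. (\<forall>h\<in>{H}. Ck_on k 1 (cartesian 1) (\<lambda>x. h (x 0))) \<longrightarrow> Ck_on k 1 (cartesian 1) (\<lambda>x. f' (x 0)))"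
      using H' by (intro exI[of _ "\<lambda>s. inverse (deriv G (H s))"]) simp
  qed simp
qed

section \<open>Radial maps and Euclidean distance\<close>

definition sqnorm :: "nat \<Rightarrow> (nat \<Rightarrow> real) \<Rightarrow> real"
  where "sqnorm n x = (\<Sum>i<n. (x i)\<^sup>2)"

lemma Ck_on_sqnorm: "openin (Euclidean_space n) S \<Longrightarrow> Ck_on k n S (sqnorm n)"
  unfolding sqnorm_def[abs_def] power2_eq_square
  by (intro Ck_on_sum Ck_on_mult Ck_on_coord)

lemma sqnorm_nonneg: "0 \<le> sqnorm n x"
  by (simp add: sqnorm_def sum_nonneg)

lemma sqnorm_scale: "sqnorm n (\<lambda>i. a * x i) = a\<^sup>2 * sqnorm n x"
  by (simp add: sqnorm_def power_mult_distrib sum_distrib_left)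

lemma eucl_dist_eq_L2_set: "eucl_dist n x y = L2_set (\<lambda>i. x i - y i) {..<n}"
  by (simp add: eucl_dist_def L2_set_def)

lemma eucl_dist_commute: "eucl_dist n x y = eucl_dist n y x"
  by (simp add: eucl_dist_def power2_commute)

lemma eucl_dist_triangle: "eucl_dist n x z \<le> eucl_dist n x y + eucl_dist n y z"
  using L2_set_triangle_ineq[of "\<lambda>i. x i - y i" "\<lambda>i. y i - z i" "{..<n}"]
  by (simp add: eucl_dist_eq_L2_set)

lemma abs_coord_diff_le_eucl_dist: "i < n \<Longrightarrow> \<bar>x i - y i\<bar> \<le> eucl_dist n x y"
  using member_le_L2_set[of "{..<n}" i "\<lambda>i. \<bar>x i - y i\<bar>"]
  by (simp add: eucl_dist_def L2_set_def)

lemma eucl_dist_less_2_of_unit_ball: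
  assumes "x \<in> eucl_ball n c 1" "y \<in> eucl_ball n c 1"
  shows "eucl_dist n x y < 2"
  using assms eucl_dist_triangle[of n x y c] eucl_dist_commute[of n x c] by (simp add: eucl_ball_def)

text \<open>Write a x - b y = a (x - y) - (b - a) y and expand the square. The cross term is 2 a (b
  - a) P with P the inner product of y - x and y, and 2 P = |y|^2 - |x|^2 + |x - y|^2 is
  nonnegative.\<close>

lemma eucl_dist_radial_ge_aux:
  assumes "0 \<le> a" "a \<le> b" "sqnorm n x \<le> sqnorm n y"
  shows "a * eucl_dist n x y \<le> eucl_dist n (\<lambda>i. a * x i) (\<lambda>i. b * y i)"
proof -
  define P where "P = (\<Sum>i<n. (y i - x i) * y i)"
  have "2 * P = sqnorm n y - sqnorm n x + (\<Sum>i<n. (x i - y i)\<^sup>2)"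
    unfolding P_def sqnorm_def sum_distrib_left sum_subtractf[symmetric] sum.distrib[symmetric]
    by (intro sum.cong) (auto simp: power2_eq_square algebra_simps)
  then have P: "P \<ge> 0" using assms(3) sum_nonneg[of "{..<n}" "\<lambda>i. (x i - y i)\<^sup>2"] by simp
  have "(\<Sum>i<n. (a * x i - b * y i)\<^sup>2) =
      a\<^sup>2 * (\<Sum>i<n. (x i - y i)\<^sup>2) + (b - a)\<^sup>2 * sqnorm n y + 2 * a * (b - a) * P"
    unfolding P_def sqnorm_def sum_distrib_left sum.distrib[symmetric]
    by (intro sum.cong) (auto simp: power2_eq_square algebra_simps)
  also have "\<dots> \<ge> a\<^sup>2 * (\<Sum>i<n. (x i - y i)\<^sup>2)"
    using assms P sqnorm_nonneg[of n y] by simp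
  finally have "sqrt (a\<^sup>2 * (\<Sum>i<n. (x i - y i)\<^sup>2)) \<le> sqrt (\<Sum>i<n. (a * x i - b * y i)\<^sup>2)"
    by simp
  then show ?thesis using assms by (simp add: eucl_dist_def real_sqrt_mult)
qed

lemma eucl_dist_radial_ge:
  assumes "mono \<phi>" "\<And>t. \<phi> t \<ge> 0"
  shows "\<phi> (min (sqnorm n x) (sqnorm n y)) * eucl_dist n x y \<le>
    eucl_dist n (\<lambda>i. \<phi> (sqnorm n x) * x i) (\<lambda>i. \<phi> (sqnorm n y) * y i)"
proof (cases "sqnorm n x \<le> sqnorm n y")
  case True
  then show ?thesis
    using eucl_dist_radial_ge_aux[OF assms(2) monoD[OF assms(1) True] True] by (simp add: min_def)
next
  case False
  then have le: "sqnorm n y \<le> sqnorm n x" by simp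
  then show ?thesis
    using eucl_dist_radial_ge_aux[OF assms(2) monoD[OF assms(1) le] le] False eucl_dist_commute
    by (simp add: min_def)
qed

text \<open>The map acts on squared norms by G t = t \<phi>(t)^2, so inverting it reduces to
  inverting G. Squared norms, unlike norms, are smooth at the origin, so both the map and its
  inverse are smooth there too.\<close>

lemma radial_diffeomorphism:
  assumes \<phi>: "smooth1 \<phi>" "mono \<phi>" "\<And>t. \<phi> t \<ge> 1" "\<And>t. t \<le> 0 \<Longrightarrow> \<phi> t = \<phi> 0"
  shows "diffeomorphism n (\<lambda>x i. \<phi> (sqnorm n x) * x i)"
proof -
  define G where "G t = t * \<phi> t * \<phi> t" for t
  have \<phi>': "(\<phi> has_real_derivative deriv \<phi> t) (at t)" for t
    by (rule smooth1_has_real_derivative[OF \<phi>(1)])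
  have G': "(G has_real_derivative \<phi> t * \<phi> t + 2 * t * \<phi> t * deriv \<phi> t) (at t)" for t
    unfolding G_def[abs_def] by (auto intro!: derivative_eq_intros \<phi>' simp: algebra_simps)
  \<comment> \<open>For negative t monotonicity of \<phi> would give the wrong sign; there \<phi> is
    constant and its derivative vanishes. Thus G' > 0 on the whole line, and inverting G involves no
    boundary point.\<close>
  have nonneg: "0 \<le> t * deriv \<phi> t" for t
  proof (cases "t < 0")
    case True
    have "(\<phi> has_real_derivative 0) (at t)"
    proof (rule has_field_derivative_transform_within_open[of "\<lambda>_. \<phi> 0" _ _ "{..<0}"])
      show "\<phi> 0 = \<phi> x" if "x \<in> {..<0}" for x using \<phi>(4)[of x] that by simp
    qed (use True in auto)
    then show ?thesis by (simp add: DERIV_imp_deriv)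
  next
    case False
    have "deriv \<phi> t \<ge> 0"
      using \<phi>' \<phi>(2) by (intro mono_on_imp_deriv_nonneg[of UNIV \<phi>]) (auto simp: mono_def mono_on_def)
    then show ?thesis using False by simp
  qed
  have G'_eq: "deriv G t = \<phi> t * \<phi> t + 2 * t * \<phi> t * deriv \<phi> t" for t
    using G' by (rule DERIV_imp_deriv)
  have G'_pos: "deriv G t > 0" for t
  proof -
    have "\<phi> t * \<phi> t > 0" using \<phi>(3)[of t] by simp
    moreover have "2 * \<phi> t * (t * deriv \<phi> t) \<ge> 0" using nonneg \<phi>(3)[of t] by simp
    ultimately show ?thesis unfolding G'_eq by (simp add: algebra_simps)
  qed
  have smG: "smooth1 G"
    unfolding smooth1_def G_def[abs_def]
    by (intro allI Ck_on_mult Ck_on_coord Ck_on_smooth1[OF _ \<phi>(1)] openin_cartesian)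
  have less: "G s < G t" if "s < t" for s t
    using DERIV_pos_imp_increasing[OF that, of G] G' G'_pos G'_eq by metis
  have sqge: "\<phi> t * \<phi> t \<ge> 1" for t
    using mult_mono[of 1 "\<phi> t" 1 "\<phi> t"] \<phi>(3)[of t] by simp
  \<comment> \<open>Since \<phi>^2 \<ge> 1, the values of G at -|s| and |s| enclose s.\<close>
  have "\<exists>t. G t = s" for s
  proof -
    have "G (- \<bar>s\<bar>) \<le> - \<bar>s\<bar>" "G \<bar>s\<bar> \<ge> \<bar>s\<bar>"
      using mult_left_mono[OF sqge[of "\<bar>s\<bar>"], of "\<bar>s\<bar>"] mult_left_mono[OF sqge[of "- \<bar>s\<bar>"], of "\<bar>s\<bar>"]
      by (auto simp: G_def mult.assoc)
    then have "\<exists>t\<ge>- \<bar>s\<bar>. t \<le> \<bar>s\<bar> \<and> G t = s"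
      using continuous_on_smooth1[OF smG] by (intro IVT') auto
    then show ?thesis by blast
  qed
  then obtain H where GH: "\<And>s. G (H s) = s" by metis
  have HG: "H (G t) = t" for t
    using less GH[of "G t"] by (metis less_irrefl linorder_less_linear)
  have smH: "smooth1 H" by (rule smooth1_inverse_function[OF smG G'_pos GH HG])
  let ?f = "\<lambda>x i. \<phi> (sqnorm n x) * x i"
  let ?g = "\<lambda>y i. inverse (\<phi> (H (sqnorm n y))) * y i"
  have nz: "\<phi> t \<noteq> 0" for t using \<phi>(3)[of t] by simp
  have sqf: "sqnorm n (?f x) = G (sqnorm n x)" for x
    by (simp add: sqnorm_scale G_def power2_eq_square)
  have gf: "?g (?f x) = x" for x
    unfolding sqf HG using nz by (simp add: mult.assoc[symmetric])
  have sqg: "sqnorm n (?g y) = H (sqnorm n y)" for y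
  proof -
    have "sqnorm n (?g y) = sqnorm n y / (\<phi> (H (sqnorm n y)) * \<phi> (H (sqnorm n y)))"
      unfolding sqnorm_scale by (simp add: power2_eq_square divide_inverse mult.commute)
    also have "\<dots> = H (sqnorm n y)"
      using GH[of "sqnorm n y"] nz[of "H (sqnorm n y)"] by (simp add: G_def field_simps)
    finally show ?thesis .
  qed
  have fg: "?f (?g y) = y" for y
    unfolding sqg using nz by (simp add: mult.assoc[symmetric])
  have fc: "?f x \<in> cartesian n" and gc: "?g x \<in> cartesian n" if "x \<in> cartesian n" for x
    using that by (auto simp: cartesian_iff)
  have bij: "bij_betw ?f (cartesian n) (cartesian n)"
    by (rule bij_betw_byWitness[where f' = ?g]) (use gf fg fc gc in auto)
  have inv: "inv_into (cartesian n) ?f y = ?g y" if "y \<in> cartesian n" for y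
    using inv_into_f_f[of ?f "cartesian n" "?g y"] bij gc[OF that] fg[of y] by (simp add: bij_betw_def)
  have "smooth_on n (cartesian n) n ?f"
    unfolding smooth_on_def using fc
    by (auto intro!: Ck_on_mult Ck_on_smooth1[OF _ \<phi>(1)] Ck_on_sqnorm Ck_on_coord)
  moreover have "Ck_on k n (cartesian n) (\<lambda>y. ?g y j)" for k j
    using nz by (intro Ck_on_mult Ck_on_inverse Ck_on_smooth1[OF _ \<phi>(1)] Ck_on_smooth1[OF _ smH]
        Ck_on_sqnorm Ck_on_coord openin_cartesian) auto
  then have "Ck_on k n (cartesian n) (\<lambda>y. inv_into (cartesian n) ?f y j)" for k j
    by (rule Ck_on_cong_imp[OF openin_cartesian, rotated]) (simp only: inv)
  then have "smooth_on n (cartesian n) n (inv_into (cartesian n) ?f)"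
    unfolding smooth_on_def using gc inv by auto
  ultimately show ?thesis using bij by (simp add: diffeomorphism_def)
qed

lemma compactin_sqnorm_ball: "compactin (Euclidean_space n) {x \<in> cartesian n. sqnorm n x \<le> R}"
proof (rule closed_compactin[OF compactin_ccube])
  \<comment> \<open>The radius R + 1 avoids a square root: 2 |u| \<le> u^2 + 1.\<close>
  show "{x \<in> cartesian n. sqnorm n x \<le> R} \<subseteq> ccube n (\<lambda>_. 0) (R + 1)"
  proof
    fix x assume x: "x \<in> {x \<in> cartesian n. sqnorm n x \<le> R}"
    have "\<bar>x i\<bar> \<le> R + 1" if "i < n" for i
    proof -
      have "(x i)\<^sup>2 \<le> sqnorm n x" unfolding sqnorm_def using that by (intro member_le_sum) auto
      also have "\<dots> \<le> R" using x by simp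
      finally have "\<bar>x i\<bar>\<^sup>2 \<le> R" by simp
      moreover have "2 * \<bar>x i\<bar> \<le> \<bar>x i\<bar>\<^sup>2 + 1"
        using zero_le_power2[of "\<bar>x i\<bar> - 1"] by (simp add: power2_diff)
      ultimately show ?thesis using abs_ge_zero[of "x i"] by linarith
    qed
    then show "x \<in> ccube n (\<lambda>_. 0) (R + 1)" using x by (simp add: ccube_def)
  qed
  have "continuous_map (Euclidean_space n) euclideanreal (sqnorm n)"
    using Ck_on_sqnorm[OF openin_cartesian, of 0] by simp
  from closedin_continuous_map_preimage[OF this, of "{..R}"]
  show "closedin (Euclidean_space n) {x \<in> cartesian n. sqnorm n x \<le> R}" by simp
qed

theorem Euclidean_diffeomorphism_Lebesgue_number_1:
  assumes cov: "open_cover (Euclidean_space n) I U"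
  shows "\<exists>f. diffeomorphism n f \<and> unit_ball_preimages_subordinate (Euclidean_space n) I U n f"
proof -
  let ?B = "\<lambda>k::nat. {x \<in> cartesian n. sqnorm n x \<le> real k}"
  have "\<exists>\<epsilon>>0. \<forall>x\<in>?B k. \<exists>i\<in>I. cube n x \<epsilon> \<subseteq> U i" for k
    using cov cube_Lebesgue_number[OF compactin_sqnorm_ball, of I n U "real k"]
    unfolding open_cover_def by (smt (verit) mem_Collect_eq subset_iff)
  then obtain \<epsilon> where \<epsilon>: "\<And>k. \<epsilon> k > 0" "\<And>k x. x \<in> ?B k \<Longrightarrow> \<exists>i\<in>I. cube n x (\<epsilon> k) \<subseteq> U i"
    by metis
  \<comment> \<open>Images of points in one preimage are less than 2 apart, so expansion by at least
    2 / \<epsilon> forces the points themselves to be closer than \<epsilon>.\<close>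
  have "\<And>k. 2 / \<epsilon> k \<ge> 0" using \<epsilon>(1) less_imp_le by (metis divide_nonneg_pos zero_le_numeral)
  then obtain \<phi> where \<phi>: "smooth1 \<phi>" "mono \<phi>" "\<And>t. \<phi> t \<ge> 1"
      "\<And>t. t \<le> 0 \<Longrightarrow> \<phi> t = \<phi> 0" "\<And>k t. 0 \<le> t \<Longrightarrow> t > real k - 1 \<Longrightarrow> \<phi> t \<ge> 2 / \<epsilon> k"
    by (rule smooth1_growth[of "\<lambda>k. 2 / \<epsilon> k"]) blast
  define f where "f = (\<lambda>x i. \<phi> (sqnorm n x) * x i)"
  have diff: "diffeomorphism n f" unfolding f_def by (rule radial_diffeomorphism[OF \<phi>(1-4)])
  moreover have "unit_ball_preimages_subordinate (Euclidean_space n) I U n f"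
    unfolding unit_ball_preimages_subordinate_def
  proof
    fix c assume c: "c \<in> cartesian n"
    define P where "P = {x \<in> cartesian n. f x \<in> eucl_ball n c 1}"
    \<comment> \<open>As \<open>f\<close> is onto, the centre of the ball is a value of
      \<open>f\<close>, and the preimage P is nonempty.\<close>
    have "c \<in> eucl_ball n c 1" using c by (simp add: eucl_ball_def eucl_dist_def)
    moreover have "c \<in> f ` cartesian n"
      using diff c by (simp add: diffeomorphism_def bij_betw_def)
    ultimately have "\<exists>x. x \<in> P" unfolding P_def by auto
    \<comment> \<open>Choose x in the lowest shell that P meets. With k the ceiling of |x|^2, the
      point x belongs to the k-th ball, and every y in P still has |y|^2 > k - 1. So the lower bound
      on \<phi> holds at the smaller of the two squared norms.\<close>
    then obtain x where x: "x \<in> P" "\<And>y. y \<in> P \<Longrightarrow> nat \<lceil>sqnorm n x\<rceil> \<le> nat \<lceil>sqnorm n y\<rceil>"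
      using exists_least_iff[of "\<lambda>k. \<exists>x\<in>P. nat \<lceil>sqnorm n x\<rceil> = k"]
      by (metis not_le)
    define k where "k = nat \<lceil>sqnorm n x\<rceil>"
    have "x \<in> ?B k" using x(1) unfolding k_def P_def by (auto simp: of_nat_ceiling)
    then obtain i where i: "i \<in> I" "cube n x (\<epsilon> k) \<subseteq> U i" using \<epsilon>(2) by blast
    have "P \<subseteq> cube n x (\<epsilon> k)"
    proof
      fix y assume y: "y \<in> P"
      let ?m = "min (sqnorm n x) (sqnorm n y)"
      have "real k - 1 < sqnorm n x" "real k - 1 < sqnorm n y"
        using x(2)[OF y] sqnorm_nonneg[of n x] sqnorm_nonneg[of n y] unfolding k_def by linarith+
      then have "2 / \<epsilon> k \<le> \<phi> ?m"
        using sqnorm_nonneg by (intro \<phi>(5)) auto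
      then have "2 / \<epsilon> k * eucl_dist n x y \<le> \<phi> ?m * eucl_dist n x y"
        by (intro mult_right_mono) (auto simp: eucl_dist_def sum_nonneg)
      also have "\<dots> \<le> eucl_dist n (f x) (f y)"
        unfolding f_def using \<phi>(3) by (intro eucl_dist_radial_ge \<phi>(2)) (meson order_trans zero_le_one)
      also have "\<dots> < 2"
        using x(1) y by (intro eucl_dist_less_2_of_unit_ball) (auto simp: P_def)
      finally have d: "eucl_dist n x y < \<epsilon> k" using \<epsilon>(1)[of k] by (simp add: field_simps)
      have "\<bar>y i - x i\<bar> < \<epsilon> k" if "i < n" for i
        using abs_coord_diff_le_eucl_dist[OF that, of x y] d by (simp add: abs_minus_commute)
      then show "y \<in> cube n x (\<epsilon> k)" using y by (simp add: cube_def P_def)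
    qed
    then show "\<exists>i\<in>I. {x \<in> topspace (Euclidean_space n). f x \<in> eucl_ball n c 1} \<subseteq> U i"
      using i unfolding P_def by blast
  qed
  ultimately show ?thesis by blast
qed

section \<open>Charts\<close>

lemma chart_homeomorphic_map:
  assumes "is_chart d X (V, p)"
  shows "homeomorphic_map (subtopology X V) (subtopology (Euclidean_space d) (p ` V)) p"
    and "openin X V" and "openin (Euclidean_space d) (p ` V)"
  using assms by (auto simp: is_chart_def)

lemma chart_topspace:
  assumes "is_chart d X (V, p)"
  shows "V \<subseteq> topspace X" "p ` V \<subseteq> cartesian d"
  using assms openin_subset by (auto simp: is_chart_def)

lemma chart_inj_on:
  assumes "is_chart d X (V, p)"
  shows "inj_on p V"
  using homeomorphic_imp_injective_map[OF chart_homeomorphic_map(1)[OF assms]] chart_topspace[OF assms]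
  by (simp add: inf.absorb2)

lemma chart_continuous_map:
  assumes "is_chart d X (V, p)"
  shows "continuous_map (subtopology X V) (Euclidean_space d) p"
  using homeomorphic_imp_continuous_map[OF chart_homeomorphic_map(1)[OF assms]]
  by (simp add: continuous_map_in_subtopology)

lemma chart_openin_image:
  assumes "is_chart d X (V, p)" "openin X G" "G \<subseteq> V"
  shows "openin (Euclidean_space d) (p ` G)"
proof -
  have "openin (subtopology X V) G"
    using assms chart_homeomorphic_map(2) by (metis openin_open_subtopology)
  then have "openin (subtopology (Euclidean_space d) (p ` V)) (p ` G)"
    using homeomorphic_imp_open_map[OF chart_homeomorphic_map(1)[OF assms(1)]] by (simp add: open_map_def)
  then show ?thesis
    using chart_homeomorphic_map(3)[OF assms(1)] by (simp add: openin_open_subtopology)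
qed

lemma chart_openin_preimage:
  assumes "is_chart d X (V, p)" "openin (Euclidean_space d) G"
  shows "openin X {y \<in> V. p y \<in> G}"
proof -
  have "openin (subtopology X V) {y \<in> topspace (subtopology X V). p y \<in> G}"
    using chart_continuous_map[OF assms(1)] assms(2) by (rule openin_continuous_map_preimage)
  moreover have "{y \<in> topspace (subtopology X V). p y \<in> G} = {y \<in> V. p y \<in> G}"
    using chart_topspace[OF assms(1)] by auto
  ultimately show ?thesis
    using chart_homeomorphic_map(2)[OF assms(1)] by (simp add: openin_open_subtopology)
qed

lemma chart_compactin_iff:
  assumes "is_chart d X (V, p)" "C \<subseteq> V"
  shows "compactin (Euclidean_space d) (p ` C) \<longleftrightarrow> compactin X C"
proof -
  have "compactin (subtopology (Euclidean_space d) (p ` V)) (p ` C) \<longleftrightarrow> compactin (subtopology X V) C"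
    using homeomorphic_map_compactness[OF chart_homeomorphic_map(1)[OF assms(1)]] assms(2)
      chart_topspace[OF assms(1)] by (simp add: topspace_subtopology_subset)
  then show ?thesis using assms(2) by (auto simp: compactin_subtopology)
qed

lemma chart_compactin_preimage:
  assumes "is_chart d X (V, p)" "compactin (Euclidean_space d) T" "T \<subseteq> p ` V"
  shows "compactin X {y \<in> V. p y \<in> T}"
proof -
  have "p ` {y \<in> V. p y \<in> T} = T" using assms(3) by auto
  then show ?thesis
    using chart_compactin_iff[OF assms(1), of "{y \<in> V. p y \<in> T}"] assms(2) by auto
qed

definition locally_Euclidean_by ::
  "nat \<Rightarrow> 'a topology \<Rightarrow> ('a set \<times> ('a \<Rightarrow> nat \<Rightarrow> real)) set \<Rightarrow> bool"
  where "locally_Euclidean_by d X A \<longleftrightarrow> (\<forall>c\<in>A. is_chart d X c) \<and> topspace X \<subseteq> (\<Union>(V, p)\<in>A. V)"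

lemma locally_Euclidean_byE:
  assumes "locally_Euclidean_by d X A" "x \<in> topspace X"
  obtains V p where "(V, p) \<in> A" "is_chart d X (V, p)" "x \<in> V"
  using assms unfolding locally_Euclidean_by_def by blast

lemma locally_Euclidean_imp_locally_compact:
  assumes A: "locally_Euclidean_by d X A"
  shows "locally_compact_space X"
  unfolding locally_compact_space_def
proof
  fix x assume "x \<in> topspace X"
  then obtain V p where V: "is_chart d X (V, p)" "x \<in> V" using locally_Euclidean_byE[OF A] by blast
  have "p x \<in> p ` V" using V(2) by blast
  then obtain r where r: "r > 0" "cube d (p x) r \<subseteq> p ` V"
    using chart_homeomorphic_map(3)[OF V(1)] unfolding openin_Euclidean_iff_cube by blast
  have sub: "ccube d (p x) (r / 2) \<subseteq> p ` V"
    using r by (intro subset_trans[OF _ r(2)]) (force simp: ccube_def cube_def)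
  have "openin X {y \<in> V. p y \<in> cube d (p x) (r / 2)}"
    by (rule chart_openin_preimage[OF V(1) openin_cube])
  moreover have "compactin X {y \<in> V. p y \<in> ccube d (p x) (r / 2)}"
    by (rule chart_compactin_preimage[OF V(1) compactin_ccube sub])
  moreover have "x \<in> {y \<in> V. p y \<in> cube d (p x) (r / 2)}"
    using V chart_topspace[OF V(1)] r by (auto simp: cube_def)
  moreover have "{y \<in> V. p y \<in> cube d (p x) (r / 2)} \<subseteq> {y \<in> V. p y \<in> ccube d (p x) (r / 2)}"
    by (auto simp: cube_def ccube_def)
  ultimately show "\<exists>U K. openin X U \<and> compactin X K \<and> x \<in> U \<and> U \<subseteq> K" by blast
qed

lemma compact_neighbourhood:
  assumes "Hausdorff_space X" "locally_compact_space X" "openin X G" "x \<in> G"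
  obtains N C where "openin X N" "compactin X C" "x \<in> N" "N \<subseteq> C" "C \<subseteq> G"
proof -
  have "neighbourhood_base_of (compactin X) X"
    using locally_compact_space_neighbourhood_base[of X] assms(1,2) by blast
  then have "\<exists>N C. openin X N \<and> compactin X C \<and> x \<in> N \<and> N \<subseteq> C \<and> C \<subseteq> G"
    using assms(3,4) unfolding neighbourhood_base_of by blast
  then show ?thesis using that by blast
qed

section \<open>Bounded order\<close>

text \<open>Indices are counted rather than sets, so that shrinking the members of a family can only
  lower the count.\<close>

definition order_at_most :: "nat \<Rightarrow> 'i set \<Rightarrow> ('i \<Rightarrow> 'a set) \<Rightarrow> 'a set \<Rightarrow> bool"
  where "order_at_most D I U S \<longleftrightarrow> (\<forall>x\<in>S. finite {i\<in>I. x \<in> U i} \<and> card {i\<in>I. x \<in> U i} \<le> D)"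

text \<open>Closed grid cells of side \<open>s\<close>, thickened so little that distinct bricks whose indices agree
  modulo 2 are disjoint.\<close>

definition brick :: "nat \<Rightarrow> real \<Rightarrow> (nat \<Rightarrow> int) \<Rightarrow> (nat \<Rightarrow> real) set"
  where "brick d s m = {x \<in> cartesian d. \<forall>i<d. \<bar>x i - s * (of_int (m i) + 1 / 2)\<bar> < s * (3 / 4)}"

lemma brick_eq_cube: "brick d s m = cube d (\<lambda>i. s * (of_int (m i) + 1 / 2)) (s * (3 / 4))"
  by (simp add: brick_def cube_def)

text \<open>Bricks sharing a point have centres less than 3s/2 apart in each coordinate, so their
  integer indices differ by at most 1; equal parity then forces equality.\<close>

lemma brick_parity_eq:
  assumes "s > 0" "x \<in> brick d s m" "x \<in> brick d s m'" "i < d" "even (m i) = even (m' i)"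
  shows "m i = m' i"
proof -
  have "\<bar>x i - s * (of_int (m i) + 1 / 2)\<bar> < s * (3 / 4)" "\<bar>x i - s * (of_int (m' i) + 1 / 2)\<bar> < s * (3 / 4)"
    using assms by (auto simp: brick_def)
  then have "\<bar>s * (of_int (m i) + 1 / 2) - s * (of_int (m' i) + 1 / 2)\<bar> < s * (3 / 2)" by linarith
  then have "s * \<bar>of_int (m i) - of_int (m' i)\<bar> < s * (3 / 2)"
    using assms(1) by (simp add: abs_mult flip: right_diff_distrib)
  then have "\<bar>of_int (m i) - of_int (m' i) :: real\<bar> < 3 / 2" using assms(1) by simp
  then have "\<bar>m i - m' i\<bar> < 2" by linarith
  moreover have "even (m i - m' i)" using assms(5) by simp
  ultimately show ?thesis by presburger
qed

text \<open>Every brick meeting C is assigned to one member of the cover that contains it, and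
  \<open>W i\<close> is the union of the bricks assigned to i. The bricks through a point have
  distinct parity vectors, of which there are 2^d.\<close>

lemma Euclidean_order_refinement:
  assumes C: "compactin (Euclidean_space d) C" and U: "\<And>i. i \<in> I \<Longrightarrow> openin (Euclidean_space d) (U i)"
    and CU: "C \<subseteq> (\<Union>i\<in>I. U i)"
  obtains W where "\<And>i. i \<in> I \<Longrightarrow> openin (Euclidean_space d) (W i)" "\<And>i. i \<in> I \<Longrightarrow> W i \<subseteq> U i"
    "C \<subseteq> (\<Union>i\<in>I. W i)" "order_at_most (2 ^ d) I W (cartesian d)"
proof -
  obtain e where e: "e > 0" "\<And>x. x \<in> C \<Longrightarrow> \<exists>i\<in>I. cube d x e \<subseteq> U i"
    using cube_Lebesgue_number[OF C U CU] by metis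
  \<comment> \<open>A brick has width 3s/2 in each coordinate, which is less than e = 2s.\<close>
  define s where "s = e / 2"
  have s: "s > 0" using e by (simp add: s_def)
  \<comment> \<open>A brick depends only on the entries of \<open>m\<close> below d; extensionality
    makes its index unique.\<close>
  define M where "M = {m \<in> {..<d} \<rightarrow>\<^sub>E (UNIV :: int set). brick d s m \<inter> C \<noteq> {}}"
  have "\<exists>i\<in>I. brick d s m \<subseteq> U i" if "m \<in> M" for m
  proof -
    obtain x where x: "x \<in> brick d s m" "x \<in> C" using \<open>m \<in> M\<close> by (auto simp: M_def)
    have "brick d s m \<subseteq> cube d x e"
    proof
      fix y assume y: "y \<in> brick d s m"
      have "\<bar>y i - x i\<bar> < e" if "i < d" for i
      proof -
        have "\<bar>y i - s * (of_int (m i) + 1 / 2)\<bar> < s * (3 / 4)" "\<bar>x i - s * (of_int (m i) + 1 / 2)\<bar> < s * (3 / 4)"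
          using x(1) y that by (auto simp: brick_def)
        moreover have "e = 2 * s" by (simp add: s_def)
        ultimately show ?thesis using s by linarith
      qed
      then show "y \<in> cube d x e" using y by (simp add: brick_def cube_def)
    qed
    then show ?thesis using e(2)[OF x(2)] by blast
  qed
  then obtain \<iota> where \<iota>: "\<And>m. m \<in> M \<Longrightarrow> \<iota> m \<in> I" "\<And>m. m \<in> M \<Longrightarrow> brick d s m \<subseteq> U (\<iota> m)" by metis
  define W where "W i = (\<Union>m\<in>{m\<in>M. \<iota> m = i}. brick d s m)" for i
  show ?thesis
  proof (rule that[of W])
    show "openin (Euclidean_space d) (W i)" for i
      unfolding W_def brick_eq_cube by (intro openin_Union) (auto intro: openin_cube)
    show "W i \<subseteq> U i" if "i \<in> I" for i
      using \<iota>(2) by (auto simp: W_def)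
    show "C \<subseteq> (\<Union>i\<in>I. W i)"
    proof
      fix x assume x: "x \<in> C"
      define m where "m = (\<lambda>i\<in>{..<d}. \<lfloor>x i / s\<rfloor>)"
      have "\<bar>x i - s * (of_int (m i) + 1 / 2)\<bar> < s * (3 / 4)" if "i < d" for i
      proof -
        have "x i = s * (x i / s)" using s by simp
        moreover have "\<bar>x i / s - (of_int (m i) + 1 / 2)\<bar> < 3 / 4"
        proof -
          have "of_int (m i) \<le> x i / s" "x i / s < of_int (m i) + 1"
            using that by (simp_all add: m_def)
          then show ?thesis unfolding abs_less_iff by linarith
        qed
        then have "s * \<bar>x i / s - (of_int (m i) + 1 / 2)\<bar> < s * (3 / 4)" using s by simp
        ultimately show ?thesis using s by (metis abs_mult abs_of_pos right_diff_distrib)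
      qed
      then have xm: "x \<in> brick d s m"
        using x compactin_subset_topspace[OF C] by (auto simp: brick_def)
      then have "m \<in> M" using x by (auto simp: M_def m_def)
      then show "x \<in> (\<Union>i\<in>I. W i)" using xm \<iota>(1) by (auto simp: W_def)
    qed
    show "order_at_most (2 ^ d) I W (cartesian d)"
      unfolding order_at_most_def
    proof
      fix x assume "x \<in> cartesian d"
      let ?J = "{i \<in> I. x \<in> W i}"
      have "\<exists>m\<in>M. \<iota> m = i \<and> x \<in> brick d s m" if "i \<in> ?J" for i
        using that by (auto simp: W_def)
      then have "\<forall>i. \<exists>m. i \<in> ?J \<longrightarrow> m \<in> M \<and> \<iota> m = i \<and> x \<in> brick d s m" by blast
      from choice[OF this] obtain m where m: "\<And>i. i \<in> ?J \<Longrightarrow> m i \<in> M" "\<And>i. i \<in> ?J \<Longrightarrow> \<iota> (m i) = i"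
          "\<And>i. i \<in> ?J \<Longrightarrow> x \<in> brick d s (m i)" by blast
      \<comment> \<open>The parity vector of a chosen brick through x. It determines the brick, and
        the brick determines the index i to which it was assigned.\<close>
      define q where "q i = (\<lambda>k\<in>{..<d}. even (m i k))" for i
      have "inj_on q ?J"
      proof (rule inj_onI)
        fix i j assume ij: "i \<in> ?J" "j \<in> ?J" "q i = q j"
        have "m i k = m j k" for k
        proof (cases "k < d")
          case True
          have "even (m i k) = even (m j k)" using ij(3) True by (metis lessThan_iff q_def restrict_apply)
          then show ?thesis using brick_parity_eq[OF s m(3)[OF ij(1)] m(3)[OF ij(2)] True] by blast
        next
          case False
          then show ?thesis using m(1)[OF ij(1)] m(1)[OF ij(2)] by (auto simp: M_def PiE_def extensional_def)
        qed
        then have "m i = m j" by blast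
        then show "i = j" using m(2) ij by metis
      qed
      moreover have "q ` ?J \<subseteq> {..<d} \<rightarrow>\<^sub>E UNIV" by (auto simp: q_def)
      moreover have "finite ({..<d} \<rightarrow>\<^sub>E (UNIV :: bool set))" by (intro finite_PiE) auto
      moreover have "card ({..<d} \<rightarrow>\<^sub>E (UNIV :: bool set)) = 2 ^ d" by (simp add: card_PiE)
      ultimately show "finite ?J \<and> card ?J \<le> 2 ^ d"
        using inj_on_finite[of q ?J] card_inj_on_le[of q ?J "{..<d} \<rightarrow>\<^sub>E UNIV"] by simp
    qed
  qed
qed

lemma chart_order_refinement:
  assumes V: "is_chart d X (V, p)" and C: "compactin X C" "C \<subseteq> V"
    and U: "\<And>i. i \<in> I \<Longrightarrow> openin X (U i)" and CU: "C \<subseteq> (\<Union>i\<in>I. U i)"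
  obtains W where "\<And>i. i \<in> I \<Longrightarrow> openin X (W i)" "\<And>i. i \<in> I \<Longrightarrow> W i \<subseteq> U i"
    "C \<subseteq> (\<Union>i\<in>I. W i)" "order_at_most (2 ^ d) I W C"
proof -
  have 1: "compactin (Euclidean_space d) (p ` C)" using chart_compactin_iff[OF V C(2)] C(1) by simp
  have 2: "openin (Euclidean_space d) (p ` (V \<inter> U i))" if "i \<in> I" for i
    using U[OF that] chart_homeomorphic_map(2)[OF V] by (intro chart_openin_image[OF V]) auto
  have 3: "p ` C \<subseteq> (\<Union>i\<in>I. p ` (V \<inter> U i))" using C CU by blast
  obtain W where W: "\<And>i. i \<in> I \<Longrightarrow> openin (Euclidean_space d) (W i)"
    "\<And>i. i \<in> I \<Longrightarrow> W i \<subseteq> p ` (V \<inter> U i)" "p ` C \<subseteq> (\<Union>i\<in>I. W i)"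
    "order_at_most (2 ^ d) I W (cartesian d)"
    by (rule Euclidean_order_refinement[where I = I and U = "\<lambda>i. p ` (V \<inter> U i)", OF 1 2 3]; blast)
  show ?thesis
  proof (rule that[of "\<lambda>i. {y \<in> V. p y \<in> W i}"])
    show "openin X {y \<in> V. p y \<in> W i}" if "i \<in> I" for i
      by (rule chart_openin_preimage[OF V W(1)[OF that]])
    show "{y \<in> V. p y \<in> W i} \<subseteq> U i" if "i \<in> I" for i
      using W(2)[OF that] chart_inj_on[OF V] by (auto dest: inj_onD)
    show "C \<subseteq> (\<Union>i\<in>I. {y \<in> V. p y \<in> W i})" using W(3) C(2) by blast
    show "order_at_most (2 ^ d) I (\<lambda>i. {y \<in> V. p y \<in> W i}) C"
      unfolding order_at_most_def
    proof
      fix x assume x: "x \<in> C"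
      then have "{i \<in> I. x \<in> {y \<in> V. p y \<in> W i}} = {i \<in> I. p x \<in> W i}" using C(2) by blast
      moreover have "p x \<in> cartesian d" using x C(2) chart_topspace[OF V] by blast
      ultimately show "finite {i \<in> I. x \<in> {y \<in> V. p y \<in> W i}} \<and> card {i \<in> I. x \<in> {y \<in> V. p y \<in> W i}} \<le> 2 ^ d"
        using W(4) by (simp add: order_at_most_def)
    qed
  qed
qed

text \<open>The sum theorem of covering dimension: refining the cover over one more compact piece keeps
  the order over the previous pieces, because the sets only shrink.\<close>

lemma finite_sum_order_refinement:
  assumes X: "Hausdorff_space X" and fin: "finite \<C>"
    and \<C>: "\<And>C. C \<in> \<C> \<Longrightarrow> compactin X C \<and> C \<subseteq> S \<and> (\<exists>V p. is_chart d X (V, p) \<and> C \<subseteq> V)"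
    and U: "\<And>i. i \<in> I \<Longrightarrow> openin X (U i)" and SU: "S \<subseteq> (\<Union>i\<in>I. U i)"
  shows "\<exists>W. (\<forall>i\<in>I. openin X (W i) \<and> W i \<subseteq> U i) \<and> S \<subseteq> (\<Union>i\<in>I. W i) \<and> order_at_most (2 ^ d) I W (\<Union>\<C>)"
  using fin \<C>
proof (induction \<C>)
  case empty
  then show ?case using U SU by (intro exI[of _ U]) (auto simp: order_at_most_def)
next
  case (insert C \<C>)
  have "\<exists>W. (\<forall>i\<in>I. openin X (W i) \<and> W i \<subseteq> U i) \<and> S \<subseteq> (\<Union>i\<in>I. W i) \<and> order_at_most (2 ^ d) I W (\<Union>\<C>)"
    by (rule insert.IH) (use insert.prems in auto)
  then obtain W where W: "\<And>i. i \<in> I \<Longrightarrow> openin X (W i)" "\<And>i. i \<in> I \<Longrightarrow> W i \<subseteq> U i"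
      "S \<subseteq> (\<Union>i\<in>I. W i)" "order_at_most (2 ^ d) I W (\<Union>\<C>)"
    by blast
  have "compactin X C \<and> C \<subseteq> S \<and> (\<exists>V p. is_chart d X (V, p) \<and> C \<subseteq> V)"
    by (rule insert.prems) simp
  then obtain V p where C: "compactin X C" "C \<subseteq> S" and V: "is_chart d X (V, p)" "C \<subseteq> V"
    by blast
  have CW: "C \<subseteq> (\<Union>i\<in>I. W i)" using W(3) C(2) by blast
  obtain W' where W': "\<And>i. i \<in> I \<Longrightarrow> openin X (W' i)" "\<And>i. i \<in> I \<Longrightarrow> W' i \<subseteq> W i"
      "C \<subseteq> (\<Union>i\<in>I. W' i)" "order_at_most (2 ^ d) I W' C"
    by (rule chart_order_refinement[where I = I and U = W, OF V(1) C(1) V(2) W(1) CW]; blast)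
  \<comment> \<open>Inside C the new refinement is used, outside C nothing changes. The sets are
    open because C is closed, and they are contained in \<open>W i\<close>, so the bound on the
    earlier pieces survives.\<close>
  let ?W = "\<lambda>i. W' i \<union> (W i - C)"
  have "openin X (?W i)" if "i \<in> I" for i
    using W(1) W'(1) that compactin_imp_closedin[OF X C(1)] by blast
  moreover have sub: "?W i \<subseteq> W i" if "i \<in> I" for i using W'(2) that by blast
  moreover have "S \<subseteq> (\<Union>i\<in>I. ?W i)"
  proof
    fix x assume "x \<in> S"
    then show "x \<in> (\<Union>i\<in>I. ?W i)" using W(3) W'(3) by (cases "x \<in> C") blast+
  qed
  moreover have "order_at_most (2 ^ d) I ?W (\<Union>(insert C \<C>))"
    unfolding order_at_most_def
  proof
    fix x assume x: "x \<in> \<Union>(insert C \<C>)"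
    show "finite {i \<in> I. x \<in> ?W i} \<and> card {i \<in> I. x \<in> ?W i} \<le> 2 ^ d"
    proof (cases "x \<in> C")
      case True
      then have "{i \<in> I. x \<in> ?W i} = {i \<in> I. x \<in> W' i}" by blast
      then show ?thesis using W'(4) True by (simp add: order_at_most_def)
    next
      case False
      then have *: "finite {i \<in> I. x \<in> W i}" "card {i \<in> I. x \<in> W i} \<le> 2 ^ d"
        using W(4) x by (auto simp: order_at_most_def)
      have le: "{i \<in> I. x \<in> ?W i} \<subseteq> {i \<in> I. x \<in> W i}" using sub by blast
      show ?thesis using card_mono[OF *(1) le] finite_subset[OF le *(1)] *(2) by linarith
    qed
  qed
  moreover have "?W i \<subseteq> U i" if "i \<in> I" for i
    using sub[OF that] W(2)[OF that] by (rule subset_trans)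
  ultimately show ?case by (intro exI[of _ ?W] conjI ballI)
qed

section \<open>From bounded order to finitely many colours\<close>

lemma subordinate_functions:
  assumes X: "Hausdorff_space X" "locally_compact_space X" and K: "compactin X K"
    and U: "\<And>i. i \<in> I \<Longrightarrow> openin X (U i)" and KU: "K \<subseteq> (\<Union>i\<in>I. U i)"
  obtains g :: "'i \<Rightarrow> 'a \<Rightarrow> real" where "\<And>i. continuous_map X euclideanreal (g i)"
    "\<And>i x. x \<in> topspace X \<Longrightarrow> 0 \<le> g i x" "\<And>i x. x \<in> topspace X \<Longrightarrow> i \<in> I \<Longrightarrow> g i x > 0 \<Longrightarrow> x \<in> U i"
    "\<And>x. x \<in> K \<Longrightarrow> \<exists>i\<in>I. g i x > 0"
proof -
  have Ksub: "K \<subseteq> topspace X" by (rule compactin_subset_topspace[OF K])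
  have cr: "completely_regular_space X"
    using locally_compact_regular_imp_completely_regular_space X by blast
  have "\<exists>i h. i \<in> I \<and> continuous_map X euclideanreal h \<and> (\<forall>y\<in>topspace X. 0 \<le> h y) \<and>
      (\<forall>y\<in>topspace X - U i. h y = 0) \<and> h x = 1" if "x \<in> K" for x
  proof -
    obtain i where i: "i \<in> I" "x \<in> U i" using KU \<open>x \<in> K\<close> by blast
    have "closedin X (topspace X - U i)" "x \<in> topspace X - (topspace X - U i)"
      using U[OF i(1)] i(2) \<open>x \<in> K\<close> Ksub by auto
    then obtain f where f: "continuous_map X (top_of_set {0..1::real}) f" "f x = 0"
        "f ` (topspace X - U i) \<subseteq> {1}"
      using cr unfolding completely_regular_space_def by metis
    have "continuous_map X euclideanreal f" and f01: "\<And>y. y \<in> topspace X \<Longrightarrow> f y \<in> {0..1}"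
      using f(1) by (auto simp: continuous_map_in_subtopology)
    then have "continuous_map X euclideanreal (\<lambda>y. 1 - f y)"
      by (intro continuous_map_diff continuous_map_const[THEN iffD2]) auto
    then show ?thesis using i(1) f f01
      by (intro exI[of _ i] exI[of _ "\<lambda>y. 1 - f y"]) (auto simp: image_subset_iff)
  qed
  then have "\<forall>x. \<exists>i h. x \<in> K \<longrightarrow> i \<in> I \<and> continuous_map X euclideanreal h \<and> (\<forall>y\<in>topspace X. 0 \<le> h y) \<and>
      (\<forall>y\<in>topspace X - U i. h y = 0) \<and> h x = 1"
    by blast
  from choice[OF this] obtain i where "\<forall>x. \<exists>h. x \<in> K \<longrightarrow> i x \<in> I \<and> continuous_map X euclideanreal h \<and>
      (\<forall>y\<in>topspace X. 0 \<le> h y) \<and> (\<forall>y\<in>topspace X - U (i x). h y = 0) \<and> h x = 1"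
    by blast
  from choice[OF this] obtain h where "\<forall>x. x \<in> K \<longrightarrow> i x \<in> I \<and> continuous_map X euclideanreal (h x) \<and>
      (\<forall>y\<in>topspace X. 0 \<le> h x y) \<and> (\<forall>y\<in>topspace X - U (i x). h x y = 0) \<and> h x x = 1"
    by blast
  then have ih: "\<And>x. x \<in> K \<Longrightarrow> i x \<in> I" "\<And>x. x \<in> K \<Longrightarrow> continuous_map X euclideanreal (h x)"
      "\<And>x y. x \<in> K \<Longrightarrow> y \<in> topspace X \<Longrightarrow> 0 \<le> h x y"
      "\<And>x y. x \<in> K \<Longrightarrow> y \<in> topspace X - U (i x) \<Longrightarrow> h x y = 0" "\<And>x. x \<in> K \<Longrightarrow> h x x = 1"
    by blast+
  let ?N = "\<lambda>x. {y \<in> topspace X. h x y \<in> {0<..}}"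
  have "openin X (?N x) \<and> x \<in> ?N x" if "x \<in> K" for x
    using openin_continuous_map_preimage[OF ih(2)[OF that], of "{0<..}"] ih(5)[OF that] that Ksub by auto
  then obtain T where T: "finite T" "T \<subseteq> K" "K \<subseteq> (\<Union>x\<in>T. ?N x)"
    by (rule compactin_choose_finite[where N = ?N, OF K]; blast)
  \<comment> \<open>Functions attached to different points but to the same member are added up. No
    normalisation follows, since only the comparison of values matters later.\<close>
  define g where "g j y = (\<Sum>x\<in>{x\<in>T. i x = j}. h x y)" for j y
  show ?thesis
  proof (rule that[of g])
    show "continuous_map X euclideanreal (g j)" for j
      unfolding g_def[abs_def] using T ih(2) by (intro continuous_map_sum) auto
    show "0 \<le> g j y" if "y \<in> topspace X" for j y
      unfolding g_def using that T ih(3) by (intro sum_nonneg) auto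
    show "y \<in> U j" if "y \<in> topspace X" "j \<in> I" "g j y > 0" for j y
    proof (rule ccontr)
      assume "y \<notin> U j"
      then have "g j y = 0" unfolding g_def using T ih(4) that by (intro sum.neutral) auto
      then show False using that by simp
    qed
    show "\<exists>j\<in>I. g j y > 0" if y: "y \<in> K" for y
    proof -
      obtain x where x: "x \<in> T" "h x y > 0" using T(3) y by auto
      have yX: "y \<in> topspace X" using y Ksub by blast
      have "0 < h x y" by (rule x)
      also have "\<dots> \<le> g (i x) y"
        unfolding g_def using x(1) T(1) ih(3)[OF _ yX] T(2) by (intro member_le_sum) auto
      finally show ?thesis using ih(1) x T by blast
    qed
  qed
qed

lemma openin_Collect_Ball:
  assumes "finite A" "\<And>a. a \<in> A \<Longrightarrow> openin X {x \<in> topspace X. P a x}"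
  shows "openin X {x \<in> topspace X. \<forall>a\<in>A. P a x}"
  using assms
proof (induction A)
  case (insert a A)
  have "{x \<in> topspace X. \<forall>a\<in>insert a A. P a x} =
      {x \<in> topspace X. P a x} \<inter> {x \<in> topspace X. \<forall>a\<in>A. P a x}" by auto
  then show ?case using insert by (simp add: openin_Int)
qed simp

text \<open>On \<open>Z J\<close> the functions indexed by \<open>J\<close> are positive and dominate all others. Hence \<open>Z J\<close> and
  \<open>Z J'\<close> are disjoint for distinct \<open>J\<close>, \<open>J'\<close> of equal size, and the size of \<open>J\<close> serves as colour.\<close>

lemma coloured_refinement:
  assumes X: "Hausdorff_space X" "locally_compact_space X" and K: "compactin X K" and I: "finite I"
    and U: "\<And>i. i \<in> I \<Longrightarrow> openin X (U i)" and KU: "K \<subseteq> (\<Union>i\<in>I. U i)"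
    and ord: "order_at_most D I U K"
  obtains F :: "nat \<Rightarrow> 'a set set" where "\<And>k. finite (F k)" "\<And>k. disjoint (F k)"
    "\<And>k V. V \<in> F k \<Longrightarrow> openin X V \<and> (\<exists>i\<in>I. V \<subseteq> U i)" "K \<subseteq> (\<Union>k<D. \<Union>(F k))"
proof -
  obtain g :: "'b \<Rightarrow> 'a \<Rightarrow> real" where g: "\<And>i. continuous_map X euclideanreal (g i)"
    "\<And>i x. x \<in> topspace X \<Longrightarrow> 0 \<le> g i x" "\<And>i x. x \<in> topspace X \<Longrightarrow> i \<in> I \<Longrightarrow> g i x > 0 \<Longrightarrow> x \<in> U i"
    "\<And>x. x \<in> K \<Longrightarrow> \<exists>i\<in>I. g i x > 0"
    by (rule subordinate_functions[where I = I and U = U, OF X K U KU]; blast)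
  define Z where "Z J = {x \<in> topspace X. \<forall>i\<in>J. 0 < g i x \<and> (\<forall>j\<in>I - J. g j x < g i x)}" for J
  \<comment> \<open>The sizes start at 1 because \<open>Z {}\<close> is the whole space, which lies
    in no prescribed member.\<close>
  define F where "F k = Z ` {J. J \<subseteq> I \<and> card J = Suc k}" for k
  have opZ: "openin X (Z J)" if "J \<subseteq> I" for J
  proof -
    have "openin X {x \<in> topspace X. g i x \<in> {0<..}}" for i
      by (rule openin_continuous_map_preimage[OF g(1)]) simp
    moreover have "openin X {x \<in> topspace X. g i x - g j x \<in> {0<..}}" for i j
      by (rule openin_continuous_map_preimage[OF continuous_map_diff[OF g(1) g(1)]]) simp
    ultimately have "openin X ({x \<in> topspace X. 0 < g i x} \<inter> {x \<in> topspace X. \<forall>j\<in>I - J. g j x < g i x})" for i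
      using I by (intro openin_Int openin_Collect_Ball) auto
    moreover have "{x \<in> topspace X. 0 < g i x} \<inter> {x \<in> topspace X. \<forall>j\<in>I - J. g j x < g i x} =
        {x \<in> topspace X. 0 < g i x \<and> (\<forall>j\<in>I - J. g j x < g i x)}" for i by blast
    ultimately show ?thesis
      unfolding Z_def using finite_subset[OF that I] by (intro openin_Collect_Ball) auto
  qed
  show ?thesis
  proof (rule that[of F])
    show "finite (F k)" for k unfolding F_def using I by simp
    show "disjoint (F k)" for k
      unfolding disjoint_def F_def
    proof (clarify)
      fix J J' assume J: "J \<subseteq> I" "J' \<subseteq> I" "card J = Suc k" "card J' = Suc k" "Z J \<noteq> Z J'"
      have "\<not> J \<subseteq> J'" "\<not> J' \<subseteq> J"
        using J card_subset_eq finite_subset[OF _ I] by metis+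
      then obtain i j where ij: "i \<in> J - J'" "j \<in> J' - J" by blast
      have False if "y \<in> Z J" "y \<in> Z J'" for y
      proof -
        have "g j y < g i y" "g i y < g j y" using that ij J(1,2) by (auto simp: Z_def)
        then show False by simp
      qed
      then show "Z J \<inter> Z J' = {}" by blast
    qed
    show "openin X V \<and> (\<exists>i\<in>I. V \<subseteq> U i)" if "V \<in> F k" for k V
    proof -
      obtain J where J: "J \<subseteq> I" "card J = Suc k" "V = Z J"
        using \<open>V \<in> F k\<close> by (auto simp: F_def)
      have "J \<noteq> {}" using J(2) by auto
      then obtain i where "i \<in> J" by blast
      then have "i \<in> I" "Z J \<subseteq> U i" using g(3) J(1) by (auto simp: Z_def)
      then show ?thesis using opZ[OF J(1)] J(3) by blast
    qed
    show "K \<subseteq> (\<Union>k<D. \<Union>(F k))"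
    proof
      fix x assume x: "x \<in> K"
      then have xX: "x \<in> topspace X" using compactin_subset_topspace[OF K] by blast
      \<comment> \<open>Take all functions that are positive at x. They dominate the others, which
        vanish there, and their number is bounded by the order of the cover at x.\<close>
      define J where "J = {i \<in> I. 0 < g i x}"
      have "J \<noteq> {}" using g(4)[OF x] by (auto simp: J_def)
      then have J0: "card J > 0" using I by (simp add: J_def card_gt_0_iff)
      have "J \<subseteq> {i \<in> I. x \<in> U i}" using g(3)[OF xX] by (auto simp: J_def)
      then have "card J \<le> card {i \<in> I. x \<in> U i}" using I by (intro card_mono) auto
      then have "card J \<le> D" using ord x by (force simp: order_at_most_def)
      moreover have "x \<in> Z J"
      proof -
        have "g j x \<le> 0" if "j \<in> I - J" for j using that by (auto simp: J_def)
        then have "g j x < g i x" if "i \<in> J" "j \<in> I - J" for i j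
          using that by (fastforce simp: J_def intro: le_less_trans)
        then show ?thesis using xX by (auto simp: Z_def J_def)
      qed
      moreover have "J \<subseteq> I" by (auto simp: J_def)
      ultimately have "x \<in> \<Union>(F (card J - 1))" "card J - 1 < D" using J0 by (auto simp: F_def)
      then show "x \<in> (\<Union>k<D. \<Union>(F k))" by blast
    qed
  qed
qed

lemma compact_shrinking:
  assumes X: "Hausdorff_space X" "locally_compact_space X" and K: "compactin X K"
    and \<F>: "\<And>V. V \<in> \<F> \<Longrightarrow> openin X V" and KF: "K \<subseteq> \<Union>\<F>"
  obtains \<kappa> where "\<And>V. compactin X (\<kappa> V)" "\<And>V. \<kappa> V \<subseteq> V" "K \<subseteq> (\<Union>V\<in>\<F>. \<kappa> V)"
proof -
  have "\<exists>V N C. V \<in> \<F> \<and> openin X N \<and> x \<in> N \<and> compactin X C \<and> N \<subseteq> C \<and> C \<subseteq> V" if "x \<in> K" for x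
  proof -
    obtain V where "V \<in> \<F>" "x \<in> V" using KF \<open>x \<in> K\<close> by blast
    then show ?thesis using compact_neighbourhood[OF X \<F>] by metis
  qed
  then obtain V N C where VNC: "\<And>x. x \<in> K \<Longrightarrow> V x \<in> \<F>" "\<And>x. x \<in> K \<Longrightarrow> openin X (N x) \<and> x \<in> N x"
      "\<And>x. x \<in> K \<Longrightarrow> compactin X (C x)" "\<And>x. x \<in> K \<Longrightarrow> N x \<subseteq> C x" "\<And>x. x \<in> K \<Longrightarrow> C x \<subseteq> V x"
    by metis
  obtain T where T: "finite T" "T \<subseteq> K" "K \<subseteq> (\<Union>x\<in>T. N x)"
    by (rule compactin_choose_finite[where N = N, OF K VNC(2)]; blast)
  \<comment> \<open>The core of W collects the compact neighbourhoods assigned to W; it is empty if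
    there are none, so \<kappa> is defined for every set.\<close>
  show ?thesis
  proof (rule that[of "\<lambda>W. \<Union>x\<in>{x\<in>T. V x = W}. C x"])
    show "compactin X (\<Union>x\<in>{x\<in>T. V x = W}. C x)" for W
      using T VNC(3) by (intro compactin_Union) auto
    show "(\<Union>x\<in>{x\<in>T. V x = W}. C x) \<subseteq> W" for W using T VNC(5) by blast
    show "K \<subseteq> (\<Union>W\<in>\<F>. \<Union>x\<in>{x\<in>T. V x = W}. C x)"
    proof
      fix y assume "y \<in> K"
      then obtain x where "x \<in> T" "y \<in> N x" using T(3) by blast
      then have "V x \<in> \<F>" "x \<in> {z\<in>T. V z = V x}" "y \<in> C x" using T(2) VNC(1,4) by auto
      then show "y \<in> (\<Union>W\<in>\<F>. \<Union>x\<in>{x\<in>T. V x = W}. C x)" by blast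
    qed
  qed
qed

text \<open>Compactness is used twice beforehand: to keep finitely many members of the cover, since
  openness of the coloured sets rests on finitely many inequalities, and to cut K into finitely many
  pieces inside charts for the sum theorem. The number of colours depends on neither choice.\<close>

lemma compact_coloured_refinement:
  assumes X: "Hausdorff_space X" and A: "locally_Euclidean_by d X A" and K: "compactin X K"
    and U: "\<And>i. i \<in> I \<Longrightarrow> openin X (U i)" and KU: "K \<subseteq> (\<Union>i\<in>I. U i)"
  obtains F :: "nat \<Rightarrow> 'a set set" and \<kappa> where "\<And>k. finite (F k)" "\<And>k. disjoint (F k)"
    "\<And>k V. V \<in> F k \<Longrightarrow> openin X V \<and> (\<exists>i\<in>I. V \<subseteq> U i)"
    "\<And>V. compactin X (\<kappa> V)" "\<And>V. \<kappa> V \<subseteq> V" "K \<subseteq> (\<Union>k<2 ^ d. \<Union>V\<in>F k. \<kappa> V)"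
proof -
  note lc = locally_Euclidean_imp_locally_compact[OF A]
  have Ksub: "K \<subseteq> topspace X" by (rule compactin_subset_topspace[OF K])
  have "\<exists>i. i \<in> I \<and> x \<in> U i" if "x \<in> K" for x using KU that by blast
  then obtain i where i: "\<And>x. x \<in> K \<Longrightarrow> i x \<in> I \<and> x \<in> U (i x)" by metis
  obtain T where T: "finite T" "T \<subseteq> K" "K \<subseteq> (\<Union>x\<in>T. U (i x))"
    by (rule compactin_choose_finite[OF K, of "\<lambda>x. U (i x)"]) (use i U in auto)
  define I' where "I' = i ` T"
  have I': "finite I'" "I' \<subseteq> I" "K \<subseteq> (\<Union>i\<in>I'. U i)" using T i by (auto simp: I'_def)
  have U': "openin X (U j)" if "j \<in> I'" for j using U I'(2) that by blast
  have "\<exists>N C V p. openin X N \<and> x \<in> N \<and> compactin X C \<and> N \<subseteq> C \<and> C \<subseteq> V \<and> is_chart d X (V, p)"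
    if "x \<in> K" for x
  proof -
    obtain V p where V: "is_chart d X (V, p)" "x \<in> V"
      using locally_Euclidean_byE[OF A] Ksub \<open>x \<in> K\<close> by (metis subsetD)
    then show ?thesis using compact_neighbourhood[OF X lc chart_homeomorphic_map(2)[OF V(1)] V(2)] by metis
  qed
  then obtain N C where NC: "\<And>x. x \<in> K \<Longrightarrow> openin X (N x) \<and> x \<in> N x" "\<And>x. x \<in> K \<Longrightarrow> compactin X (C x)"
      "\<And>x. x \<in> K \<Longrightarrow> N x \<subseteq> C x" "\<And>x. x \<in> K \<Longrightarrow> \<exists>V p. C x \<subseteq> V \<and> is_chart d X (V, p)"
    by metis
  obtain T' where T': "finite T'" "T' \<subseteq> K" "K \<subseteq> (\<Union>x\<in>T'. N x)"
    by (rule compactin_choose_finite[where N = N, OF K NC(1)]; blast)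
  define \<C> where "\<C> = (\<lambda>x. C x \<inter> K) ` T'"
  have \<C>: "compactin X C' \<and> C' \<subseteq> K \<and> (\<exists>V p. is_chart d X (V, p) \<and> C' \<subseteq> V)" if "C' \<in> \<C>" for C'
  proof -
    obtain x where x: "x \<in> K" "C' = C x \<inter> K" using \<open>C' \<in> \<C>\<close> T' by (auto simp: \<C>_def)
    have "compactin X (C x \<inter> K)"
      using compact_Int_closedin[OF NC(2)[OF x(1)] compactin_imp_closedin[OF X K]] .
    then show ?thesis using x NC(4)[OF x(1)] by blast
  qed
  have KC: "K \<subseteq> \<Union>\<C>" using T' NC(3) by (fastforce simp: \<C>_def)
  have "finite \<C>" using T' by (simp add: \<C>_def)
  from finite_sum_order_refinement[OF X this \<C> U' I'(3)]
  obtain W where W: "\<And>i. i \<in> I' \<Longrightarrow> openin X (W i)" "\<And>i. i \<in> I' \<Longrightarrow> W i \<subseteq> U i"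
      "K \<subseteq> (\<Union>i\<in>I'. W i)" "order_at_most (2 ^ d) I' W (\<Union>\<C>)"
    by blast
  have ordK: "order_at_most (2 ^ d) I' W K" using W(4) KC by (auto simp: order_at_most_def)
  obtain F :: "nat \<Rightarrow> 'a set set" where F: "\<And>k. finite (F k)" "\<And>k. disjoint (F k)"
    "\<And>k V. V \<in> F k \<Longrightarrow> openin X V \<and> (\<exists>i\<in>I'. V \<subseteq> W i)" "K \<subseteq> (\<Union>k<2 ^ d. \<Union>(F k))"
    by (rule coloured_refinement[where I = I' and U = W, OF X lc K I'(1) W(1) W(3) ordK]; blast)
  have opF: "openin X V" if "V \<in> (\<Union>k<2 ^ d. F k)" for V using that F(3) by blast
  have KF: "K \<subseteq> \<Union>(\<Union>k<2 ^ d. F k)" using F(4) by blast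
  obtain \<kappa> where \<kappa>: "\<And>V. compactin X (\<kappa> V)" "\<And>V. \<kappa> V \<subseteq> V" "K \<subseteq> (\<Union>V\<in>(\<Union>k<2 ^ d. F k). \<kappa> V)"
    by (rule compact_shrinking[where \<F> = "\<Union>k<2 ^ d. F k", OF X lc K opF KF]; blast)
  show ?thesis
  proof (rule that[OF F(1,2) _ \<kappa>(1,2)])
    show "openin X V \<and> (\<exists>i\<in>I. V \<subseteq> U i)" if "V \<in> F k" for k V
      using F(3)[OF that] W(2) I'(2) by blast
    show "K \<subseteq> (\<Union>k<2 ^ d. \<Union>V\<in>F k. \<kappa> V)" using \<kappa>(3) by blast
  qed
qed

section \<open>Exhaustion by compact sets\<close>

lemma locally_finite_in_compactin:
  assumes "locally_finite_in X \<V>" "compactin X K"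
  shows "finite {V \<in> \<V>. V \<inter> K \<noteq> {}}"
proof -
  have "\<exists>N. openin X N \<and> x \<in> N \<and> finite {V \<in> \<V>. V \<inter> N \<noteq> {}}" if "x \<in> K" for x
  proof -
    have "x \<in> topspace X" using that compactin_subset_topspace[OF assms(2)] by blast
    then show ?thesis using assms(1) unfolding locally_finite_in_def by blast
  qed
  then have "\<forall>x\<in>K. \<exists>N. openin X N \<and> x \<in> N \<and> finite {V \<in> \<V>. V \<inter> N \<noteq> {}}" ..
  from bchoice[OF this] obtain N where N: "\<And>x. x \<in> K \<Longrightarrow> openin X (N x) \<and> x \<in> N x"
      "\<And>x. x \<in> K \<Longrightarrow> finite {V \<in> \<V>. V \<inter> N x \<noteq> {}}"
    by blast
  obtain T where T: "finite T" "T \<subseteq> K" "K \<subseteq> (\<Union>x\<in>T. N x)"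
    by (rule compactin_choose_finite[where N = N, OF assms(2) N(1)]; blast)
  have "{V \<in> \<V>. V \<inter> K \<noteq> {}} \<subseteq> (\<Union>x\<in>T. {V \<in> \<V>. V \<inter> N x \<noteq> {}})"
  proof
    fix V assume "V \<in> {V \<in> \<V>. V \<inter> K \<noteq> {}}"
    then obtain y where y: "V \<in> \<V>" "y \<in> V" "y \<in> K" by auto
    then obtain x where "x \<in> T" "y \<in> N x" using T(3) by auto
    then show "V \<in> (\<Union>x\<in>T. {V \<in> \<V>. V \<inter> N x \<noteq> {}})" using y by auto
  qed
  moreover have "finite (\<Union>x\<in>T. {V \<in> \<V>. V \<inter> N x \<noteq> {}})" using T N(2) by (intro finite_UN_I) auto
  ultimately show ?thesis by (rule finite_subset)
qed

text \<open>Chains of intersecting members of a locally finite cover by relatively compact sets split the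
  cover into countable classes, and the union of each class is clopen.\<close>

lemma countable_relatively_compact_cover:
  assumes lc: "locally_compact_space X" and pc: "paracompact_space X"
    and comp: "countable (connected_components_of X)"
  obtains \<W> where "countable \<W>" "\<And>W. W \<in> \<W> \<Longrightarrow> openin X W \<and> (\<exists>K. compactin X K \<and> W \<subseteq> K)"
    "\<Union>\<W> = topspace X"
proof -
  let ?\<U> = "{U. openin X U \<and> (\<exists>K. compactin X K \<and> U \<subseteq> K)}"
  have "\<Union>?\<U> = topspace X"
  proof
    show "topspace X \<subseteq> \<Union>?\<U>"
      using lc unfolding locally_compact_space_def by blast
  qed (use openin_subset in blast)
  then have "(\<forall>U\<in>?\<U>. openin X U) \<and> \<Union>?\<U> = topspace X" by blast
  with pc[unfolded paracompact_space_def] have "\<exists>\<V>. (\<forall>V\<in>\<V>. openin X V) \<and> \<Union>\<V> = topspace X \<and>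
      (\<forall>V\<in>\<V>. \<exists>U\<in>?\<U>. V \<subseteq> U) \<and> locally_finite_in X \<V>"
    by (elim allE[of _ ?\<U>] mp)
  then obtain \<V> where "(\<forall>V\<in>\<V>. openin X V) \<and> \<Union>\<V> = topspace X \<and>
      (\<forall>V\<in>\<V>. \<exists>U\<in>?\<U>. V \<subseteq> U) \<and> locally_finite_in X \<V>" ..
  then have \<V>: "\<And>V. V \<in> \<V> \<Longrightarrow> openin X V" "\<Union>\<V> = topspace X"
      "\<And>V. V \<in> \<V> \<Longrightarrow> \<exists>U\<in>?\<U>. V \<subseteq> U" "locally_finite_in X \<V>"
    by blast+
  have rc: "\<exists>K. compactin X K \<and> V \<subseteq> K" if "V \<in> \<V>" for V using \<V>(3)[OF that] by blast
  have fin: "finite {W \<in> \<V>. V \<inter> W \<noteq> {}}" if "V \<in> \<V>" for V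
  proof -
    obtain K where K: "compactin X K" "V \<subseteq> K" using rc[OF \<open>V \<in> \<V>\<close>] by blast
    have "{W \<in> \<V>. V \<inter> W \<noteq> {}} \<subseteq> {W \<in> \<V>. W \<inter> K \<noteq> {}}" using K(2) by blast
    then show ?thesis using locally_finite_in_compactin[OF \<V>(4) K(1)] by (rule finite_subset)
  qed
  \<comment> \<open>A member meets only finitely many others, so finitely many are reached in n
    steps and \<open>R\<^sup>*\<close> has countable classes.\<close>
  define R where "R = {(V, W). V \<in> \<V> \<and> W \<in> \<V> \<and> V \<inter> W \<noteq> {}}"
  have countR: "countable (R\<^sup>* `` {V})" for V
  proof -
    have "finite ((R ^^ n) `` {V})" for n
    proof (induction n)
      case (Suc n)
      have "(R ^^ Suc n) `` {V} = (\<Union>W\<in>(R ^^ n) `` {V}. R `` {W})" by auto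
      moreover have "finite (R `` {W})" for W
      proof (cases "W \<in> \<V>")
        case True
        then have "R `` {W} = {W' \<in> \<V>. W \<inter> W' \<noteq> {}}" by (auto simp: R_def)
        then show ?thesis using fin[OF True] by simp
      qed (auto simp: R_def)
      ultimately show ?case using Suc by simp
    qed auto
    then have "countable (\<Union>n. (R ^^ n) `` {V})" by (intro countable_UN) (auto intro: countable_finite)
    moreover have "R\<^sup>* `` {V} = (\<Union>n. (R ^^ n) `` {V})" by (auto simp: rtrancl_is_UN_relpow)
    ultimately show ?thesis by simp
  qed
  have RV: "R\<^sup>* `` {V} \<subseteq> \<V>" if "V \<in> \<V>" for V
  proof
    fix W assume "W \<in> R\<^sup>* `` {V}"
    then have "(V, W) \<in> R\<^sup>*" by simp
    then show "W \<in> \<V>" using that by (induction rule: rtrancl_induct) (auto simp: R_def)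
  qed
  let ?P = "\<lambda>V. \<Union>(R\<^sup>* `` {V})"
  have opP: "openin X (?P V)" if "V \<in> \<V>" for V
    using RV[OF that] \<V>(1) by (intro openin_Union) blast
  have clP: "closedin X (?P V)" if V: "V \<in> \<V>" for V
  proof -
    \<comment> \<open>A member outside the class meets none inside it, for otherwise the chain could
      be prolonged. The complement is therefore again a union of members.\<close>
    have "topspace X - ?P V = \<Union>(\<V> - R\<^sup>* `` {V})"
    proof
      show "topspace X - ?P V \<subseteq> \<Union>(\<V> - R\<^sup>* `` {V})" using \<V>(2) by blast
      show "\<Union>(\<V> - R\<^sup>* `` {V}) \<subseteq> topspace X - ?P V"
      proof
        fix x assume "x \<in> \<Union>(\<V> - R\<^sup>* `` {V})"
        then obtain W where W: "x \<in> W" "W \<in> \<V>" "(V, W) \<notin> R\<^sup>*" by blast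
        have "x \<notin> ?P V"
        proof
          assume "x \<in> ?P V"
          then obtain W' where W': "x \<in> W'" "(V, W') \<in> R\<^sup>*" by blast
          then have "(W', W) \<in> R" using W RV[OF V] by (auto simp: R_def)
          then show False using W' W by (meson rtrancl.rtrancl_into_rtrancl)
        qed
        then show "x \<in> topspace X - ?P V" using W \<V>(2) by blast
      qed
    qed
    moreover have "openin X (\<Union>(\<V> - R\<^sup>* `` {V}))" using \<V>(1) by (intro openin_Union) blast
    ultimately show ?thesis using openin_subset[OF opP[OF V]] by (simp add: closedin_def)
  qed
  \<comment> \<open>A connected component that meets a clopen set lies in it. One class per
    component is enough, so countably many classes cover the space.\<close>
  have "\<exists>V\<in>\<V>. C \<subseteq> ?P V" if C: "C \<in> connected_components_of X" for C
  proof -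
    obtain x where x: "x \<in> C" using nonempty_connected_components_of[OF C] by blast
    then have "x \<in> topspace X" using C Union_connected_components_of[of X] by auto
    then obtain V where V: "V \<in> \<V>" "x \<in> V" using \<V>(2) by blast
    have "C \<subseteq> ?P V \<or> disjnt C (?P V)"
      using connectedin_clopen_cases[OF connectedin_connected_components_of[OF C] clP[OF V(1)] opP[OF V(1)]] .
    moreover have "x \<in> ?P V" using V(2) by blast
    ultimately show ?thesis using V(1) x by (auto simp: disjnt_iff)
  qed
  then obtain v where v: "\<And>C. C \<in> connected_components_of X \<Longrightarrow> v C \<in> \<V>"
      "\<And>C. C \<in> connected_components_of X \<Longrightarrow> C \<subseteq> ?P (v C)" by metis
  define \<W> where "\<W> = (\<Union>C\<in>connected_components_of X. R\<^sup>* `` {v C})"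
  have sub: "\<W> \<subseteq> \<V>" using RV v(1) by (auto simp: \<W>_def)
  show ?thesis
  proof (rule that[of \<W>])
    show "countable \<W>" unfolding \<W>_def using comp countR by (intro countable_UN) auto
    show "openin X W \<and> (\<exists>K. compactin X K \<and> W \<subseteq> K)" if "W \<in> \<W>" for W
      using sub that \<V>(1) rc by blast
    have "topspace X = \<Union>(connected_components_of X)" by (simp add: Union_connected_components_of)
    also have "\<dots> \<subseteq> \<Union>\<W>"
    proof
      fix x assume "x \<in> \<Union>(connected_components_of X)"
      then obtain C where "C \<in> connected_components_of X" "x \<in> C" by blast
      then show "x \<in> \<Union>\<W>" using v(2) unfolding \<W>_def by blast
    qed
    finally show "\<Union>\<W> = topspace X" using sub \<V>(2) by blast
  qed
qed

lemma compact_exhaustion: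
  assumes lc: "locally_compact_space X" and pc: "paracompact_space X"
    and comp: "countable (connected_components_of X)"
  obtains K where "\<And>n::nat. compactin X (K n)" "\<And>n. K n \<subseteq> X interior_of (K (Suc n))"
    "(\<Union>n. K n) = topspace X"
proof -
  obtain \<W> where \<W>: "countable \<W>" "\<And>W. W \<in> \<W> \<Longrightarrow> openin X W \<and> (\<exists>K. compactin X K \<and> W \<subseteq> K)"
      "\<Union>\<W> = topspace X"
    by (rule countable_relatively_compact_cover[OF assms]; blast)
  \<comment> \<open>Adding the empty set allows an enumeration even if the cover is empty.\<close>
  define w where "w = from_nat_into (insert {} \<W>)"
  have ran: "range w = insert {} \<W>" unfolding w_def using \<W>(1) by (intro range_from_nat_into) auto
  have w: "openin X (w n) \<and> (\<exists>K. compactin X K \<and> w n \<subseteq> K)" for n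
  proof -
    have "w n \<in> insert {} \<W>" using ran by blast
    then show ?thesis using \<W>(2) by auto
  qed
  then obtain c where c: "\<And>n. compactin X (c n)" "\<And>n. w n \<subseteq> c n" by metis
  have wX: "(\<Union>n. w n) = topspace X" using ran \<W>(3) by auto
  define B where "B m = (\<Union>i<m. c i)" for m
  have B: "compactin X (B m)" for m unfolding B_def using c by (intro compactin_Union) auto
  have "\<exists>m'>m. B m \<subseteq> (\<Union>i<m'. w i)" for m
  proof -
    have "\<exists>n. x \<in> w n" if "x \<in> B m" for x
      using that wX compactin_subset_topspace[OF B] by blast
    then obtain \<nu> where \<nu>: "\<And>x. x \<in> B m \<Longrightarrow> x \<in> w (\<nu> x)" by metis
    obtain T where T: "finite T" "T \<subseteq> B m" "B m \<subseteq> (\<Union>x\<in>T. w (\<nu> x))"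
      by (rule compactin_choose_finite[where N = "\<lambda>x. w (\<nu> x)", OF B]) (use \<nu> w in blast)+
    define m' where "m' = Suc (Max (insert m (\<nu> ` T)))"
    have "\<nu> x < m'" if "x \<in> T" for x
      unfolding m'_def using that T(1) by (auto simp: less_Suc_eq_le intro!: Max_ge)
    then have "B m \<subseteq> (\<Union>i<m'. w i)" using T(3) by blast
    moreover have "m < m'" unfolding m'_def using T(1) by (auto simp: less_Suc_eq_le intro!: Max_ge)
    ultimately show ?thesis by blast
  qed
  then have "\<forall>m. \<exists>m'. m < m' \<and> B m \<subseteq> (\<Union>i<m'. w i)" by blast
  from choice[OF this] obtain s where s: "\<And>m. m < s m" "\<And>m. B m \<subseteq> (\<Union>i<s m. w i)" by blast
  \<comment> \<open>The first s m open sets cover B m. Iterating s puts each chosen compact set into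
    the interior of the next, and n \<le> k n ensures that everything is reached.\<close>
  define k where "k n = (s ^^ n) 0" for n
  have kS: "k (Suc n) = s (k n)" for n by (simp add: k_def)
  have kn: "n \<le> k n" for n
    by (induction n) (use kS s(1) in \<open>auto simp: Suc_le_eq intro: le_less_trans\<close>)
  show ?thesis
  proof (rule that[of "\<lambda>n. B (k n)"])
    show "compactin X (B (k n))" for n by (rule B)
    show "B (k n) \<subseteq> X interior_of B (k (Suc n))" for n
    proof -
      have "B (k n) \<subseteq> (\<Union>i<s (k n). w i)" by (rule s(2))
      also have "\<dots> \<subseteq> X interior_of B (s (k n))"
        using c(2) w by (intro interior_of_maximal openin_Union) (auto simp: B_def)
      finally show ?thesis by (simp add: kS)
    qed
    show "(\<Union>n. B (k n)) = topspace X"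
    proof
      show "(\<Union>n. B (k n)) \<subseteq> topspace X" using compactin_subset_topspace[OF B] by blast
      show "topspace X \<subseteq> (\<Union>n. B (k n))"
      proof
        fix x assume "x \<in> topspace X"
        then obtain n where "x \<in> w n" using wX by blast
        then have "x \<in> c n" using c(2) by blast
        moreover have "n < k (Suc n)" using kn[of "Suc n"] by simp
        ultimately show "x \<in> (\<Union>n. B (k n))" unfolding B_def by blast
      qed
    qed
  qed
qed

section \<open>Finitely many colours\<close>

text \<open>Members are pairs of an open set and a compact core; the cores cover. The shells of an
  exhaustion are taken modulo 3, so that shells of the same colour do not interact.\<close>

lemma manifold_coloured_refinement:
  assumes X: "Hausdorff_space X" and pc: "paracompact_space X"
    and comp: "countable (connected_components_of X)" and A: "locally_Euclidean_by d X A"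
    and U: "\<And>i. i \<in> I \<Longrightarrow> openin X (U i)" and XU: "topspace X \<subseteq> (\<Union>i\<in>I. U i)"
  obtains F :: "nat \<Rightarrow> ('a set \<times> 'a set) set" where "\<And>c. countable (F c)"
    "\<And>c e e'. e \<in> F c \<Longrightarrow> e' \<in> F c \<Longrightarrow> e \<noteq> e' \<Longrightarrow> fst e \<inter> fst e' = {}"
    "\<And>c e. e \<in> F c \<Longrightarrow> openin X (fst e) \<and> compactin X (snd e) \<and> snd e \<subseteq> fst e \<and>
      (\<exists>i\<in>I. fst e \<subseteq> U i) \<and> (\<exists>V p. (V, p) \<in> A \<and> fst e \<subseteq> V)"
    "\<And>c x. x \<in> topspace X \<Longrightarrow> \<exists>N. openin X N \<and> x \<in> N \<and> finite {e \<in> F c. fst e \<inter> N \<noteq> {}}"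
    "topspace X \<subseteq> (\<Union>c<3 * 2 ^ d. \<Union>e\<in>F c. snd e)"
proof -
  note lc = locally_Euclidean_imp_locally_compact[OF A]
  obtain K where K: "\<And>n::nat. compactin X (K n)" "\<And>n. K n \<subseteq> X interior_of (K (Suc n))"
      "(\<Union>n. K n) = topspace X"
    by (rule compact_exhaustion[OF lc pc comp]; blast)
  have KS: "K n \<subseteq> K (Suc n)" for n by (rule subset_trans[OF K(2) interior_of_subset])
  have Kmono: "K m \<subseteq> K n" if "m \<le> n" for m n by (rule lift_Suc_mono_le[of K, OF KS that])
  \<comment> \<open>Compact shells S n and their open thickenings G n, which lie in K (n + 1) and,
    from n = 2 on, avoid K (n - 2). Thickenings whose indices differ by at least 3 are disjoint. The
    first indices are separate because subtraction is truncated.\<close>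
  define S where "S n = (if n = 0 then K 0 else K n \<inter> (topspace X - X interior_of (K (n - 1))))" for n
  define G where "G n = (if n < 2 then X interior_of (K (Suc n)) else X interior_of (K (Suc n)) - K (n - 2))" for n
  have S: "compactin X (S n)" for n
    unfolding S_def using K(1) by (auto intro!: compact_Int_closedin)
  have opG: "openin X (G n)" for n
    unfolding G_def using compactin_imp_closedin[OF X K(1)] by (auto intro!: openin_diff)
  have SG: "S n \<subseteq> G n" for n
  proof (cases "n < 2")
    case True
    then show ?thesis using K(2)[of n] by (auto simp: S_def G_def)
  next
    case False
    then have "Suc (n - 2) = n - 1" by simp
    then have "K (n - 2) \<subseteq> X interior_of (K (n - 1))" using K(2)[of "n - 2"] by metis
    then show ?thesis using False K(2)[of n] by (auto simp: S_def G_def)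
  qed
  have GK: "G n \<subseteq> K (Suc n)" for n using interior_of_subset[of X "K (Suc n)"] by (auto simp: G_def)
  have disjG: "G n \<inter> K m = {}" if "m + 2 \<le> n" for n m
  proof -
    have "m \<le> n - 2" using that by linarith
    then show ?thesis using that Kmono[of m "n - 2"] by (auto simp: G_def)
  qed
  \<comment> \<open>Indexing by pairs refines the cover, the chart domains and the thickened shell
    at the same time.\<close>
  let ?J = "I \<times> A" and ?U = "\<lambda>n (i, c). U i \<inter> fst c \<inter> G n"
  have opU: "openin X (?U n j)" if "j \<in> ?J" for n j
  proof -
    obtain i V p where j: "j = (i, (V, p))" by (metis surj_pair)
    then have "openin X V" using that A by (auto simp: locally_Euclidean_by_def is_chart_def)
    then show ?thesis using that j U opG by (auto intro!: openin_Int)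
  qed
  have SU: "S n \<subseteq> (\<Union>j\<in>?J. ?U n j)" for n
  proof
    fix x assume x: "x \<in> S n"
    then have xX: "x \<in> topspace X" using compactin_subset_topspace[OF S] by blast
    obtain V p where "(V, p) \<in> A" "x \<in> V" using locally_Euclidean_byE[OF A xX] by metis
    moreover obtain i where "i \<in> I" "x \<in> U i" using xX XU by blast
    ultimately have "(i, (V, p)) \<in> ?J" "x \<in> ?U n (i, (V, p))" using x SG by auto
    then show "x \<in> (\<Union>j\<in>?J. ?U n j)" by blast
  qed
  define Q where "Q n F \<kappa> \<longleftrightarrow> (\<forall>k. finite (F k)) \<and> (\<forall>k. disjoint (F k)) \<and>
     (\<forall>k V. V \<in> F k \<longrightarrow> openin X V \<and> (\<exists>j\<in>?J. V \<subseteq> ?U n j)) \<and>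
     (\<forall>V. compactin X (\<kappa> V)) \<and> (\<forall>V. \<kappa> V \<subseteq> V) \<and> S n \<subseteq> (\<Union>k<2 ^ d. \<Union>V\<in>F k. \<kappa> V)"
    for n and F :: "nat \<Rightarrow> 'a set set" and \<kappa>
  have "\<forall>n. \<exists>H. Q n (fst H) (snd H)"
  proof
    fix n
    obtain F :: "nat \<Rightarrow> 'a set set" and \<kappa> where "Q n F \<kappa>"
      unfolding Q_def
      by (rule compact_coloured_refinement[where I = ?J and U = "?U n", OF X A S opU SU]; blast)
    then show "\<exists>H. Q n (fst H) (snd H)" by (intro exI[of _ "(F, \<kappa>)"]) simp
  qed
  from choice[OF this] obtain H where H: "\<And>n. Q n (fst (H n)) (snd (H n))" by blast
  define f where "f n = fst (H n)" for n
  define \<kappa> where "\<kappa> n = snd (H n)" for n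
  have fQ: "Q n (f n) (\<kappa> n)" for n using H by (simp add: f_def \<kappa>_def)
  have f1: "finite (f n k)" for n k using fQ[of n, unfolded Q_def] by (elim conjE allE)
  have f2: "disjoint (f n k)" for n k using fQ[of n, unfolded Q_def] by (elim conjE allE)
  have f34: "openin X V \<and> (\<exists>j\<in>?J. V \<subseteq> ?U n j)" if "V \<in> f n k" for n k V
  proof -
    have "\<forall>k V. V \<in> f n k \<longrightarrow> openin X V \<and> (\<exists>j\<in>?J. V \<subseteq> ?U n j)"
      using fQ[of n, unfolded Q_def] by (elim conjE)
    then show ?thesis using that by (elim allE[of _ k] allE[of _ V] mp)
  qed
  have f5: "compactin X (\<kappa> n V)" for n V using fQ[of n, unfolded Q_def] by (elim conjE allE)
  have f6: "\<kappa> n V \<subseteq> V" for n V using fQ[of n, unfolded Q_def] by (elim conjE allE)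
  have f7: "S n \<subseteq> (\<Union>k<2 ^ d. \<Union>V\<in>f n k. \<kappa> n V)" for n using fQ[of n, unfolded Q_def] by (elim conjE)
  note f = f1 f2 f34[THEN conjunct1] f34[THEN conjunct2] f5 f6 f7
  have fG: "V \<subseteq> G n" if "V \<in> f n k" for n k V using f(4)[OF that] by auto
  \<comment> \<open>Colour c stands for the colour c div 3 within a shell and the residue c mod 3 of
    the shell. A piece carries its core along because \<kappa> depends on the shell.\<close>
  define F where "F c = (\<Union>n\<in>{n. n mod 3 = c mod 3}. (\<lambda>V. (V, \<kappa> n V)) ` f n (c div 3))" for c
  have FE: "\<exists>n V. e = (V, \<kappa> n V) \<and> V \<in> f n (c div 3) \<and> n mod 3 = c mod 3" if "e \<in> F c" for e c
    using that by (auto simp: F_def)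
  show ?thesis
  proof (rule that[of F])
    show "countable (F c)" for c
      unfolding F_def using f(1) by (intro countable_UN countable_image) (auto intro: countable_finite)
    show "fst e \<inter> fst e' = {}" if e: "e \<in> F c" "e' \<in> F c" "e \<noteq> e'" for c e e'
    proof -
      obtain n V where n: "e = (V, \<kappa> n V)" "V \<in> f n (c div 3)" "n mod 3 = c mod 3" using FE[OF e(1)] by blast
      obtain m W where m: "e' = (W, \<kappa> m W)" "W \<in> f m (c div 3)" "m mod 3 = c mod 3" using FE[OF e(2)] by blast
      have sep: "G a \<inter> G b = {}" if "a < b" "a mod 3 = b mod 3" for a b :: nat
      proof -
        have "Suc a + 2 \<le> b" using that by presburger
        then show ?thesis using disjG GK by blast
      qed
      consider "n = m" | "n < m" | "m < n" by linarith
      then show ?thesis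
      proof cases
        case 1
        then have "V \<noteq> W" using e(3) n m by auto
        then show ?thesis using f(2) n m 1 by (auto simp: disjoint_def)
      next
        case 2
        then show ?thesis using sep[of n m] fG[OF n(2)] fG[OF m(2)] n m by auto
      next
        case 3
        then show ?thesis using sep[of m n] fG[OF n(2)] fG[OF m(2)] n m by auto
      qed
    qed
    show "openin X (fst e) \<and> compactin X (snd e) \<and> snd e \<subseteq> fst e \<and> (\<exists>i\<in>I. fst e \<subseteq> U i) \<and>
        (\<exists>V p. (V, p) \<in> A \<and> fst e \<subseteq> V)" if e: "e \<in> F c" for c e
    proof -
      obtain n V where n: "e = (V, \<kappa> n V)" "V \<in> f n (c div 3)" using FE[OF e] by blast
      from f(4)[OF n(2)] obtain j where j: "j \<in> ?J" "V \<subseteq> ?U n j" by (elim bexE)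
      obtain i W p where ij: "j = (i, (W, p))" by (metis surj_pair)
      have "i \<in> I" "V \<subseteq> U i" "(W, p) \<in> A" "V \<subseteq> W" using j ij by auto
      then show ?thesis using n f(3)[OF n(2)] f(5,6) by auto
    qed
    show "\<exists>N. openin X N \<and> x \<in> N \<and> finite {e \<in> F c. fst e \<inter> N \<noteq> {}}" if "x \<in> topspace X" for c x
    proof -
      obtain m where m: "x \<in> K m" using K(3) \<open>x \<in> topspace X\<close> by blast
      let ?N = "X interior_of K (Suc m)"
      \<comment> \<open>From index m + 3 on the thickened shells avoid K (m + 1).\<close>
      have "{e \<in> F c. fst e \<inter> ?N \<noteq> {}} \<subseteq> (\<Union>n<m + 3. (\<lambda>V. (V, \<kappa> n V)) ` f n (c div 3))"
      proof
        fix e assume e: "e \<in> {e \<in> F c. fst e \<inter> ?N \<noteq> {}}"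
        then obtain n V where n: "e = (V, \<kappa> n V)" "V \<in> f n (c div 3)" using FE by blast
        have "G n \<inter> K (Suc m) \<noteq> {}" using e n fG[OF n(2)] interior_of_subset[of X "K (Suc m)"] by auto
        then have "n < m + 3" using disjG[of "Suc m" n] by (cases "n < m + 3") auto
        then show "e \<in> (\<Union>n<m + 3. (\<lambda>V. (V, \<kappa> n V)) ` f n (c div 3))" using n by blast
      qed
      moreover have "finite (\<Union>n<m + 3. (\<lambda>V. (V, \<kappa> n V)) ` f n (c div 3))" using f(1) by auto
      ultimately have "finite {e \<in> F c. fst e \<inter> ?N \<noteq> {}}" by (rule finite_subset)
      then show ?thesis using subsetD[OF K(2) m] by (intro exI[of _ ?N]) auto
    qed
    show "topspace X \<subseteq> (\<Union>c<3 * 2 ^ d. \<Union>e\<in>F c. snd e)"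
    proof
      fix x assume x: "x \<in> topspace X"
      then have ex: "\<exists>n. x \<in> K n" using K(3) by blast
      define n where "n = (LEAST n. x \<in> K n)"
      have xn: "x \<in> K n" unfolding n_def using ex by (rule LeastI_ex)
      have "x \<notin> K (n - 1)" if "n \<noteq> 0"
        using not_less_Least[of "n - 1" "\<lambda>n. x \<in> K n"] that unfolding n_def[symmetric] by simp
      then have "x \<in> S n" using xn x interior_of_subset[of X "K (n - 1)"] by (auto simp: S_def)
      then obtain k V where k: "k < 2 ^ d" "V \<in> f n k" "x \<in> \<kappa> n V" using f(7) by blast
      let ?c = "3 * k + n mod 3"
      have c: "?c div 3 = k" "?c mod 3 = n mod 3" "?c < 3 * 2 ^ d" using k(1) by auto
      have "(V, \<kappa> n V) \<in> F ?c" unfolding F_def c using k by blast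
      then show "x \<in> (\<Union>c<3 * 2 ^ d. \<Union>e\<in>F c. snd e)" using k c(3) by force
    qed
  qed
qed

section \<open>The embedding\<close>

text \<open>Differentiating \<psi> \<circ> \<phi> = id shows that the Jacobian matrix of \<phi> has
  a left inverse. It is applied to transition maps between charts.\<close>

lemma left_inverse_injective_deriv:
  assumes S: "openin (Euclidean_space d) S" and T: "openin (Euclidean_space n) T"
    and \<phi>: "\<phi> ` S \<subseteq> T" "\<And>s. s < n \<Longrightarrow> Ck_on 1 d S (\<lambda>x. \<phi> x s)"
    and \<psi>: "\<And>j. j < d \<Longrightarrow> Ck_on 1 n T (\<lambda>z. \<psi> z j)" "\<And>x. x \<in> S \<Longrightarrow> \<psi> (\<phi> x) = x"
    and y: "y \<in> S" and v: "\<And>s. s < n \<Longrightarrow> (\<Sum>i<d. v i * partial_deriv i (\<lambda>x. \<phi> x s) y) = 0"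
    and j: "j < d"
  shows "v j = 0"
proof -
  have D: "(\<Sum>s<n. partial_deriv s (\<lambda>z. \<psi> z j) (\<phi> y) * partial_deriv i (\<lambda>x. \<phi> x s) y) = (if i = j then 1 else 0)"
    if i: "i < d" for i
  proof (rule DERIV_unique)
    show "((\<lambda>t. \<psi> (\<phi> (y(i := t))) j) has_real_derivative
        (\<Sum>s<n. partial_deriv s (\<lambda>z. \<psi> z j) (\<phi> y) * partial_deriv i (\<lambda>x. \<phi> x s) y)) (at (y i))"
      by (rule partial_deriv_compose[OF S T \<psi>(1)[OF j] \<phi>(2) \<phi>(1) y i])
    have "((\<lambda>t. (y(i := t)) j) has_real_derivative (if i = j then 1 else 0)) (at (y i))"
      by (auto intro!: derivative_eq_intros)
    then show "((\<lambda>t. \<psi> (\<phi> (y(i := t))) j) has_real_derivative (if i = j then 1 else 0)) (at (y i))"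
    proof (rule DERIV_cong_ev[THEN iffD1, OF refl _ refl, rotated])
      show "\<forall>\<^sub>F t in nhds (y i). (y(i := t)) j = \<psi> (\<phi> (y(i := t))) j"
        using openin_Euclidean_eventually_upd[OF S y i] by eventually_elim (simp only: \<psi>(2))
    qed
  qed
  have "v j = (\<Sum>i<d. if i = j then v i else 0)" using j by simp
  also have "\<dots> = (\<Sum>i<d. v i * (if i = j then 1 else 0))" by (intro sum.cong) auto
  also have "\<dots> = (\<Sum>i<d. v i * (\<Sum>s<n. partial_deriv s (\<lambda>z. \<psi> z j) (\<phi> y) * partial_deriv i (\<lambda>x. \<phi> x s) y))"
    using D by (intro sum.cong) auto
  also have "\<dots> = (\<Sum>s<n. partial_deriv s (\<lambda>z. \<psi> z j) (\<phi> y) * (\<Sum>i<d. v i * partial_deriv i (\<lambda>x. \<phi> x s) y))"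
    unfolding sum_distrib_left by (subst sum.swap) (simp add: mult_ac)
  also have "\<dots> = 0" using v by simp
  finally show ?thesis .
qed

section \<open>Gluing functions along coloured charts\<close>

lemma continuous_map_Ck_on_compose:
  assumes "continuous_map X (Euclidean_space d) p" "Ck_on k d (cartesian d) g"
  shows "continuous_map X euclideanreal (\<lambda>x. g (p x))"
proof -
  have "continuous_map (Euclidean_space d) euclideanreal g"
    using Ck_on_le[OF _ assms(2), of 0] by simp
  from continuous_map_compose[OF assms(1) this] show ?thesis by (simp add: o_def)
qed

lemma smooth_atlas_transition:
  assumes A: "smooth_atlas d X A" and V: "(V, p) \<in> A" and W: "(W, q) \<in> A"
  shows "smooth_on d (p ` (V \<inter> W)) d (q \<circ> inv_into V p)"
proof -
  have "\<forall>(V, p)\<in>A. \<forall>(W, q)\<in>A. smooth_on d (p ` (V \<inter> W)) d (q \<circ> inv_into V p)"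
    using A unfolding smooth_atlas_def by (elim conjE)
  from bspec[OF bspec[OF this V, simplified] W] show ?thesis by simp
qed

text \<open>The outcome of all choices: a member \<open>e\<close> consists of an open piece and its
  core, \<open>V e\<close> and \<open>p e\<close> form a chart around the piece, and
  \<open>b e\<close> is a cut-off function in chart coordinates which vanishes off the compact set
  \<open>T e\<close> and is 1 on the neighbourhood \<open>N e\<close> of the core's image. The
  numbers \<open>w c e\<close> tell apart the members of colour c.\<close>

locale coloured_charts =
  fixes X :: "'a topology" and d :: nat and A :: "('a set \<times> ('a \<Rightarrow> nat \<Rightarrow> real)) set"
    and F :: "nat \<Rightarrow> ('a set \<times> 'a set) set" and m :: nat
    and V :: "'a set \<times> 'a set \<Rightarrow> 'a set" and p :: "'a set \<times> 'a set \<Rightarrow> 'a \<Rightarrow> nat \<Rightarrow> real"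
    and b :: "'a set \<times> 'a set \<Rightarrow> (nat \<Rightarrow> real) \<Rightarrow> real"
    and T N :: "'a set \<times> 'a set \<Rightarrow> (nat \<Rightarrow> real) set"
    and w :: "nat \<Rightarrow> 'a set \<times> 'a set \<Rightarrow> nat"
  assumes Hausdorff: "Hausdorff_space X"
    and charts: "\<And>c. c \<in> A \<Longrightarrow> is_chart d X c"
    and inj_w: "\<And>c. inj_on (w c) (F c)"
    and disj: "\<And>c e e'. e \<in> F c \<Longrightarrow> e' \<in> F c \<Longrightarrow> e \<noteq> e' \<Longrightarrow> fst e \<inter> fst e' = {}"
    and open_fst: "\<And>c e. e \<in> F c \<Longrightarrow> openin X (fst e)"
    and compact_snd: "\<And>c e. e \<in> F c \<Longrightarrow> compactin X (snd e)"
    and snd_sub: "\<And>c e. e \<in> F c \<Longrightarrow> snd e \<subseteq> fst e"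
    and loc_fin: "\<And>c x. x \<in> topspace X \<Longrightarrow> \<exists>G. openin X G \<and> x \<in> G \<and> finite {e \<in> F c. fst e \<inter> G \<noteq> {}}"
    and cover: "topspace X \<subseteq> (\<Union>c<m. \<Union>e\<in>F c. snd e)"
    and in_A: "\<And>c e. e \<in> F c \<Longrightarrow> (V e, p e) \<in> A"
    and fst_sub: "\<And>c e. e \<in> F c \<Longrightarrow> fst e \<subseteq> V e"
    and b_le_1: "\<And>c e x. e \<in> F c \<Longrightarrow> b e x \<le> 1"
    and T: "\<And>c e. e \<in> F c \<Longrightarrow> compactin (Euclidean_space d) (T e)" "\<And>c e. e \<in> F c \<Longrightarrow> T e \<subseteq> p e ` fst e"
    and b_eq_0: "\<And>c e x. e \<in> F c \<Longrightarrow> x \<in> cartesian d - T e \<Longrightarrow> b e x = 0"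
    and N: "\<And>c e. e \<in> F c \<Longrightarrow> openin (Euclidean_space d) (N e)" "\<And>c e. e \<in> F c \<Longrightarrow> p e ` snd e \<subseteq> N e"
    and b_eq_1: "\<And>c e x. e \<in> F c \<Longrightarrow> x \<in> N e \<Longrightarrow> b e x = 1"
    and b_Ck: "\<And>c e k. e \<in> F c \<Longrightarrow> Ck_on k d (cartesian d) (b e)"
begin

lemma chart: "e \<in> F c \<Longrightarrow> is_chart d X (V e, p e)"
  using charts in_A by blast

lemma p_cartesian: "e \<in> F c \<Longrightarrow> x \<in> V e \<Longrightarrow> p e x \<in> cartesian d"
  using chart_topspace(2)[OF chart] by blast

text \<open>Disjointness within a colour makes the described member unique, so the functions of a
  colour are combined without any sum. The cut-off factor makes the extension by 0 harmless.\<close>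

definition glue :: "nat \<Rightarrow> ('a set \<times> 'a set \<Rightarrow> (nat \<Rightarrow> real) \<Rightarrow> real) \<Rightarrow> 'a \<Rightarrow> real"
  where "glue c h x = (if \<exists>e\<in>F c. x \<in> fst e
    then let e = THE e. e \<in> F c \<and> x \<in> fst e in b e (p e x) * h e (p e x) else 0)"

lemma glue_eq:
  assumes "e \<in> F c" "x \<in> fst e"
  shows "glue c h x = b e (p e x) * h e (p e x)"
proof -
  have "(THE e. e \<in> F c \<and> x \<in> fst e) = e"
    using assms disj by (intro the_equality) blast+
  then show ?thesis using assms by (auto simp: glue_def Let_def)
qed

lemma glue_eq_0: "(\<And>e. e \<in> F c \<Longrightarrow> x \<notin> fst e) \<Longrightarrow> glue c h x = 0"
  by (auto simp: glue_def)

lemma glue_eq_core: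
  assumes "e \<in> F c" "x \<in> snd e"
  shows "glue c h x = h e (p e x)"
proof -
  have "x \<in> fst e" using assms snd_sub by blast
  moreover have "b e (p e x) = 1" using assms N(2) by (intro b_eq_1) blast+
  ultimately show ?thesis using glue_eq[OF assms(1)] by simp
qed

text \<open>A point outside all pieces may still be a limit of them. Near it only finitely many
  pieces matter, and the set where a cut-off function can be nonzero is contained in a compact,
  hence closed, subset of its piece; removing these sets leaves a neighbourhood.\<close>

lemma glue_locally_0:
  assumes x: "x \<in> topspace X" and notin: "\<And>e. e \<in> F c \<Longrightarrow> x \<notin> fst e"
  obtains G where "openin X G" "x \<in> G" "\<And>h y. y \<in> G \<Longrightarrow> glue c h y = 0"
proof -
  obtain G where G: "openin X G" "x \<in> G" "finite {e \<in> F c. fst e \<inter> G \<noteq> {}}"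
    using loc_fin[OF x] by blast
  define S where "S e = {y \<in> V e. p e y \<in> T e}" for e
  have S: "closedin X (S e)" if e: "e \<in> F c" for e
  proof -
    have "T e \<subseteq> p e ` V e" using T(2)[OF e] fst_sub[OF e] by blast
    then show ?thesis
      unfolding S_def
      using chart_compactin_preimage[OF chart[OF e] T(1)[OF e]] compactin_imp_closedin[OF Hausdorff] by blast
  qed
  have Sfst: "S e \<subseteq> fst e" if e: "e \<in> F c" for e
    unfolding S_def using T(2)[OF e] fst_sub[OF e] chart_inj_on[OF chart[OF e]] by (auto dest: inj_onD)
  let ?G = "G - (\<Union>e\<in>{e \<in> F c. fst e \<inter> G \<noteq> {}}. S e)"
  show ?thesis
  proof (rule that[of ?G])
    show "openin X ?G" using G S by (intro openin_diff closedin_Union) auto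
    show "x \<in> ?G" using G(2) notin Sfst by blast
    show "glue c h y = 0" if y: "y \<in> ?G" for h y
    proof (cases "\<exists>e\<in>F c. y \<in> fst e")
      case True
      then obtain e where e: "e \<in> F c" "y \<in> fst e" by blast
      then have "y \<notin> S e" using y by blast
      moreover have "y \<in> V e" using fst_sub e by blast
      ultimately have "p e y \<in> cartesian d - T e" using p_cartesian[OF e(1)] by (simp add: S_def)
      then show ?thesis using glue_eq[OF e] b_eq_0[OF e(1)] by simp
    qed (auto intro: glue_eq_0)
  qed
qed

lemma continuous_map_glue:
  assumes h: "\<And>e. e \<in> F c \<Longrightarrow> Ck_on 0 d (cartesian d) (h e)"
  shows "continuous_map X euclideanreal (glue c h)"
proof -
  have loc: "\<exists>G. openin X G \<and> x \<in> G \<and> continuous_map (subtopology X G) euclideanreal (glue c h)"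
    if x: "x \<in> topspace X" for x
  proof (cases "\<exists>e\<in>F c. x \<in> fst e")
    case True
    then obtain e where e: "e \<in> F c" "x \<in> fst e" by blast
    have "continuous_map (subtopology X (fst e)) (Euclidean_space d) (p e)"
      using chart_continuous_map[OF chart[OF e(1)]] fst_sub[OF e(1)]
      by (rule continuous_map_from_subtopology_mono)
    then have "continuous_map (subtopology X (fst e)) euclideanreal (\<lambda>y. b e (p e y) * h e (p e y))"
      using h[OF e(1)] b_Ck[OF e(1), of 0]
      by (intro continuous_map_real_mult continuous_map_Ck_on_compose[where k = 0 and d = d])
    then have "continuous_map (subtopology X (fst e)) euclideanreal (glue c h)"
      by (rule continuous_map_eq) (simp add: glue_eq[OF e(1)])
    then show ?thesis using open_fst[OF e(1)] e(2) by blast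
  next
    case False
    then obtain G where G: "openin X G" "x \<in> G" "\<And>h y. y \<in> G \<Longrightarrow> glue c h y = 0"
      using glue_locally_0[OF x] by blast
    have "continuous_map (subtopology X G) euclideanreal (\<lambda>_. 0)" by simp
    then have "continuous_map (subtopology X G) euclideanreal (glue c h)"
      by (rule continuous_map_eq) (simp add: G(3))
    then show ?thesis using G by blast
  qed
  then have "\<forall>x\<in>topspace X. \<exists>G. openin X G \<and> x \<in> G \<and> continuous_map (subtopology X G) euclideanreal (glue c h)" ..
  from bchoice[OF this] obtain G where G: "\<And>x. x \<in> topspace X \<Longrightarrow> openin X (G x)"
      "\<And>x. x \<in> topspace X \<Longrightarrow> x \<in> G x"
      "\<And>x. x \<in> topspace X \<Longrightarrow> continuous_map (subtopology X (G x)) euclideanreal (glue c h)"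
    by blast
  show ?thesis
    by (rule pasting_lemma[where I = "topspace X" and T = G and f = "\<lambda>_. glue c h"]) (use G in auto)
qed

text \<open>On a piece the glued function, read in the chart q, is a C^k function composed with a
  transition map; off the pieces it vanishes locally.\<close>

lemma Ck_on_glue:
  assumes A: "smooth_atlas d X A" and W: "(W, q) \<in> A"
    and h: "\<And>e. e \<in> F c \<Longrightarrow> Ck_on k d (cartesian d) (h e)"
  shows "Ck_on k d (q ` W) (\<lambda>y. glue c h (inv_into W q y))"
proof (rule Ck_on_local)
  note chW = charts[OF W]
  note invq = inv_into_f_f[OF chart_inj_on[OF chW]]
  show "openin (Euclidean_space d) (q ` W)" by (rule chart_homeomorphic_map(3)[OF chW])
  fix y assume "y \<in> q ` W"
  then obtain x where x: "x \<in> W" "y = q x" by blast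
  then have xX: "x \<in> topspace X" using chart_topspace[OF chW] by blast
  show "\<exists>S. openin (Euclidean_space d) S \<and> y \<in> S \<and> Ck_on k d S (\<lambda>y. glue c h (inv_into W q y))"
  proof (cases "\<exists>e\<in>F c. x \<in> fst e")
    case True
    then obtain e where e: "e \<in> F c" "x \<in> fst e" by blast
    let ?S = "q ` (W \<inter> fst e)"
    have S: "openin (Euclidean_space d) ?S"
      using chart_openin_image[OF chW] openin_Int[OF chart_homeomorphic_map(2)[OF chW] open_fst[OF e(1)]] by blast
    have "smooth_on d (q ` (W \<inter> V e)) d (p e \<circ> inv_into W q)"
      by (rule smooth_atlas_transition[OF A W in_A[OF e(1)]])
    then have "Ck_on k d (q ` (W \<inter> V e)) (\<lambda>y. p e (inv_into W q y) j)" if "j < d" for j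
      using that by (simp add: smooth_on_def)
    moreover have "?S \<subseteq> q ` (W \<inter> V e)" using fst_sub[OF e(1)] by blast
    ultimately have pk: "Ck_on k d ?S (\<lambda>y. p e (inv_into W q y) j)" if "j < d" for j
      using that by (blast intro: Ck_on_subset)
    have im: "(\<lambda>y. p e (inv_into W q y)) ` ?S \<subseteq> cartesian d"
      using p_cartesian[OF e(1)] fst_sub[OF e(1)] invq by auto
    have "Ck_on k d ?S (\<lambda>y. g (p e (inv_into W q y)))" if "Ck_on k d (cartesian d) g" for g
      by (rule Ck_on_compose[OF S openin_cartesian im that pk])
    from Ck_on_mult[OF S this[OF b_Ck[OF e(1)]] this[OF h[OF e(1)]]]
    have "Ck_on k d ?S (\<lambda>y. b e (p e (inv_into W q y)) * h e (p e (inv_into W q y)))" .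
    then have "Ck_on k d ?S (\<lambda>y. glue c h (inv_into W q y))"
      by (rule Ck_on_cong_imp[OF S, rotated]) (use invq glue_eq[OF e(1)] in auto)
    then show ?thesis using S x e by blast
  next
    case False
    then obtain G where G: "openin X G" "x \<in> G" "\<And>h y. y \<in> G \<Longrightarrow> glue c h y = 0"
      using glue_locally_0[OF xX] by blast
    let ?S = "q ` (W \<inter> G)"
    have S: "openin (Euclidean_space d) ?S"
      using chart_openin_image[OF chW] openin_Int[OF chart_homeomorphic_map(2)[OF chW] G(1)] by blast
    have "Ck_on k d ?S (\<lambda>y. 0)" by (rule Ck_on_const[OF S])
    then have "Ck_on k d ?S (\<lambda>y. glue c h (inv_into W q y))"
      by (rule Ck_on_cong_imp[OF S, rotated]) (use invq G(3) in auto)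
    then show ?thesis using S x G by blast
  qed
qed

text \<open>For every colour there are \<open>d\<close> cut-off chart coordinates, the cut-off function itself scaled
  so that a unit ball meeting its plateau stays in its support, and an exponential tag that
  separates the members of the same colour and tends to infinity.\<close>

definition slot :: "nat \<Rightarrow> nat \<Rightarrow> 'a set \<times> 'a set \<Rightarrow> (nat \<Rightarrow> real) \<Rightarrow> real"
  where "slot c s e z = (if s < d then z s else if s = d then 4 else 4 ^ Suc (w c e))"

definition dimension :: nat
  where "dimension = m * (d + 2)"

definition emb :: "'a \<Rightarrow> nat \<Rightarrow> real"
  where "emb x i = (if i < dimension then glue (i div (d + 2)) (slot (i div (d + 2)) (i mod (d + 2))) x else 0)"

lemma Ck_on_slot: "Ck_on k d (cartesian d) (slot c s e)"
  unfolding slot_def[abs_def]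
  by (cases "s < d"; cases "s = d") (simp_all del: Ck_on.simps add: Ck_on_coord Ck_on_const)

lemma emb_cartesian: "emb x \<in> cartesian dimension"
  by (simp add: cartesian_iff emb_def)

lemma emb_slot:
  assumes "c < m" "s < d + 2"
  shows "c * (d + 2) + s < dimension" "emb x (c * (d + 2) + s) = glue c (slot c s) x"
proof -
  have "c * (d + 2) + s < Suc c * (d + 2)" using assms(2) by simp
  also have "\<dots> \<le> m * (d + 2)" using assms(1) by (intro mult_right_mono) auto
  finally show 1: "c * (d + 2) + s < dimension" by (simp add: dimension_def)
  have "(c * D + s) div D = c" "(c * D + s) mod D = s" if "s < D" for D
    using that by simp_all
  note this[OF assms(2)]
  with 1 show "emb x (c * (d + 2) + s) = glue c (slot c s) x" by (simp only: emb_def if_True)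
qed

lemma continuous_map_emb: "continuous_map X (Euclidean_space dimension) emb"
proof (subst continuous_map_Euclidean_iff_coord)
  show "\<forall>j<dimension. continuous_map X euclideanreal (\<lambda>x. emb x j)"
    using continuous_map_glue[OF Ck_on_slot] by (simp add: emb_def[abs_def])
qed (use emb_cartesian in blast)

lemma core_exists:
  assumes "x \<in> topspace X"
  obtains c e where "c < m" "e \<in> F c" "x \<in> snd e"
proof -
  have "x \<in> (\<Union>c<m. \<Union>e\<in>F c. snd e)" using assms cover by (rule subsetD[rotated])
  then show ?thesis using that by blast
qed

text \<open>The plateau slot is 4 at x, so its value 4 \<rho> at y exceeds 2; hence y lies in a
  piece e' of the same colour and 1/2 < \<rho> \<le> 1. If e' had a larger number, its tag would be
  at least twice that of e even after multiplication by \<rho>, leaving a gap of at least 4. If it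
  had a smaller number, the tag of e would be at least four times the other, leaving a gap of at
  least 12.\<close>

lemma in_fst_of_close:
  assumes c: "c < m" and e: "e \<in> F c" and x: "x \<in> snd e"
    and close: "eucl_dist dimension (emb x) (emb y) < 2"
  shows "y \<in> fst e"
proof -
  have le: "\<bar>glue c (slot c s) x - glue c (slot c s) y\<bar> < 2" if "s < d + 2" for s
    using abs_coord_diff_le_eucl_dist[OF emb_slot(1)[OF c that], of "emb x" "emb y"] close
    unfolding emb_slot(2)[OF c that] by linarith
  have 4: "\<bar>4 - glue c (slot c d) y\<bar> < 2"
    using le[of d] glue_eq_core[OF e x, of "slot c d"] by (simp add: slot_def)
  then have "glue c (slot c d) y \<noteq> 0" by auto
  then obtain e' where e': "e' \<in> F c" "y \<in> fst e'" using glue_eq_0 by blast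
  define \<rho> where "\<rho> = b e' (p e' y)"
  have \<rho>: "\<rho> > 1 / 2" "\<rho> \<le> 1"
    using 4 glue_eq[OF e', of "slot c d"] b_le_1[OF e'(1)] by (auto simp: slot_def \<rho>_def)
  have tag: "\<bar>4 ^ Suc (w c e) - \<rho> * 4 ^ Suc (w c e')\<bar> < 2"
    using le[of "Suc d"] glue_eq_core[OF e x, of "slot c (Suc d)"] glue_eq[OF e', of "slot c (Suc d)"]
    by (simp add: slot_def \<rho>_def)
  have ge4: "(4::real) \<le> 4 ^ Suc j" for j using one_le_power[of "4::real" j] by simp
  have "w c e = w c e'"
  proof (rule ccontr)
    assume "w c e \<noteq> w c e'"
    then consider "w c e < w c e'" | "w c e' < w c e" by linarith
    then show False
    proof cases
      case 1
      then have "(4::real) ^ Suc (Suc (w c e)) \<le> 4 ^ Suc (w c e')" by (intro power_increasing) auto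
      then have "1 / 2 * (4 * 4 ^ Suc (w c e)) \<le> \<rho> * 4 ^ Suc (w c e')"
        using \<rho>(1) by (intro mult_mono) auto
      then show False using tag ge4[of "w c e"] by linarith
    next
      case 2
      then have "(4::real) ^ Suc (Suc (w c e')) \<le> 4 ^ Suc (w c e)" by (intro power_increasing) auto
      moreover have "\<rho> * 4 ^ Suc (w c e') \<le> 1 * 4 ^ Suc (w c e')" using \<rho>(2) by (intro mult_right_mono) auto
      moreover have "(4::real) ^ Suc (Suc (w c e')) = 4 * 4 ^ Suc (w c e')" by simp
      ultimately show False using tag ge4[of "w c e'"] by linarith
    qed
  qed
  then have "e = e'" using inj_onD[OF inj_w _ e e'(1)] by blast
  then show ?thesis using e' by simp
qed

section \<open>Injectivity, properness and immersion\<close>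

lemma inj_on_emb: "inj_on emb (topspace X)"
proof (rule inj_onI)
  fix x y assume x: "x \<in> topspace X" and y: "y \<in> topspace X" and eq: "emb x = emb y"
  obtain c e where c: "c < m" "e \<in> F c" "x \<in> snd e" using core_exists[OF x] by blast
  have ye: "y \<in> fst e" by (rule in_fst_of_close[OF c]) (simp add: eq eucl_dist_def)
  have xe: "x \<in> fst e" using c snd_sub by blast
  have geq: "glue c (slot c s) x = glue c (slot c s) y" if "s < d + 2" for s
    using emb_slot(2)[OF c(1) that] eq by metis
  \<comment> \<open>The plateau slot compares 4 with 4 times the cut-off value at y. Once that value
    is 1, the remaining slots show the chart coordinates of y undistorted.\<close>
  have "b e (p e y) = 1"
    using geq[of d] glue_eq_core[OF c(2,3), of "slot c d"] glue_eq[OF c(2) ye, of "slot c d"]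
    by (simp add: slot_def)
  then have "p e x s = p e y s" if "s < d" for s
    using geq[of s] glue_eq_core[OF c(2,3), of "slot c s"] glue_eq[OF c(2) ye, of "slot c s"] that
    by (simp add: slot_def)
  moreover have "p e x \<in> cartesian d" "p e y \<in> cartesian d"
    using p_cartesian[OF c(2)] fst_sub[OF c(2)] xe ye by blast+
  ultimately have "p e x = p e y" by (metis cartesian_iff ext not_le)
  then show "x = y" using chart_inj_on[OF chart[OF c(2)]] fst_sub[OF c(2)] xe ye by (auto dest: inj_onD)
qed

text \<open>On the core of a member the tag is exactly 4 ^ (w + 1). It is bounded on the preimage of
  a compact set, so this preimage is a closed subset of a finite union of compact cores.\<close>

lemma proper_map_emb: "proper_map X (Euclidean_space dimension) emb"
proof (rule compact_imp_proper_map)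
  show "k_space (Euclidean_space dimension)"
    using locally_compact_Euclidean_space Hausdorff_Euclidean_space locally_compact_imp_k_space by blast
  show "kc_space (Euclidean_space dimension)"
    using Hausdorff_Euclidean_space Hausdorff_imp_kc_space by blast
  show "emb \<in> topspace X \<rightarrow> topspace (Euclidean_space dimension)" using emb_cartesian by blast
  show "continuous_map X (Euclidean_space dimension) emb \<or> kc_space X" using continuous_map_emb by blast
  fix Q assume Q: "compactin (Euclidean_space dimension) Q"
  let ?P = "{x \<in> topspace X. emb x \<in> Q}"
  have "\<exists>R. \<forall>z\<in>Q. z i \<le> R" for i
  proof -
    have "compactin euclideanreal ((\<lambda>z. z i) ` Q)" by (rule image_compactin[OF Q continuous_map_Euclidean_coord])
    then have "bounded ((\<lambda>z. z i) ` Q)" by (simp add: compact_imp_bounded)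
    then have "bdd_above ((\<lambda>z. z i) ` Q)" by (rule bounded_imp_bdd_above)
    then show ?thesis by (auto simp: bdd_above_def)
  qed
  then obtain R where R: "\<And>i z. z \<in> Q \<Longrightarrow> z i \<le> R i" by metis
  define B where "B c = {e \<in> F c. 4 ^ Suc (w c e) \<le> R (c * (d + 2) + Suc d)}" for c
  have finB: "finite (B c)" for c
  proof -
    obtain j where j: "R (c * (d + 2) + Suc d) < 4 ^ j" using real_arch_pow[of 4] by auto
    have "w c ` B c \<subseteq> {..<j}"
    proof
      fix k assume "k \<in> w c ` B c"
      then have "(4::real) ^ Suc k < 4 ^ j" using j by (auto simp: B_def)
      then show "k \<in> {..<j}" by (simp del: power_Suc)
    qed
    moreover have "inj_on (w c) (B c)" using inj_w[of c] by (rule inj_on_subset) (auto simp: B_def)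
    ultimately show ?thesis using finite_subset finite_imageD by blast
  qed
  let ?K = "\<Union>c<m. \<Union>e\<in>B c. snd e"
  have "compactin X ?K"
    using finB compact_snd by (intro compactin_Union) (auto simp: B_def intro!: compactin_Union)
  moreover have "closedin X ?P"
    using continuous_map_emb compactin_imp_closedin[OF Hausdorff_Euclidean_space Q]
    by (rule closedin_continuous_map_preimage)
  moreover have "?P \<subseteq> ?K"
  proof
    fix x assume x: "x \<in> ?P"
    then have "x \<in> topspace X" by simp
    then obtain c e where c: "c < m" "e \<in> F c" "x \<in> snd e" by (rule core_exists)
    have "4 ^ Suc (w c e) = emb x (c * (d + 2) + Suc d)"
      using emb_slot(2)[OF c(1), of "Suc d"] glue_eq_core[OF c(2,3), of "slot c (Suc d)"] by (simp add: slot_def)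
    also have "\<dots> \<le> R (c * (d + 2) + Suc d)" using R x by blast
    finally have "e \<in> B c" using c by (simp add: B_def)
    then show "x \<in> ?K" using c by blast
  qed
  ultimately show "compactin X ?P" by (intro closed_compactin[of X ?K ?P])
qed

lemma embedding_map_emb: "embedding_map X (Euclidean_space dimension) emb"
  by (rule injective_closed_imp_embedding_map[OF continuous_map_emb proper_imp_closed_map[OF proper_map_emb] inj_on_emb])

lemma unit_ball_preimages_subordinate_emb:
  assumes "I \<noteq> {}" "\<And>c e. e \<in> F c \<Longrightarrow> \<exists>i\<in>I. fst e \<subseteq> U i"
  shows "unit_ball_preimages_subordinate X I U dimension emb"
  unfolding unit_ball_preimages_subordinate_def
proof
  fix z assume "z \<in> cartesian dimension"
  let ?P = "{x \<in> topspace X. emb x \<in> eucl_ball dimension z 1}"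
  show "\<exists>i\<in>I. ?P \<subseteq> U i"
  \<comment> \<open>A ball that misses the image still needs some index; this is where I must be
    nonempty.\<close>
  proof (cases "?P = {}")
    case True
    then show ?thesis using assms(1) by auto
  next
    case False
    then obtain x where x: "x \<in> topspace X" "emb x \<in> eucl_ball dimension z 1" by blast
    obtain c e where c: "c < m" "e \<in> F c" "x \<in> snd e" using core_exists[OF x(1)] by blast
    have "?P \<subseteq> fst e"
      using in_fst_of_close[OF c] eucl_dist_less_2_of_unit_ball[OF x(2)] by blast
    then show ?thesis using assms(2)[OF c(2)] by blast
  qed
qed

text \<open>Every point lies in the core of some member e. Near it the first d slots of the block of
  that colour are the chart coordinates of e, so in any other chart they form a transition map, and
  these d coordinates alone already make the derivative injective.\<close>

lemma smooth_immersion_emb: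
  assumes A: "smooth_atlas d X A"
  shows "smooth_immersion d A dimension emb"
  unfolding smooth_immersion_def
proof (clarify)
  fix W q assume W: "(W, q) \<in> A"
  note chW = charts[OF W]
  note invq = inv_into_f_f[OF chart_inj_on[OF chW]]
  have "Ck_on k d (q ` W) (\<lambda>y. (emb \<circ> inv_into W q) y j)" if "j < dimension" for j k
    using Ck_on_glue[OF A W Ck_on_slot] that by (simp add: emb_def)
  then have "smooth_on d (q ` W) dimension (emb \<circ> inv_into W q)"
    using emb_cartesian by (auto simp: smooth_on_def)
  moreover have "injective_deriv_at d dimension (emb \<circ> inv_into W q) y" if "y \<in> q ` W" for y
    unfolding injective_deriv_at_def
  proof (intro ballI impI)
    fix v assume v: "v \<in> cartesian d"
      and D: "\<forall>j<dimension. (\<Sum>i<d. v i * partial_deriv i (\<lambda>y. (emb \<circ> inv_into W q) y j) y) = 0"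
    obtain x where x: "x \<in> W" "y = q x" using \<open>y \<in> q ` W\<close> by blast
    then have "x \<in> topspace X" using chart_topspace[OF chW] by blast
    then obtain c e where c: "c < m" "e \<in> F c" "x \<in> snd e" by (rule core_exists)
    note chV = chart[OF c(2)]
    have xV: "x \<in> V e" using c snd_sub fst_sub by blast
    let ?\<phi> = "p e \<circ> inv_into W q" and ?\<psi> = "q \<circ> inv_into (V e) (p e)"
    let ?S = "q ` (W \<inter> V e)" and ?T = "p e ` (V e \<inter> W)"
    have oWV: "openin X (W \<inter> V e)"
      using chart_homeomorphic_map(2)[OF chW] chart_homeomorphic_map(2)[OF chV] by (rule openin_Int)
    have S: "openin (Euclidean_space d) ?S" using chart_openin_image[OF chW oWV] by blast
    have T: "openin (Euclidean_space d) ?T" using chart_openin_image[OF chV oWV] by (simp add: Int_commute)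
    have sm: "smooth_on d ?S d ?\<phi>" "smooth_on d ?T d ?\<psi>"
      using smooth_atlas_transition[OF A W in_A[OF c(2)]] smooth_atlas_transition[OF A in_A[OF c(2)] W]
      by blast+
    have \<phi>T: "?\<phi> ` ?S \<subseteq> ?T" using invq by auto
    have \<psi>\<phi>: "?\<psi> (?\<phi> z) = z" if "z \<in> ?S" for z
      using that invq inv_into_f_f[OF chart_inj_on[OF chV]] by auto
    have \<phi>C: "Ck_on 1 d ?S (\<lambda>z. ?\<phi> z s)" if "s < d" for s
      using sm(1) that unfolding smooth_on_def by blast
    have \<psi>C: "Ck_on 1 d ?T (\<lambda>z. ?\<psi> z j)" if "j < d" for j
      using sm(2) that unfolding smooth_on_def by blast
    \<comment> \<open>An open set around x on which the cut-off function is 1: equality at x alone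
      would say nothing about partial derivatives.\<close>
    define O' where "O' = {z \<in> V e. p e z \<in> N e} \<inter> fst e"
    have O': "openin X O'"
      unfolding O'_def using chart_openin_preimage[OF chV N(1)[OF c(2)]] open_fst[OF c(2)] by (rule openin_Int)
    have xO: "x \<in> O'" using c xV N(2)[OF c(2)] snd_sub[OF c(2)] by (auto simp: O'_def)
    let ?S' = "q ` (W \<inter> O')"
    have S': "openin (Euclidean_space d) ?S'"
      using chart_openin_image[OF chW] openin_Int[OF chart_homeomorphic_map(2)[OF chW] O'] by blast
    have yS': "y \<in> ?S'" using x xO by blast
    have coord: "(emb \<circ> inv_into W q) z (c * (d + 2) + s) = ?\<phi> z s" if "z \<in> ?S'" "s < d" for z s
    proof -
      obtain u where u: "u \<in> W" "u \<in> O'" "z = q u" using \<open>z \<in> ?S'\<close> by blast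
      have "u \<in> fst e" "b e (p e u) = 1" using u(2) b_eq_1[OF c(2)] by (auto simp: O'_def)
      then have "glue c (slot c s) u = p e u s" using glue_eq[OF c(2)] that(2) by (simp add: slot_def)
      then show ?thesis using u invq emb_slot(2)[OF c(1), of s u] that(2) by simp
    qed
    have "v j = 0" if "j < d" for j
    proof (rule left_inverse_injective_deriv[where \<phi> = ?\<phi> and \<psi> = ?\<psi>, OF S T \<phi>T \<phi>C \<psi>C \<psi>\<phi> _ _ that])
      show "y \<in> ?S" using x xV by blast
      fix s assume s: "s < d"
      have "partial_deriv i (\<lambda>z. ?\<phi> z s) y = partial_deriv i (\<lambda>z. (emb \<circ> inv_into W q) z (c * (d + 2) + s)) y"
        if "i < d" for i
        by (rule partial_deriv_cong[OF S' _ yS' that]) (simp only: coord s)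
      then show "(\<Sum>i<d. v i * partial_deriv i (\<lambda>z. ?\<phi> z s) y) = 0"
        using D emb_slot(1)[OF c(1), of s] s by simp
    qed
    then show "v = (\<lambda>i. 0)" using v by (auto simp: cartesian_iff fun_eq_iff not_less[symmetric])
  qed
  ultimately show "smooth_on d (q ` W) dimension (emb \<circ> inv_into W q) \<and>
      (\<forall>y\<in>q ` W. injective_deriv_at d dimension (emb \<circ> inv_into W q) y)"
    by blast
qed

end

text \<open>One map for both kinds of manifold: the smooth structure appears only as the premise of
  the last conclusion, so A may be an atlas or just any covering set of charts.\<close>

theorem manifold_subordinate_embedding:
  assumes X: "Hausdorff_space X" "paracompact_space X" "countable (connected_components_of X)"
    and A: "locally_Euclidean_by d X A" and I: "I \<noteq> {}" and cov: "open_cover X I U"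
  obtains n f where "embedding_map X (Euclidean_space n) f" "proper_map X (Euclidean_space n) f"
    "unit_ball_preimages_subordinate X I U n f" "smooth_atlas d X A \<Longrightarrow> smooth_immersion d A n f"
proof -
  have U: "openin X (U i)" if "i \<in> I" for i using cov that by (simp add: open_cover_def)
  have XU: "topspace X \<subseteq> (\<Union>i\<in>I. U i)" using cov by (simp add: open_cover_def)
  obtain F :: "nat \<Rightarrow> ('a set \<times> 'a set) set" where F: "\<And>c. countable (F c)"
    "\<And>c e e'. e \<in> F c \<Longrightarrow> e' \<in> F c \<Longrightarrow> e \<noteq> e' \<Longrightarrow> fst e \<inter> fst e' = {}"
    "\<And>c e. e \<in> F c \<Longrightarrow> openin X (fst e) \<and> compactin X (snd e) \<and> snd e \<subseteq> fst e \<and>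
      (\<exists>i\<in>I. fst e \<subseteq> U i) \<and> (\<exists>V p. (V, p) \<in> A \<and> fst e \<subseteq> V)"
    "\<And>c x. x \<in> topspace X \<Longrightarrow> \<exists>N. openin X N \<and> x \<in> N \<and> finite {e \<in> F c. fst e \<inter> N \<noteq> {}}"
    "topspace X \<subseteq> (\<Union>c<3 * 2 ^ d. \<Union>e\<in>F c. snd e)"
    by (rule manifold_coloured_refinement[where I = I and U = U, OF X A U XU]; blast)
  have chA: "is_chart d X c" if "c \<in> A" for c using A that by (simp add: locally_Euclidean_by_def)
  have "\<forall>e\<in>(\<Union>c. F c). \<exists>g. g \<in> A \<and> fst e \<subseteq> fst g" using F(3) by fastforce
  from bchoice[OF this] obtain g where g: "\<And>c e. e \<in> F c \<Longrightarrow> g e \<in> A" "\<And>c e. e \<in> F c \<Longrightarrow> fst e \<subseteq> fst (g e)"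
    by blast
  define Q where "Q e b T N \<longleftrightarrow> (\<forall>x. b x \<le> 1) \<and> compactin (Euclidean_space d) T \<and>
    T \<subseteq> snd (g e) ` fst e \<and> (\<forall>x\<in>cartesian d - T. b x = 0) \<and> openin (Euclidean_space d) N \<and>
    snd (g e) ` snd e \<subseteq> N \<and> (\<forall>x\<in>N. b x = 1) \<and> (\<forall>k. Ck_on k d (cartesian d) b)"
    for e and b :: "(nat \<Rightarrow> real) \<Rightarrow> real" and T N
  have "\<forall>e\<in>(\<Union>c. F c). \<exists>H. Q e (fst H) (fst (snd H)) (snd (snd H))"
  proof
    fix e assume "e \<in> (\<Union>c. F c)"
    then obtain c where e: "e \<in> F c" by blast
    have ch: "is_chart d X (fst (g e), snd (g e))" using chA g(1)[OF e] by simp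
    have 1: "openin (Euclidean_space d) (snd (g e) ` fst e)"
      using chart_openin_image[OF ch _ g(2)[OF e]] F(3)[OF e] by blast
    have 2: "compactin (Euclidean_space d) (snd (g e) ` snd e)"
      using chart_compactin_iff[OF ch, of "snd e"] F(3)[OF e] g(2)[OF e] by blast
    have 3: "snd (g e) ` snd e \<subseteq> snd (g e) ` fst e" using F(3)[OF e] by blast
    show "\<exists>H. Q e (fst H) (fst (snd H)) (snd (snd H))"
    proof (rule smooth_bump_function[OF 1 2 3])
      fix b T N
      assume "\<And>x. 0 \<le> b x" "\<And>x. b x \<le> 1" "compactin (Euclidean_space d) T" "T \<subseteq> snd (g e) ` fst e"
        "\<And>x. x \<in> cartesian d - T \<Longrightarrow> b x = 0" "openin (Euclidean_space d) N" "snd (g e) ` snd e \<subseteq> N"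
        "\<And>x. x \<in> N \<Longrightarrow> b x = 1" "\<And>k. Ck_on k d (cartesian d) b"
      then show "\<exists>H. Q e (fst H) (fst (snd H)) (snd (snd H))"
        unfolding Q_def by (intro exI[of _ "(b, T, N)"]) (simp del: Ck_on.simps)
    qed
  qed
  from bchoice[OF this] obtain H where H: "\<And>c e. e \<in> F c \<Longrightarrow> Q e (fst (H e)) (fst (snd (H e))) (snd (snd (H e)))"
    by blast
  \<comment> \<open>The tags take their exponents from an enumeration of each countable colour
    class.\<close>
  interpret coloured_charts X d A F "3 * 2 ^ d" "\<lambda>e. fst (g e)" "\<lambda>e. snd (g e)"
    "\<lambda>e. fst (H e)" "\<lambda>e. fst (snd (H e))" "\<lambda>e. snd (snd (H e))" "\<lambda>c. to_nat_on (F c)"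
    by unfold_locales (use X(1) chA F g H in \<open>auto simp: Q_def intro: inj_on_to_nat_on\<close>)
  show ?thesis
  proof (rule that[OF embedding_map_emb proper_map_emb])
    show "unit_ball_preimages_subordinate X I U dimension emb"
      using unit_ball_preimages_subordinate_emb[OF I] F(3) by blast
  qed (rule smooth_immersion_emb)
qed

theorem proposition1p4:
  shows
    "(\<forall>n (I :: 'i set) U.
        open_cover (Euclidean_space n) I U \<longrightarrow>
        (\<exists>f. diffeomorphism n f \<and>
             unit_ball_preimages_subordinate (Euclidean_space n) I U n f)) \<and>
     (\<forall>d (M :: 'a topology) A (I :: 'i set) U.
        smooth_manifold d M A \<and> countable (connected_components_of M) \<and>
        I \<noteq> {} \<and> open_cover M I U \<longrightarrow>
        (\<exists>n f. smooth_proper_embedding d M A n f \<and>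
               unit_ball_preimages_subordinate M I U n f)) \<and>
     (\<forall>d (M :: 'a topology) (I :: 'i set) U.
        topological_manifold d M \<and> countable (connected_components_of M) \<and>
        I \<noteq> {} \<and> open_cover M I U \<longrightarrow>
        (\<exists>n f. topological_proper_embedding M n f \<and>
               unit_ball_preimages_subordinate M I U n f))"
proof (intro conjI allI impI; (elim conjE)?)
  fix n and I :: "'i set" and U
  assume "open_cover (Euclidean_space n) I U"
  then show "\<exists>f. diffeomorphism n f \<and> unit_ball_preimages_subordinate (Euclidean_space n) I U n f"
    by (rule Euclidean_diffeomorphism_Lebesgue_number_1)
next
  fix d and M :: "'a topology" and A and I :: "'i set" and U
  assume M: "smooth_manifold d M A" and comp: "countable (connected_components_of M)"
    and I: "I \<noteq> {}" and cov: "open_cover M I U"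
  have A: "Hausdorff_space M" "paracompact_space M" "smooth_atlas d M A"
    using M by (simp_all add: smooth_manifold_def)
  then have "locally_Euclidean_by d M A"
    by (auto simp: smooth_atlas_def locally_Euclidean_by_def)
  then obtain n f where "embedding_map M (Euclidean_space n) f" "proper_map M (Euclidean_space n) f"
    "unit_ball_preimages_subordinate M I U n f" "smooth_atlas d M A \<Longrightarrow> smooth_immersion d A n f"
    using manifold_subordinate_embedding[OF A(1,2) comp _ I cov] by metis
  then show "\<exists>n f. smooth_proper_embedding d M A n f \<and> unit_ball_preimages_subordinate M I U n f"
    using A(3) unfolding smooth_proper_embedding_def by blast
next
  fix d and M :: "'a topology" and I :: "'i set" and U
  assume M: "topological_manifold d M" and comp: "countable (connected_components_of M)"
    and I: "I \<noteq> {}" and cov: "open_cover M I U"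
  have A: "Hausdorff_space M" "paracompact_space M"
    using M by (simp_all add: topological_manifold_def)
  \<comment> \<open>Without a given atlas, the set of all charts takes its place.\<close>
  have "locally_Euclidean_by d M {c. is_chart d M c}"
    using M by (fastforce simp: topological_manifold_def locally_Euclidean_by_def)
  then obtain n f where "embedding_map M (Euclidean_space n) f" "proper_map M (Euclidean_space n) f"
    "unit_ball_preimages_subordinate M I U n f"
    using manifold_subordinate_embedding[OF A comp _ I cov] by metis
  then show "\<exists>n f. topological_proper_embedding M n f \<and> unit_ball_preimages_subordinate M I U n f"
    unfolding topological_proper_embedding_def by blast
qed

end
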